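(* Let $V_n\subset V_h$, $Q_n\subset H_{\mathrm{div}}(\Omega)$ and $t_f\in H_{\mathrm{div}}(\mathcal{T}_h,f)$ be the reduced space, the reduced flux space and the offset flux produced by the greedy basis generation described in the context, and suppose that the bilinear form $a_{h,\mu}$ on $V_h\times V_h$ depends separably on $\mu\in\mathcal{P}$. For $\mu\in\mathcal{P}$ let $u_{n,\mu}\in V_n$ be the reduced solution, i.e. the unique element of $V_n$ with $$a_{h,\mu}(u_{n,\mu},v_n)=(f,v_n)_{L^2(\Omega)}\quad\text{for all }v_n\in V_n,$$ let $\Pi_0 u_{n,\mu}\in Q_n$ be the unique solution of $$(\Pi_0 u_{n,\mu},q_n)_{H_{\mathrm{div}}(\Omega)}=(R_{h,\mu}u_{n,\mu}-t_f,\,q_n)_{H_{\mathrm{div}}(\Omega)}\quad\text{for all }q_n\in Q_n,$$ and define the reduced flux reconstruction $t_{n,\mu}:=\Pi_0u_{n,\mu}+t_f$. Then for every $\mu\in\mathcal{P}$ the flux $t_{n,\mu}$ is locally conservative, that is, $t_{n,\mu}\in H_{\mathrm{div}}(\mathcal{T}_h,f)$, i.e. $t_{n,\mu}\in H_{\mathrm{div}}(\Omega)$ and $$\int_K\nabla\cdot t_{n,\mu}\,\mathrm{d}x=\int_K f\,\mathrm{d}x\quad\text{for all }K\in\mathcal{T}_h.$$ Moreover, all computations required to obtain $t_{n,\mu}$ depend separably on $\mu$: the bilinear forms $V_n\times V_n\ni(v,w)\mapsto a_{h,\mu}(v,w)$ and $V_n\times Q_n\ni(v,q)\mapsto(R_{h,\mu}v,q)_{H_{\mathrm{div}}(\Omega)}$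 depend separably on $\mu$, while the remaining quantities in the two linear systems, namely $w\mapsto(f,w)_{L^2(\Omega)}$ on $V_n$, $q\mapsto(t_f,q)_{H_{\mathrm{div}}(\Omega)}$ on $Q_n$ and the inner product $(p,q)\mapsto(p,q)_{H_{\mathrm{div}}(\Omega)}$ on $Q_n\times Q_n$, as well as $t_f$ itself, do not depend on $\mu$.
   Context: **Problem data.** $\Omega\subset\mathbb{R}^d$, $d\in\{2,3\}$, is a bounded domain with polygonal boundary, $\mathcal{P}\subset\mathbb{R}^p$ ($p\in\mathbb{N}$) is a compact parameter domain, $f\in L^2(\Omega)$, and for each $\mu\in\mathcal{P}$ the coefficient $\sigma_\mu\in L^\infty(\Omega)$ is uniformly positive. The underlying problem is $-\nabla\cdot(\sigma_\mu\nabla u_\mu)=f$ with $u_\mu\in H^1_0(\Omega)$. The traces of $\sigma_\mu|_K$ on the faces of each grid element $K$, needed in the face integrals below, are assumed to be well-defined bounded functions. **Grid.** $\mathcal{T}_h$ is a (finite) conforming simplicial partition of $\Omega$ into disjoint elements $K$ with $\bigcup_{K}\overline K=\overline\Omega$, and $\mathcal{F}_h$ is its set of faces: each $\Gamma\in\mathcal{F}_h$ is either an inner face shared by exactly two distinct elements $K^-,K^+$, $\Gamma=\overline{K^-}\cap\overline{K^+}$, or a boundary face of a single element $K^-$ contained in $\partial\Omega$. Let $h_\Gamma:=\operatorname{diam}(\Gamma)$ and let $n$ be the unit normal on $\Gamma$ pointing away from $K^-$. For a function $v$ that may be two-valued on $\Gamma$, with $v^\pm:=v|_{K^\pm}$,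 put $\langle v\rangle:=\tfrac12(v^-+v^+)$, $[v]:=v^--v^+$ on inner faces and $\langle v\rangle:=[v]:=v$ on boundary faces. **Discontinuous Galerkin approximation.** $V_h:=\{v\in L^2(\Omega)\mid v|_K\in\mathbb{P}_1(K)\ \forall K\in\mathcal{T}_h\}$, with $\mathbb{P}_1(K)$ the polynomials of degree at most $1$ on $K$. For a penalty parameter $\nu>0$ set $$a_{h,\mu}(u,v):=\sum_{K\in\mathcal{T}_h}\int_K(\sigma_\mu\nabla u)\cdot\nabla v\,\mathrm{d}x+\sum_{\Gamma\in\mathcal{F}_h}\int_\Gamma-\langle(\sigma_\mu\nabla v)\cdot n\rangle[u]-\langle(\sigma_\mu\nabla u)\cdot n\rangle[v]+\tfrac{\nu}{h_\Gamma}[u][v]\,\mathrm{d}s .$$ The parameter $\nu$ is fixed, large enough that $a_{h,\mu}$ is coercive on $V_h$ for all $\mu\in\mathcal{P}$, and also when $\sigma_\mu$ is replaced by the constant $1$. The DG solution $u_{h,\mu}\in V_h$ is the unique solution of $a_{h,\mu}(u_{h,\mu},v_h)=(f,v_h)_{L^2(\Omega)}$ for all $v_h\in V_h$. **Fluxes.** $H_{\mathrm{div}}(\Omega):=\{q\in L^2(\Omega)^d\mid\nabla\cdot q\in L^2(\Omega)\}$ with inner product $(p,q)_{H_{\mathrm{div}}(\Omega)}=(p,q)_{L^2(\Omega)^d}+(\nabla\cdot p,\nabla\cdot q)_{L^2(\Omega)}$. For $g\in L^2(\Omega)$, $$H_{\mathrm{div}}(\mathcal{T}_h,g):=\{q\in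 H_{\mathrm{div}}(\Omega)\mid(\nabla\cdot q,1)_{L^2(K)}=(g,1)_{L^2(K)}\ \forall K\in\mathcal{T}_h\}.$$ $Q_h\subset H_{\mathrm{div}}(\Omega)$ is the lowest-order (order $0$) Raviart–Thomas–Nédélec space on $\mathcal{T}_h$, whose elements are uniquely determined by their normal fluxes $\int_\Gamma q\cdot n\,\mathrm{d}s$, $\Gamma\in\mathcal{F}_h$. The diffusive flux reconstruction $R_{h,\mu}:V_h\to Q_h$ is the linear operator defined by $$\int_\Gamma R_{h,\mu}(v_h)\cdot n\,\mathrm{d}s=\int_\Gamma-\langle(\sigma_\mu\nabla v_h)\cdot n\rangle+\tfrac{\nu}{h_\Gamma}[v_h]\,\mathrm{d}s\quad\text{for all }\Gamma\in\mathcal{F}_h .$$ **Separable dependence.** A $\mu$-dependent (bi)linear form or operator $b_\mu$ depends separably on $\mu$ if $b_\mu=\sum_{\xi=1}^{\Xi}\theta_\xi(\mu)\,b_\xi$ for some $\Xi\in\mathbb{N}$, parameter functionals $\theta_\xi:\mathcal{P}\to\mathbb{R}$ and $\mu$-independent component (bi)linear forms or operators $b_\xi$. **Greedy generation of $V_n$, $Q_n$, $t_f$.** Let $\mathcal{P}_{\mathrm{train}}\subset\mathcal{P}$ be a finite training set and $\delta>0$ a tolerance. Let $t_f:=R_{h,1}u_{h,f}$, where $u_{h,f}\in V_h$ is the DG solution and $R_{h,1}$ the flux reconstruction for the coefficient $\sigma_\mu$ replaced by the constant $1$ (same $f$ and $\nu$). Start with $V_0=\{0\}$, $Q_0=\{0\}$.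 For $k\ge1$, as long as $\max_{\mu\in\mathcal{P}_{\mathrm{train}}}\eta_{k-1}(\mu)>\delta$, choose $\mu_k\in\operatorname{argmax}_{\mu\in\mathcal{P}_{\mathrm{train}}}\eta_{k-1}(\mu)$ and set $$V_k:=\operatorname{span}(V_{k-1}\cup\{u_{h,\mu_k}\}),\qquad Q_k:=\operatorname{span}(Q_{k-1}\cup\{t_{h,\mu_k}-t_f\}),\qquad t_{h,\mu_k}:=R_{h,\mu_k}u_{h,\mu_k}.$$ Here $\eta_k(\mu):=\underline{\sigma}_\mu\,\|(f,\cdot)_{L^2(\Omega)}-a_{h,\mu}(u_{k,\mu},\cdot)\|_{-1}$, where $\underline\sigma_\mu>0$ is the (essential) minimum of $\sigma_\mu$ over $\Omega$, $\|\cdot\|_{-1}$ is the dual norm with respect to a fixed norm on $V_h$, and $u_{k,\mu}\in V_k$ is the Galerkin solution $a_{h,\mu}(u_{k,\mu},v)=(f,v)_{L^2(\Omega)}$ for all $v\in V_k$. The spaces $V_n$, $Q_n$ are those obtained after $n$ steps. *)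

theory Defs
  imports "HOL-Analysis.Analysis"
begin

text \<open>
  Elements of Lebesgue spaces are represented by functions on the whole space; only their values
  almost everywhere in \<open>\<Omega>\<close> matter, and equality in \<open>L\<^sup>2(\<Omega>)\<close> is \<open>ae_eq \<Omega>\<close>.
\<close>

section \<open>Function spaces\<close>

definition ae_eq :: "'a::euclidean_space set \<Rightarrow> ('a \<Rightarrow> 'b) \<Rightarrow> ('a \<Rightarrow> 'b) \<Rightarrow> bool" where
  "ae_eq \<Omega> u v \<longleftrightarrow> (AE x in lebesgue_on \<Omega>. u x = v x)"

definition L2 :: "'a::euclidean_space set \<Rightarrow> ('a \<Rightarrow> 'b::euclidean_space) set" where
  "L2 \<Omega> = {v. v \<in> borel_measurable (lebesgue_on \<Omega>) \<and>
               integrable (lebesgue_on \<Omega>) (\<lambda>x. (norm (v x))\<^sup>2)}"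

definition L2_inner ::
  "'a::euclidean_space set \<Rightarrow> ('a \<Rightarrow> 'b::euclidean_space) \<Rightarrow> ('a \<Rightarrow> 'b) \<Rightarrow> real" where
  "L2_inner \<Omega> u v = (LINT x|lebesgue_on \<Omega>. u x \<bullet> v x)"

definition Linf :: "'a::euclidean_space set \<Rightarrow> ('a \<Rightarrow> real) set" where
  "Linf \<Omega> = {v. v \<in> borel_measurable (lebesgue_on \<Omega>) \<and>
                (\<exists>C. AE x in lebesgue_on \<Omega>. \<bar>v x\<bar> \<le> C)}"

definition uniformly_positive :: "'a::euclidean_space set \<Rightarrow> ('a \<Rightarrow> real) \<Rightarrow> bool" where
  "uniformly_positive \<Omega> s \<longleftrightarrow> (\<exists>c>0. AE x in lebesgue_on \<Omega>. c \<le> s x)"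

definition ess_min :: "'a::euclidean_space set \<Rightarrow> ('a \<Rightarrow> real) \<Rightarrow> real" where
  "ess_min \<Omega> s = Sup {c. AE x in lebesgue_on \<Omega>. c \<le> s x}"

definition gradient :: "('a::euclidean_space \<Rightarrow> real) \<Rightarrow> 'a \<Rightarrow> 'a" where
  "gradient p x = (THE g. GDERIV p x :> g)"

text \<open>Test functions are of class \<open>C\<^sup>1\<close> with compact support in \<open>\<Omega>\<close>; by mollification this gives the
  same weak divergence as smooth test functions.\<close>

definition test_function :: "'a::euclidean_space set \<Rightarrow> ('a \<Rightarrow> real) \<Rightarrow> bool" where
  "test_function \<Omega> \<phi> \<longleftrightarrow>
     (\<forall>x. \<phi> differentiable (at x)) \<and> continuous_on UNIV (gradient \<phi>) \<and>
     compact (closure {x. \<phi> x \<noteq> 0}) \<and> closure {x. \<phi> x \<noteq> 0} \<subseteq> \<Omega>"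

definition is_weak_div ::
  "'a::euclidean_space set \<Rightarrow> ('a \<Rightarrow> 'a) \<Rightarrow> ('a \<Rightarrow> real) \<Rightarrow> bool" where
  "is_weak_div \<Omega> q g \<longleftrightarrow>
     g \<in> L2 \<Omega> \<and> (\<forall>\<phi>. test_function \<Omega> \<phi> \<longrightarrow> L2_inner \<Omega> q (gradient \<phi>) = - L2_inner \<Omega> g \<phi>)"

definition Hdiv :: "'a::euclidean_space set \<Rightarrow> ('a \<Rightarrow> 'a) set" where
  "Hdiv \<Omega> = {q \<in> L2 \<Omega>. \<exists>g. is_weak_div \<Omega> q g}"

text \<open>The weak divergence is unique up to \<open>ae_eq \<Omega>\<close>; \<open>SOME\<close> selects a representative.\<close>

definition weak_div :: "'a::euclidean_space set \<Rightarrow> ('a \<Rightarrow> 'a) \<Rightarrow> 'a \<Rightarrow> real" where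
  "weak_div \<Omega> q = (SOME g. is_weak_div \<Omega> q g)"

definition hdiv_inner ::
  "'a::euclidean_space set \<Rightarrow> ('a \<Rightarrow> 'a) \<Rightarrow> ('a \<Rightarrow> 'a) \<Rightarrow> real" where
  "hdiv_inner \<Omega> p q = L2_inner \<Omega> p q + L2_inner \<Omega> (weak_div \<Omega> p) (weak_div \<Omega> q)"

definition Hdiv_mesh ::
  "'a::euclidean_space set \<Rightarrow> 'a set set \<Rightarrow> ('a \<Rightarrow> real) \<Rightarrow> ('a \<Rightarrow> 'a) set" where
  "Hdiv_mesh \<Omega> T g = {q \<in> Hdiv \<Omega>. \<forall>K\<in>T.
     (LINT x|lebesgue_on K. weak_div \<Omega> q x) = (LINT x|lebesgue_on K. g x)}"


section \<open>Domain, grid and faces\<close>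

text \<open>The condition \<open>interior (closure \<Omega>) = \<Omega>\<close> excludes slits: no part of the boundary has \<open>\<Omega>\<close> on
  both of its sides.\<close>

definition polygonal_domain :: "'a::euclidean_space set \<Rightarrow> bool" where
  "polygonal_domain \<Omega> \<longleftrightarrow>
     open \<Omega> \<and> connected \<Omega> \<and> bounded \<Omega> \<and> \<Omega> \<noteq> {} \<and> interior (closure \<Omega>) = \<Omega> \<and>
     (\<exists>B. finite B \<and> (\<forall>b\<in>B. polytope b \<and> aff_dim b = int DIM('a) - 1) \<and> frontier \<Omega> = \<Union>B)"

definition mesh_faces :: "'a::euclidean_space set set \<Rightarrow> 'a set set" where
  "mesh_faces T = {\<Gamma>. \<exists>K\<in>T. \<Gamma> facet_of K}"

definition face_elems :: "'a::euclidean_space set set \<Rightarrow> 'a set \<Rightarrow> 'a set set" where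
  "face_elems T \<Gamma> = {K \<in> T. \<Gamma> facet_of K}"

text \<open>A grid is given by the closures of its elements, which are closed nondegenerate simplices;
  \<^const>\<open>triangulation\<close> says that any two of them meet in a common face (possibly empty).\<close>

definition conforming_mesh :: "'a::euclidean_space set \<Rightarrow> 'a set set \<Rightarrow> bool" where
  "conforming_mesh \<Omega> T \<longleftrightarrow>
     triangulation T \<and> (\<forall>K\<in>T. int DIM('a) simplex K) \<and> \<Union>T = closure \<Omega> \<and>
     (\<forall>\<Gamma>\<in>mesh_faces T.
        (\<exists>K1 K2. K1 \<noteq> K2 \<and> face_elems T \<Gamma> = {K1, K2} \<and> \<Gamma> = K1 \<inter> K2) \<or>
        (\<exists>K. face_elems T \<Gamma> = {K} \<and> \<Gamma> \<subseteq> frontier \<Omega>))"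

text \<open>\<open>Km \<Gamma>\<close> is the element called \<open>K\<^sup>-\<close> on the face \<open>\<Gamma>\<close>; on inner faces this is an arbitrary choice.\<close>

definition mesh_orientation ::
  "'a::euclidean_space set set \<Rightarrow> ('a set \<Rightarrow> 'a set) \<Rightarrow> bool" where
  "mesh_orientation T Km \<longleftrightarrow> (\<forall>\<Gamma>\<in>mesh_faces T. Km \<Gamma> \<in> face_elems T \<Gamma>)"

definition inner_face :: "'a::euclidean_space set set \<Rightarrow> 'a set \<Rightarrow> bool" where
  "inner_face T \<Gamma> \<longleftrightarrow> card (face_elems T \<Gamma>) = 2"

definition Kplus ::
  "'a::euclidean_space set set \<Rightarrow> ('a set \<Rightarrow> 'a set) \<Rightarrow> 'a set \<Rightarrow> 'a set" where
  "Kplus T Km \<Gamma> = (THE K. K \<in> face_elems T \<Gamma> \<and> K \<noteq> Km \<Gamma>)"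

text \<open>The unit normal on \<open>\<Gamma>\<close> pointing away from \<open>Km \<Gamma>\<close>. Since \<open>\<Gamma> \<subseteq> Km \<Gamma>\<close>, the condition forces \<open>n\<close> to
  be orthogonal to \<open>\<Gamma>\<close>.\<close>

definition face_normal :: "('a::euclidean_space set \<Rightarrow> 'a set) \<Rightarrow> 'a set \<Rightarrow> 'a" where
  "face_normal Km \<Gamma> = (THE n. norm n = 1 \<and> (\<forall>x\<in>\<Gamma>. \<forall>y\<in>Km \<Gamma>. n \<bullet> (y - x) \<le> 0))"

text \<open>Surface measure on a flat face \<open>\<Gamma>\<close> of codimension one: the Lebesgue measure of the slab of
  thickness 1 over \<open>\<Gamma>\<close>, pushed forward under the orthogonal projection onto the hyperplane of \<open>\<Gamma>\<close>.\<close>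

definition face_slab :: "'a::euclidean_space set \<Rightarrow> 'a set" where
  "face_slab \<Gamma> = {x. closest_point (affine hull \<Gamma>) x \<in> \<Gamma> \<and>
                     dist x (closest_point (affine hull \<Gamma>) x) \<le> 1/2}"

definition surface_measure :: "'a::euclidean_space set \<Rightarrow> 'a measure" where
  "surface_measure \<Gamma> = completion
     (distr (restrict_space lborel (face_slab \<Gamma>)) borel (closest_point (affine hull \<Gamma>)))"


section \<open>Traces, averages and jumps\<close>

text \<open>Trace at boundary points of \<open>K\<close> of the restriction to \<open>K\<close> of a function in \<open>L\<^sup>\<infinity>\<close>: the limit of
  its mean values over \<open>K \<inter> ball x r\<close>. It does not depend on the representative.\<close>

definition local_mean :: "('a::euclidean_space \<Rightarrow> real) \<Rightarrow> 'a set \<Rightarrow> 'a \<Rightarrow> real \<Rightarrow> real" where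
  "local_mean s K x r =
     (LINT y|lebesgue_on (K \<inter> ball x r). s y) / measure lebesgue (K \<inter> ball x r)"

definition face_trace :: "('a::euclidean_space \<Rightarrow> real) \<Rightarrow> 'a set \<Rightarrow> 'a \<Rightarrow> real" where
  "face_trace s K x = Lim (at_right 0) (local_mean s K x)"

definition bounded_face_traces ::
  "'a::euclidean_space set set \<Rightarrow> ('a \<Rightarrow> real) \<Rightarrow> bool" where
  "bounded_face_traces T s \<longleftrightarrow> (\<forall>K\<in>T. \<forall>\<Gamma>. \<Gamma> facet_of K \<longrightarrow>
     (AE x in surface_measure \<Gamma>. \<exists>l. (local_mean s K x \<longlongrightarrow> l) (at_right 0)) \<and>
     face_trace s K \<in> borel_measurable (surface_measure \<Gamma>) \<and>
     (\<exists>C. AE x in surface_measure \<Gamma>. \<bar>face_trace s K x\<bar> \<le> C))"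

text \<open>In the following two definitions \<open>w K\<close> is the restriction to \<open>K\<close> of a piecewise function.\<close>

definition face_avg ::
  "'a::euclidean_space set set \<Rightarrow> ('a set \<Rightarrow> 'a set) \<Rightarrow> ('a set \<Rightarrow> 'a \<Rightarrow> real) \<Rightarrow> 'a set \<Rightarrow> 'a \<Rightarrow> real"
  where "face_avg T Km w \<Gamma> x =
     (if inner_face T \<Gamma> then (w (Km \<Gamma>) x + w (Kplus T Km \<Gamma>) x) / 2 else w (Km \<Gamma>) x)"

definition face_jump ::
  "'a::euclidean_space set set \<Rightarrow> ('a set \<Rightarrow> 'a set) \<Rightarrow> ('a set \<Rightarrow> 'a \<Rightarrow> real) \<Rightarrow> 'a set \<Rightarrow> 'a \<Rightarrow> real"
  where "face_jump T Km w \<Gamma> x =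
     (if inner_face T \<Gamma> then w (Km \<Gamma>) x - w (Kplus T Km \<Gamma>) x else w (Km \<Gamma>) x)"


section \<open>Discontinuous Galerkin form\<close>

definition P1 :: "('a::euclidean_space \<Rightarrow> real) set" where
  "P1 = {p. \<exists>g c. \<forall>x. p x = g \<bullet> x + c}"

text \<open>The unique polynomial in the local space \<open>S\<close> that represents \<open>v\<close> on \<open>K\<close>. It is used for the
  restriction of \<open>v\<close> to \<open>K\<close> and for its trace on the faces of \<open>K\<close>.\<close>

definition elem_poly ::
  "('a::euclidean_space \<Rightarrow> 'b) set \<Rightarrow> ('a \<Rightarrow> 'b) \<Rightarrow> 'a set \<Rightarrow> 'a \<Rightarrow> 'b" where
  "elem_poly S v K = (THE p. p \<in> S \<and> ae_eq K v p)"

definition dg_space :: "'a::euclidean_space set \<Rightarrow> 'a set set \<Rightarrow> ('a \<Rightarrow> real) set" where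
  "dg_space \<Omega> T = {v \<in> L2 \<Omega>. \<forall>K\<in>T. \<exists>p\<in>P1. ae_eq K v p}"

definition normal_diffusion ::
  "('a::euclidean_space set \<Rightarrow> 'a set) \<Rightarrow> ('a \<Rightarrow> real) \<Rightarrow> ('a \<Rightarrow> real) \<Rightarrow> 'a set \<Rightarrow> 'a set \<Rightarrow> 'a \<Rightarrow> real"
  where "normal_diffusion Km s v \<Gamma> K x =
     (face_trace s K x *\<^sub>R gradient (elem_poly P1 v K) x) \<bullet> face_normal Km \<Gamma>"

definition dg_form ::
  "'a::euclidean_space set set \<Rightarrow> ('a set \<Rightarrow> 'a set) \<Rightarrow> real \<Rightarrow> ('a \<Rightarrow> real) \<Rightarrow>
   ('a \<Rightarrow> real) \<Rightarrow> ('a \<Rightarrow> real) \<Rightarrow> real" where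
  "dg_form T Km \<nu> s u v =
     (\<Sum>K\<in>T. LINT x|lebesgue_on K.
        (s x *\<^sub>R gradient (elem_poly P1 u K) x) \<bullet> gradient (elem_poly P1 v K) x) +
     (\<Sum>\<Gamma>\<in>mesh_faces T. LINT x|surface_measure \<Gamma>.
        - face_avg T Km (normal_diffusion Km s v \<Gamma>) \<Gamma> x * face_jump T Km (elem_poly P1 u) \<Gamma> x
        - face_avg T Km (normal_diffusion Km s u \<Gamma>) \<Gamma> x * face_jump T Km (elem_poly P1 v) \<Gamma> x
        + \<nu> / diameter \<Gamma> * face_jump T Km (elem_poly P1 u) \<Gamma> x * face_jump T Km (elem_poly P1 v) \<Gamma> x)"

definition is_norm_on ::
  "'a::euclidean_space set \<Rightarrow> ('a \<Rightarrow> real) set \<Rightarrow> (('a \<Rightarrow> real) \<Rightarrow> real) \<Rightarrow> bool" where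
  "is_norm_on \<Omega> V N \<longleftrightarrow>
     (\<forall>v\<in>V. 0 \<le> N v \<and> (N v = 0 \<longleftrightarrow> ae_eq \<Omega> v (\<lambda>x. 0))) \<and>
     (\<forall>v\<in>V. \<forall>c. N (\<lambda>x. c * v x) = \<bar>c\<bar> * N v) \<and>
     (\<forall>v\<in>V. \<forall>w\<in>V. N (\<lambda>x. v x + w x) \<le> N v + N w)"

definition coercive_on ::
  "('a \<Rightarrow> real) set \<Rightarrow> (('a \<Rightarrow> real) \<Rightarrow> real) \<Rightarrow>
   (('a \<Rightarrow> real) \<Rightarrow> ('a \<Rightarrow> real) \<Rightarrow> real) \<Rightarrow> bool" where
  "coercive_on V N b \<longleftrightarrow> (\<exists>\<alpha>>0. \<forall>v\<in>V. \<alpha> * (N v)\<^sup>2 \<le> b v v)"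

definition dual_norm ::
  "('a \<Rightarrow> real) set \<Rightarrow> (('a \<Rightarrow> real) \<Rightarrow> real) \<Rightarrow> (('a \<Rightarrow> real) \<Rightarrow> real) \<Rightarrow> real" where
  "dual_norm V N l = (SUP v\<in>{v\<in>V. N v \<le> 1}. \<bar>l v\<bar>)"

definition galerkin_solution ::
  "'v set \<Rightarrow> ('v \<Rightarrow> 'v \<Rightarrow> real) \<Rightarrow> ('v \<Rightarrow> real) \<Rightarrow> 'v \<Rightarrow> bool" where
  "galerkin_solution V A l u \<longleftrightarrow> u \<in> V \<and> (\<forall>v\<in>V. A u v = l v)"

definition uniquely_solvable ::
  "'a::euclidean_space set \<Rightarrow> ('a \<Rightarrow> 'b) set \<Rightarrow>
   (('a \<Rightarrow> 'b) \<Rightarrow> ('a \<Rightarrow> 'b) \<Rightarrow> real) \<Rightarrow> (('a \<Rightarrow> 'b) \<Rightarrow> real) \<Rightarrow> bool" where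
  "uniquely_solvable \<Omega> V A l \<longleftrightarrow>
     (\<exists>u. galerkin_solution V A l u) \<and>
     (\<forall>u u'. galerkin_solution V A l u \<longrightarrow> galerkin_solution V A l u' \<longrightarrow> ae_eq \<Omega> u u')"


section \<open>Flux reconstruction\<close>

definition RT0 :: "('a::euclidean_space \<Rightarrow> 'a) set" where
  "RT0 = {p. \<exists>a b. \<forall>x. p x = a + b *\<^sub>R x}"

definition rt_space :: "'a::euclidean_space set \<Rightarrow> 'a set set \<Rightarrow> ('a \<Rightarrow> 'a) set" where
  "rt_space \<Omega> T = {q \<in> Hdiv \<Omega>. \<forall>K\<in>T. \<exists>p\<in>RT0. ae_eq K q p}"

text \<open>Normal components of functions in \<open>rt_space \<Omega> T\<close> are continuous across inner faces, so taking
  the trace from \<open>Km \<Gamma>\<close> is no restriction.\<close>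

definition normal_flux :: "('a::euclidean_space set \<Rightarrow> 'a set) \<Rightarrow> ('a \<Rightarrow> 'a) \<Rightarrow> 'a set \<Rightarrow> real" where
  "normal_flux Km q \<Gamma> =
     (LINT x|surface_measure \<Gamma>. elem_poly RT0 q (Km \<Gamma>) x \<bullet> face_normal Km \<Gamma>)"

text \<open>Linearity on spaces of functions modulo \<open>ae_eq \<Omega>\<close>.\<close>

definition linear_operator_on ::
  "'a::euclidean_space set \<Rightarrow> ('a \<Rightarrow> 'b::real_vector) set \<Rightarrow>
   (('a \<Rightarrow> 'b) \<Rightarrow> 'a \<Rightarrow> 'c::real_vector) \<Rightarrow> bool" where
  "linear_operator_on \<Omega> V L \<longleftrightarrow>
     (\<forall>u\<in>V. \<forall>v\<in>V. ae_eq \<Omega> u v \<longrightarrow> ae_eq \<Omega> (L u) (L v)) \<and>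
     (\<forall>u\<in>V. \<forall>v\<in>V. \<forall>\<alpha> \<beta>.
        ae_eq \<Omega> (L (\<lambda>x. \<alpha> *\<^sub>R u x + \<beta> *\<^sub>R v x)) (\<lambda>x. \<alpha> *\<^sub>R L u x + \<beta> *\<^sub>R L v x))"

definition flux_reconstruction ::
  "'a::euclidean_space set \<Rightarrow> 'a set set \<Rightarrow> ('a set \<Rightarrow> 'a set) \<Rightarrow> real \<Rightarrow> ('a \<Rightarrow> real) \<Rightarrow>
   (('a \<Rightarrow> real) \<Rightarrow> 'a \<Rightarrow> 'a) \<Rightarrow> bool" where
  "flux_reconstruction \<Omega> T Km \<nu> s R \<longleftrightarrow>
     linear_operator_on \<Omega> (dg_space \<Omega> T) R \<and>
     (\<forall>v\<in>dg_space \<Omega> T. R v \<in> rt_space \<Omega> T \<and>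
       (\<forall>\<Gamma>\<in>mesh_faces T. normal_flux Km (R v) \<Gamma> =
          (LINT x|surface_measure \<Gamma>.
             - face_avg T Km (normal_diffusion Km s v \<Gamma>) \<Gamma> x
             + \<nu> / diameter \<Gamma> * face_jump T Km (elem_poly P1 v) \<Gamma> x)))"


section \<open>Separable parameter dependence\<close>

definition bilinear_form_on ::
  "'a::euclidean_space set \<Rightarrow> ('a \<Rightarrow> 'b::real_vector) set \<Rightarrow> ('a \<Rightarrow> 'c::real_vector) set \<Rightarrow>
   (('a \<Rightarrow> 'b) \<Rightarrow> ('a \<Rightarrow> 'c) \<Rightarrow> real) \<Rightarrow> bool" where
  "bilinear_form_on \<Omega> V W b \<longleftrightarrow>
     (\<forall>v\<in>V. \<forall>v'\<in>V. \<forall>w\<in>W. \<forall>w'\<in>W. ae_eq \<Omega> v v' \<longrightarrow> ae_eq \<Omega> w w' \<longrightarrow> b v w = b v' w') \<and>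
     (\<forall>v\<in>V. \<forall>v'\<in>V. \<forall>w\<in>W. \<forall>\<alpha> \<beta>.
        b (\<lambda>x. \<alpha> *\<^sub>R v x + \<beta> *\<^sub>R v' x) w = \<alpha> * b v w + \<beta> * b v' w) \<and>
     (\<forall>v\<in>V. \<forall>w\<in>W. \<forall>w'\<in>W. \<forall>\<alpha> \<beta>.
        b v (\<lambda>x. \<alpha> *\<^sub>R w x + \<beta> *\<^sub>R w' x) = \<alpha> * b v w + \<beta> * b v w')"

definition depends_separably ::
  "'a::euclidean_space set \<Rightarrow> 'p set \<Rightarrow> ('a \<Rightarrow> 'b::real_vector) set \<Rightarrow> ('a \<Rightarrow> 'c::real_vector) set \<Rightarrow>
   ('p \<Rightarrow> ('a \<Rightarrow> 'b) \<Rightarrow> ('a \<Rightarrow> 'c) \<Rightarrow> real) \<Rightarrow> bool" where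
  "depends_separably \<Omega> P V W b \<longleftrightarrow>
     (\<exists>(\<Xi>::nat) (\<theta>::nat \<Rightarrow> 'p \<Rightarrow> real) c.
        (\<forall>\<xi>\<in>{1..\<Xi>}. bilinear_form_on \<Omega> V W (c \<xi>)) \<and>
        (\<forall>\<mu>\<in>P. \<forall>v\<in>V. \<forall>w\<in>W. b \<mu> v w = (\<Sum>\<xi>=1..\<Xi>. \<theta> \<xi> \<mu> * c \<xi> v w)))"

definition parameter_independent :: "'p set \<Rightarrow> ('p \<Rightarrow> 'b) \<Rightarrow> bool" where
  "parameter_independent P X \<longleftrightarrow> (\<forall>\<mu>\<in>P. \<forall>\<mu>'\<in>P. X \<mu> = X \<mu>')"


section \<open>Greedy basis generation\<close>

definition fun_span :: "('a \<Rightarrow> 'b::real_vector) set \<Rightarrow> ('a \<Rightarrow> 'b) set" where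
  "fun_span S = {v. \<exists>F c. finite F \<and> F \<subseteq> S \<and> v = (\<lambda>x. \<Sum>g\<in>F. c g *\<^sub>R g x)}"

primrec snapshot_space :: "(nat \<Rightarrow> 'a \<Rightarrow> 'b::real_vector) \<Rightarrow> nat \<Rightarrow> ('a \<Rightarrow> 'b) set" where
  "snapshot_space s 0 = {\<lambda>x. 0}"
| "snapshot_space s (Suc k) = fun_span (snapshot_space s k \<union> {s (Suc k)})"

text \<open>The error estimator of a reduced space \<open>V\<close>; it does not depend on the representative of the
  Galerkin solution chosen by \<open>SOME\<close>.\<close>

definition error_estimator ::
  "'a::euclidean_space set \<Rightarrow> ('a \<Rightarrow> real) set \<Rightarrow> (('a \<Rightarrow> real) \<Rightarrow> real) \<Rightarrow> ('a \<Rightarrow> real) \<Rightarrow>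
   ('a \<Rightarrow> real) \<Rightarrow> (('a \<Rightarrow> real) \<Rightarrow> ('a \<Rightarrow> real) \<Rightarrow> real) \<Rightarrow> ('a \<Rightarrow> real) set \<Rightarrow> real" where
  "error_estimator \<Omega> Vh N f s A V =
     (let u = (SOME u. galerkin_solution V A (L2_inner \<Omega> f) u)
      in ess_min \<Omega> s * dual_norm Vh N (\<lambda>v. L2_inner \<Omega> f v - A u v))"

text \<open>The first \<open>n\<close> steps of the greedy algorithm with estimators \<open>\<eta> k\<close>; \<open>m k\<close> is the parameter
  selected in step \<open>k\<close>.\<close>

definition greedy_steps ::
  "'p set \<Rightarrow> real \<Rightarrow> (nat \<Rightarrow> 'p \<Rightarrow> real) \<Rightarrow> (nat \<Rightarrow> 'p) \<Rightarrow> nat \<Rightarrow> bool" where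
  "greedy_steps P \<delta> \<eta> m n \<longleftrightarrow>
     (\<forall>k\<in>{1..n}. Max (\<eta> (k - 1) ` P) > \<delta> \<and> is_arg_max (\<eta> (k - 1)) (\<lambda>\<mu>. \<mu> \<in> P) (m k))"

end

theory Submission
  imports Defs "HOL-Analysis.Radon_Nikodym"
begin

text \<open>
  Testing the discontinuous Galerkin scheme with the indicator of an element \<open>K\<close> leaves only the face
  terms on the boundary of \<open>K\<close>, which are exactly the normal fluxes prescribed for the reconstruction.
  On \<open>K\<close> the reconstruction is \<open>a + b x\<close>, so the divergence theorem reduces to the cone formula
  for the volume of a simplex, and the two sides of an inner face carry the same flux because the field
  has a weak divergence. Hence every snapshot flux, and the offset \<open>tf\<close>, is locally conservative;
  differences with \<open>tf\<close> have mean-free divergence on every element, and so does their span.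
  Separability on the reduced spaces is a finite-dimensional fact.
\<close>

section \<open>Simplices in barycentric coordinates\<close>

text \<open>Three notions are only indirectly accessible. The area of a face is by definition the
  Lebesgue volume of the slab of thickness one over it, so the cone formula compares two volumes; in
  barycentric coordinates the divergence theorem for \<open>a + b x\<close> then comes down to the
  identities \<open>sum_g\<close> and \<open>sum_c\<close>. The weak divergence is a
  \<open>SOME\<close>, so it can be identified only through uniqueness, which needs sufficiently
  many test functions; hence the explicit cutoffs and the fundamental lemma. Finally,
  \<open>normal_flux\<close> reads a field from the side of \<open>Km\<close> only, so the balance
  on the other element needs continuity of the normal component, and this has to be extracted from
  the mere existence of a square-integrable divergence. On the reduced side the obstacle is that
  functions are representatives, equal only almost everywhere, and snapshots may be dependent or
  null. The spaces are therefore built up one snapshot at a time, with a degenerate snapshot allowed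
  at every stage. Separability of the flux term uses no formula for the reconstruction: its values
  on a fixed finite spanning family are themselves the parameter functionals.\<close>

lemma small_multiple:
  fixes p :: "'a::real_normed_vector"
  assumes "e > 0" obtains t where "t > 0" "t * norm p < e"
proof
  have pos: "0 < norm p + 1" by (simp add: add_nonneg_pos)
  then show "0 < e / (2 * (norm p + 1))" using assms by simp
  show "e / (2 * (norm p + 1)) * norm p < e"
    using assms pos mult_pos_pos[OF assms pos] by (simp add: divide_less_eq algebra_simps)
qed

text \<open>The gradient \<open>g w\<close> of the coordinate belonging to the vertex
  \<open>w\<close> is an inward normal of the facet opposite \<open>w\<close>, and its length is the
  reciprocal of the height over that facet. Facets, normals, distances and volumes thus become
  statements about signs and values of affine functions.\<close>

locale bary_simplex =
  fixes C :: "'a::euclidean_space set" and g :: "'a \<Rightarrow> 'a" and c :: "'a \<Rightarrow> real"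
    and bary :: "'a \<Rightarrow> 'a \<Rightarrow> real"
  defines "bary w x \<equiv> g w \<bullet> x + c w"
  assumes finite_C: "finite C" and card_C: "card C = Suc DIM('a)"
    and bary_vertex: "\<And>w v. w \<in> C \<Longrightarrow> v \<in> C \<Longrightarrow> bary w v = (if v = w then 1 else 0)"
    and sum_bary: "\<And>x. (\<Sum>w\<in>C. bary w x) = 1"
    and sum_bary_vertex: "\<And>x. (\<Sum>w\<in>C. bary w x *\<^sub>R w) = x"
begin

lemma bary_add: "bary w (x + y) = bary w x + g w \<bullet> y"
  by (simp add: bary_def inner_add_right)

lemma bary_diff: "bary w x - bary w y = g w \<bullet> (x - y)"
  by (simp add: bary_def inner_diff_right)

lemma bary_sum:
  assumes "sum u C = 1" shows "bary w (\<Sum>v\<in>C. u v *\<^sub>R v) = (\<Sum>v\<in>C. u v * bary w v)"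
proof -
  have "bary w (\<Sum>v\<in>C. u v *\<^sub>R v) = (\<Sum>v\<in>C. u v * (g w \<bullet> v)) + c w * sum u C"
    using assms by (simp add: bary_def inner_sum_right)
  also have "\<dots> = (\<Sum>v\<in>C. u v * bary w v)"
    by (simp add: bary_def sum.distrib sum_distrib_left algebra_simps)
  finally show ?thesis .
qed

lemma bary_convex_combination:
  assumes "sum u C = 1" "w \<in> C" shows "bary w (\<Sum>v\<in>C. u v *\<^sub>R v) = u w"
proof -
  have "bary w (\<Sum>v\<in>C. u v *\<^sub>R v) = (\<Sum>v\<in>C. if v = w then u v else 0)"
    unfolding bary_sum[OF assms(1)] using assms(2) by (intro sum.cong) (auto simp: bary_vertex)
  then show ?thesis using assms(2) finite_C by simp
qed

lemma hull_eq: "convex hull C = {x. \<forall>w\<in>C. 0 \<le> bary w x}"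
  unfolding convex_hull_finite[OF finite_C]
  using bary_convex_combination sum_bary sum_bary_vertex by (auto intro!: exI[of _ "\<lambda>w. bary w x" for x])

lemma facet_eq:
  assumes "v \<in> C"
  shows "convex hull (C - {v}) = {x. bary v x = 0 \<and> (\<forall>w\<in>C. 0 \<le> bary w x)}"
proof -
  have "x \<in> convex hull (C - {v}) \<longleftrightarrow> bary v x = 0 \<and> (\<forall>w\<in>C. 0 \<le> bary w x)" for x
  proof
    assume x: "x \<in> convex hull (C - {v})"
    have "convex {x. g v \<bullet> x = - c v}" by (rule convex_hyperplane)
    moreover have "C - {v} \<subseteq> {x. g v \<bullet> x = - c v}"
      using assms bary_vertex[of v] by (auto simp: bary_def eq_neg_iff_add_eq_0)
    ultimately have "x \<in> {x. g v \<bullet> x = - c v}"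
      using x hull_minimal[of "C - {v}" _ convex] by blast
    moreover have "x \<in> convex hull C" using x hull_mono[of "C - {v}" C convex] by blast
    ultimately show "bary v x = 0 \<and> (\<forall>w\<in>C. 0 \<le> bary w x)"
      by (auto simp: hull_eq bary_def)
  next
    assume x: "bary v x = 0 \<and> (\<forall>w\<in>C. 0 \<le> bary w x)"
    have "(\<Sum>w\<in>C - {v}. bary w x) = 1" "(\<Sum>w\<in>C - {v}. bary w x *\<^sub>R w) = x"
      using sum_bary[of x] sum_bary_vertex[of x] x assms finite_C by (auto simp: sum.remove)
    then show "x \<in> convex hull (C - {v})"
      using x finite_C by (auto simp: convex_hull_finite intro!: exI[of _ "\<lambda>w. bary w x"])
  qed
  then show ?thesis by blast
qed

lemma affine_hull_facet:
  assumes "v \<in> C"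
  shows "affine hull (C - {v}) = {x. bary v x = 0}"
proof -
  have "x \<in> affine hull (C - {v}) \<longleftrightarrow> bary v x = 0" for x
  proof
    assume x: "x \<in> affine hull (C - {v})"
    have "affine {x. g v \<bullet> x = - c v}" by (rule affine_hyperplane)
    moreover have "C - {v} \<subseteq> {x. g v \<bullet> x = - c v}"
      using assms bary_vertex[of v] by (auto simp: bary_def eq_neg_iff_add_eq_0)
    ultimately have "x \<in> {x. g v \<bullet> x = - c v}"
      using x hull_minimal[of "C - {v}" _ affine] by blast
    then show "bary v x = 0" by (auto simp: bary_def)
  next
    assume x: "bary v x = 0"
    have "(\<Sum>w\<in>C - {v}. bary w x) = 1" "(\<Sum>w\<in>C - {v}. bary w x *\<^sub>R w) = x"
      using sum_bary[of x] sum_bary_vertex[of x] x assms finite_C by (auto simp: sum.remove)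
    then show "x \<in> affine hull (C - {v})"
      using finite_C by (auto simp: affine_hull_finite intro!: exI[of _ "\<lambda>w. bary w x"])
  qed
  then show ?thesis by auto
qed

lemma g_nonzero:
  assumes "v \<in> C" shows "g v \<noteq> 0"
proof
  assume "g v = 0"
  have "card (C - {v}) > 0" using card_C assms finite_C by (simp add: card_Diff_singleton)
  then obtain u where "u \<in> C" "u \<noteq> v" by (metis Diff_iff card_gt_0_iff ex_in_conv insertI1)
  then show False
    using \<open>g v = 0\<close> bary_vertex[of v v] bary_vertex[of v u] assms by (simp add: bary_def)
qed

text \<open>Coefficient comparison in the partition of unity. After weighting with facet areas the
  first identity says that a constant field has no net flux, the second that the field
  \<open>x\<close> has flux \<open>DIM('a)\<close> times the volume; see
  \<open>divergence_affine\<close>.\<close>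

lemma sum_g: "(\<Sum>w\<in>C. g w) = 0" and sum_c: "(\<Sum>w\<in>C. c w) = 1"
proof -
  have *: "(\<Sum>w\<in>C. g w) \<bullet> x + (\<Sum>w\<in>C. c w) = 1" for x
    using sum_bary[of x] by (simp add: bary_def sum.distrib inner_sum_left)
  show "(\<Sum>w\<in>C. c w) = 1" using *[of 0] by simp
  \<comment> \<open>Evaluating the identity at the sum of the gradients itself makes its squared
    norm vanish.\<close>
  then show "(\<Sum>w\<in>C. g w) = 0" using *[of "\<Sum>w\<in>C. g w"] by simp
qed

text \<open>The centroid of the facet opposite \<open>v\<close>. All other coordinates equal
  \<open>1 / DIM('a)\<close> there, so it lies in the relative interior; it serves as reference
  point for fluxes, as centre of homotheties and as centre of small balls around the facet.\<close>

definition facet_center :: "'a \<Rightarrow> 'a" where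
  "facet_center v = (\<Sum>w\<in>C - {v}. (1 / DIM('a)) *\<^sub>R w)"

lemma bary_facet_center:
  assumes "v \<in> C" "w \<in> C"
  shows "bary w (facet_center v) = (if w = v then 0 else 1 / DIM('a))"
proof -
  let ?u = "\<lambda>w. if w = v then 0 else 1 / real DIM('a)"
  have card: "card (C - {v}) = DIM('a)" using card_C assms finite_C by (simp add: card_Diff_singleton)
  have "sum ?u C = 1" using assms(1) finite_C card by (simp add: sum.remove[of C v])
  moreover have "facet_center v = (\<Sum>w\<in>C. ?u w *\<^sub>R w)"
    using assms(1) finite_C by (simp add: facet_center_def sum.remove[of C v])
  ultimately show ?thesis using bary_convex_combination[of ?u w] assms(2) by simp
qed

lemma facet_center_in: "v \<in> C \<Longrightarrow> facet_center v \<in> convex hull (C - {v})"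
  by (auto simp: facet_eq bary_facet_center)

lemma continuous_on_bary [continuous_intros]: "continuous_on S (bary w)"
  unfolding bary_def by (intro continuous_intros)

text \<open>Near the centroid the coordinate of \<open>v\<close> is the only one that can become
  negative, so locally the simplex is a half-space.\<close>

lemma ball_facet_center:
  assumes "v \<in> C"
  obtains e where "e > 0" "\<And>x w. dist (facet_center v) x < e \<Longrightarrow> w \<in> C - {v} \<Longrightarrow> bary w x > 0"
proof -
  have "open (\<Inter>w\<in>C - {v}. {x. 0 < bary w x})"
    using finite_C by (intro open_INT ballI open_Collect_less continuous_intros) auto
  moreover have "facet_center v \<in> (\<Inter>w\<in>C - {v}. {x. 0 < bary w x})"
    using assms by (auto simp: bary_facet_center)
  ultimately obtain e where "e > 0" "ball (facet_center v) e \<subseteq> (\<Inter>w\<in>C - {v}. {x. 0 < bary w x})"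
    by (meson openE)
  then show ?thesis using that[of e] by (force simp: subset_eq)
qed

definition outward :: "'a \<Rightarrow> 'a" where "outward v = - (g v /\<^sub>R norm (g v))"

lemma norm_outward: "v \<in> C \<Longrightarrow> norm (outward v) = 1"
  using g_nonzero[of v] by (simp add: outward_def)

text \<open>Moving along the facet forces the tangential part of \<open>n\<close> to vanish, and the
  vertex \<open>v\<close> fixes the sign. The equivalence serves twice: it evaluates the
  \<open>THE\<close> in \<open>face_normal\<close>, and it identifies the normal of a neighbouring
  simplex.\<close>

lemma outward_unique:
  assumes v: "v \<in> C"
  shows "norm n = 1 \<and> (\<forall>x\<in>convex hull (C - {v}). \<forall>y\<in>convex hull C. n \<bullet> (y - x) \<le> 0) \<longleftrightarrow> n = outward v"
proof
  assume n: "norm n = 1 \<and> (\<forall>x\<in>convex hull (C - {v}). \<forall>y\<in>convex hull C. n \<bullet> (y - x) \<le> 0)"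
  define x0 where "x0 = facet_center v"
  have x0: "x0 \<in> convex hull (C - {v})" using facet_center_in[OF v] by (simp add: x0_def)
  obtain e where e: "e > 0" "\<And>x w. dist x0 x < e \<Longrightarrow> w \<in> C - {v} \<Longrightarrow> bary w x > 0"
    unfolding x0_def using ball_facet_center[OF v] by blast
  have gv: "g v \<noteq> 0" using g_nonzero v by auto
  have bx0: "bary v x0 = 0" using bary_facet_center v by (simp add: x0_def)
  \<comment> \<open>The tangential part of \<open>n\<close>. A small step along \<open>p\<close>
    from the centroid stays in the facet, so \<open>n \<bullet> p \<le> 0\<close>, whereas
    \<open>n \<bullet> p = p \<bullet> p\<close>.\<close>
  define p where "p = n - ((n \<bullet> g v) / (g v \<bullet> g v)) *\<^sub>R g v"
  have pg: "g v \<bullet> p = 0" using gv by (simp add: p_def inner_diff_right inner_commute)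
  obtain t where tpos: "t > 0" and tn: "t * norm p < e" using small_multiple[OF e(1)] .
  have in_facet: "x0 + t *\<^sub>R p \<in> convex hull C"
  proof -
    have "bary w (x0 + t *\<^sub>R p) > 0" if "w \<in> C - {v}" for w
      using that tn tpos by (intro e(2)) (auto simp: dist_norm)
    moreover have "bary v (x0 + t *\<^sub>R p) = 0" using bx0 pg by (simp add: bary_add)
    ultimately show ?thesis unfolding hull_eq by (auto simp: less_imp_le)
      (metis Diff_iff less_imp_le order_refl singletonD)
  qed
  have "n \<bullet> p \<le> 0"
  proof -
    have "n \<bullet> ((x0 + t *\<^sub>R p) - x0) \<le> 0" using n x0 in_facet by blast
    then show ?thesis using tpos by (simp add: mult_le_0_iff)
  qed
  moreover have "n \<bullet> p = p \<bullet> p"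
    using pg by (simp add: p_def inner_diff_left inner_diff_right inner_commute)
  ultimately have "p = 0" using inner_eq_zero_iff inner_ge_zero by (metis order_antisym)
  then obtain s where s: "n = s *\<^sub>R g v" by (auto simp: p_def)
  have "v \<in> convex hull C" using v hull_inc by metis
  then have "n \<bullet> (v - x0) \<le> 0" using n x0 by blast
  moreover have "g v \<bullet> (v - x0) = 1" using bary_diff[of v v x0] bx0 bary_vertex v by simp
  ultimately have "s \<le> 0" by (simp add: s)
  moreover have "\<bar>s\<bar> * norm (g v) = 1" using n by (simp add: s)
  ultimately have "s = - inverse (norm (g v))" using gv by (auto simp: field_simps)
  then show "n = outward v" by (simp add: s outward_def)
next
  assume n: "n = outward v"
  have "n \<bullet> (y - x) \<le> 0" if "x \<in> convex hull (C - {v})" "y \<in> convex hull C" for x y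
  proof -
    have "0 \<le> g v \<bullet> (y - x)"
      using that v bary_diff[of v y x] by (auto simp: facet_eq hull_eq)
    then show ?thesis by (simp add: n outward_def zero_le_mult_iff)
  qed
  then show "norm n = 1 \<and> (\<forall>x\<in>convex hull (C - {v}). \<forall>y\<in>convex hull C. n \<bullet> (y - x) \<le> 0)"
    using n norm_outward[OF v] by auto
qed

lemma face_normal_outward:
  assumes "v \<in> C" "Km (convex hull (C - {v})) = convex hull C"
  shows "face_normal Km (convex hull (C - {v})) = outward v"
  unfolding face_normal_def using outward_unique[OF assms(1)] assms(2) by auto

section \<open>Prisms over a facet and their volume\<close>

definition proj :: "'a \<Rightarrow> 'a \<Rightarrow> 'a" where
  "proj v x = x - (bary v x / (g v \<bullet> g v)) *\<^sub>R g v"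

lemma bary_proj: "bary w (proj v x) = bary w x - bary v x * ((g w \<bullet> g v) / (g v \<bullet> g v))"
  by (simp add: proj_def bary_def inner_diff_right)

lemma bary_proj_same: "v \<in> C \<Longrightarrow> bary v (proj v x) = 0"
  using g_nonzero[of v] by (simp add: bary_proj)

lemma continuous_on_proj [continuous_intros]: "continuous_on S (proj v)"
  unfolding proj_def by (cases "g v = 0") (auto intro!: continuous_intros)

lemma dist_proj: "dist x (proj v x) = \<bar>bary v x\<bar> / norm (g v)"
  by (simp add: proj_def dist_norm power2_norm_eq_inner[symmetric] power2_eq_square)

text \<open>By Cauchy-Schwarz no point of the hyperplane is closer than
  \<open>\<bar>bary v x\<bar> / norm (g v)\<close>, and \<open>proj\<close> attains this
  value.\<close>

lemma closest_point_facet: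
  assumes v: "v \<in> C"
  shows "closest_point (affine hull (C - {v})) x = proj v x"
proof -
  let ?A = "affine hull (C - {v})"
  have "dist x (proj v x) \<le> dist x z" if "z \<in> ?A" for z
  proof -
    have "bary v z = 0" using that v by (auto simp: affine_hull_facet)
    then have "\<bar>bary v x\<bar> \<le> norm (g v) * dist x z"
      using Cauchy_Schwarz_ineq2[of "g v" "x - z"] bary_diff[of v x z] by (simp add: dist_norm)
    then show ?thesis using g_nonzero[OF v] by (simp add: dist_proj divide_le_eq mult.commute)
  qed
  moreover have "proj v x \<in> ?A" using v by (simp add: affine_hull_facet bary_proj_same)
  moreover have "convex ?A" "closed ?A"
    by (auto simp: affine_imp_convex affine_affine_hull)
  ultimately show ?thesis using closest_point_unique[of ?A "proj v x" x] by metis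
qed

text \<open>A right prism over the facet, half-open so that prisms stack disjointly. Heights are
  measured by \<open>bary v\<close>; geometric thickness one corresponds to a height difference of
  \<open>norm (g v)\<close>.\<close>

definition slab :: "'a \<Rightarrow> real \<Rightarrow> real \<Rightarrow> 'a set" where
  "slab v s t = {x. s \<le> bary v x \<and> bary v x < t \<and> proj v x \<in> convex hull (C - {v})}"

lemma compact_hulls: "compact (convex hull C)" "compact (convex hull (C - {v}))"
  using finite_C by (auto intro!: finite_imp_compact_convex_hull)

lemma lmeasurable_slab:
  assumes v: "v \<in> C" shows "slab v s t \<in> lmeasurable"
proof (rule bounded_set_imp_lmeasurable)
  obtain B where B: "\<And>y. y \<in> convex hull (C - {v}) \<Longrightarrow> norm y \<le> B"
    using compact_imp_bounded[OF compact_hulls(2)] unfolding bounded_iff by blast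
  show "bounded (slab v s t)"
  proof (rule boundedI)
    fix x assume x: "x \<in> slab v s t"
    have "norm x \<le> norm (proj v x) + dist x (proj v x)" by (metis add.commute dist_norm norm_triangle_sub)
    also have "\<dots> \<le> B + \<bar>bary v x\<bar> / norm (g v)" using x B by (auto simp: slab_def dist_proj)
    also have "\<dots> \<le> B + (\<bar>s\<bar> + \<bar>t\<bar>) / norm (g v)"
      using x by (intro add_left_mono divide_right_mono) (auto simp: slab_def)
    finally show "norm x \<le> B + (\<bar>s\<bar> + \<bar>t\<bar>) / norm (g v)" .
  qed
  have "slab v s t = {x. s \<le> bary v x} \<inter> {x. bary v x < t} \<inter> proj v -` (convex hull (C - {v}))"
    by (auto simp: slab_def)
  moreover have "closed {x. s \<le> bary v x}" by (intro closed_Collect_le continuous_intros)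
  moreover have "open {x. bary v x < t}" by (intro open_Collect_less continuous_intros)
  moreover have "closed (proj v -` (convex hull (C - {v})))"
    by (intro closed_vimage compact_imp_closed compact_hulls continuous_intros)
  ultimately have "slab v s t \<in> sets borel" by auto
  then show "slab v s t \<in> sets lebesgue" by simp
qed

text \<open>The translation along \<open>g v\<close> is scaled so that it raises
  \<open>bary v\<close> by exactly \<open>r\<close>; being normal to the facet, it does not change
  \<open>proj\<close>.\<close>

lemma slab_translate:
  assumes v: "v \<in> C"
  shows "slab v (s + r) (t + r) = (+) ((r / (g v \<bullet> g v)) *\<^sub>R g v) ` slab v s t"
proof -
  define z where "z = (r / (g v \<bullet> g v)) *\<^sub>R g v"
  have b: "bary v (z + x) = bary v x + r" for x
    using g_nonzero[OF v] bary_add[of v x z] by (simp add: z_def add.commute)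
  have p: "proj v (z + x) = proj v x" for x
    unfolding proj_def b by (simp add: z_def add_divide_distrib algebra_simps)
  have "x \<in> slab v (s + r) (t + r) \<longleftrightarrow> x - z \<in> slab v s t" for x
    using b[of "x - z"] p[of "x - z"] by (auto simp: slab_def)
  note iff = this
  have "slab v (s + r) (t + r) = (+) z ` slab v s t"
  proof (intro equalityI subsetI)
    fix x assume "x \<in> slab v (s + r) (t + r)"
    then show "x \<in> (+) z ` slab v s t" using iff[of x] by (intro image_eqI[of _ _ "x - z"]) auto
  next
    fix x assume "x \<in> (+) z ` slab v s t"
    then have "x - z \<in> slab v s t" by auto
    then show "x \<in> slab v (s + r) (t + r)" using iff by blast
  qed
  then show ?thesis by (simp add: z_def)
qed

lemma measure_slab_translate:
  "v \<in> C \<Longrightarrow> measure lebesgue (slab v (s + r) (t + r)) = measure lebesgue (slab v s t)"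
  by (simp add: slab_translate measure_translation)

text \<open>Stacking translated copies. Integer multiples suffice because the heights used later are
  \<open>norm (g v) / N\<close>.\<close>

lemma measure_slab_mult:
  assumes v: "v \<in> C" and t: "0 \<le> t"
  shows "measure lebesgue (slab v 0 (real N * t)) = real N * measure lebesgue (slab v 0 t)"
proof (induction N)
  case 0
  have "slab v 0 0 = {}" by (auto simp: slab_def)
  then show ?case by simp
next
  case (Suc N)
  have Nt: "0 \<le> real N * t" using t by simp
  have "real (Suc N) * t = t + real N * t" by (simp add: algebra_simps)
  then have "slab v 0 (real (Suc N) * t) = slab v 0 (real N * t) \<union> slab v (0 + real N * t) (t + real N * t)"
    using t Nt unfolding slab_def by (auto intro: order_trans[OF Nt])
  moreover have "slab v 0 (real N * t) \<inter> slab v (0 + real N * t) (t + real N * t) = {}"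
    by (auto simp: slab_def)
  ultimately have "measure lebesgue (slab v 0 (real (Suc N) * t)) =
      measure lebesgue (slab v 0 (real N * t)) + measure lebesgue (slab v (0 + real N * t) (t + real N * t))"
    by (simp add: measure_Un3 lmeasurable_slab[OF v])
  also have "\<dots> = real (Suc N) * measure lebesgue (slab v 0 t)"
    by (simp only: measure_slab_translate[OF v] Suc.IH) (simp add: algebra_simps)
  finally show ?case .
qed

lemma face_slab_eq:
  assumes v: "v \<in> C"
  shows "face_slab (convex hull (C - {v})) =
    {x. \<bar>bary v x\<bar> \<le> norm (g v) / 2 \<and> proj v x \<in> convex hull (C - {v})}"
  using g_nonzero[OF v] by (auto simp: face_slab_def closest_point_facet[OF v] dist_proj pos_divide_le_eq)

text \<open>The slab in the surface measure is closed and centred on the facet, whereas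
  \<open>slab v 0 (norm (g v))\<close> is half-open and lies on one side. A shift by half the
  thickness makes them agree up to one bounding hyperplane.\<close>

lemma measure_face_slab_slab:
  assumes v: "v \<in> C"
  shows "measure lebesgue (face_slab (convex hull (C - {v}))) = measure lebesgue (slab v 0 (norm (g v)))"
proof -
  let ?S = "slab v (0 + (- norm (g v) / 2)) (norm (g v) + (- norm (g v) / 2))"
  let ?F = "face_slab (convex hull (C - {v}))"
  have "(?S - ?F) \<union> (?F - ?S) \<subseteq> {x. g v \<bullet> x = norm (g v) / 2 - c v}"
    unfolding face_slab_eq[OF v] slab_def bary_def abs_le_iff by auto
  then have "negligible ((?S - ?F) \<union> (?F - ?S))"
    using negligible_hyperplane g_nonzero[OF v] negligible_subset by blast
  then have "measure lebesgue ?F = measure lebesgue ?S"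
    using measure_negligible_symdiff lmeasurable_slab[OF v] by blast
  then show ?thesis by (simp only: measure_slab_translate[OF v])
qed

section \<open>Thin layers of the simplex along a facet\<close>

definition cap :: "'a \<Rightarrow> real \<Rightarrow> 'a set" where
  "cap v e = {x \<in> convex hull C. bary v x < e}"

lemma lmeasurable_hull: "convex hull C \<in> lmeasurable"
  using compact_hulls(1) by (rule lmeasurable_compact)

lemma lmeasurable_cap: "cap v e \<in> lmeasurable"
proof -
  have "open {x. bary v x < e}" by (intro open_Collect_less continuous_intros)
  then have "convex hull C \<inter> {x. bary v x < e} \<in> lmeasurable"
    by (intro fmeasurable_Int_fmeasurable lmeasurable_hull) auto
  then show ?thesis by (simp add: cap_def Int_def)
qed

text \<open>What remains after removing the cap is the image of the whole simplex under the
  homothety with centre \<open>v\<close> and ratio \<open>1 - e\<close>.\<close>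

lemma measure_cap:
  assumes v: "v \<in> C" and e: "0 < e" "e < 1"
  shows "measure lebesgue (cap v e) = (1 - (1 - e) ^ DIM('a)) * measure lebesgue (convex hull C)"
proof -
  let ?T = "(\<lambda>x. (1 - e) *\<^sub>R x + e *\<^sub>R v) ` (convex hull C)"
  have b: "bary w ((1 - e) *\<^sub>R x + e *\<^sub>R v) = (1 - e) * bary w x + e * bary w v" for w x
    by (simp add: bary_def inner_add_right algebra_simps)
  have "convex hull C - cap v e = ?T"
  proof (intro equalityI subsetI)
    fix x assume x: "x \<in> convex hull C - cap v e"
    define y where "y = (1 / (1 - e)) *\<^sub>R (x - e *\<^sub>R v)"
    have xy: "x = (1 - e) *\<^sub>R y + e *\<^sub>R v" using e by (simp add: y_def)
    have "0 \<le> bary w y" if "w \<in> C" for w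
    proof -
      have "0 \<le> (1 - e) * bary w y"
        using x that v e b[of w y] unfolding xy[symmetric]
        by (auto simp: hull_eq cap_def bary_vertex split: if_splits)
      then show ?thesis using e by (simp add: zero_le_mult_iff)
    qed
    then show "x \<in> ?T" using xy by (auto simp: hull_eq)
  next
    fix x assume "x \<in> ?T"
    then obtain y where y: "x = (1 - e) *\<^sub>R y + e *\<^sub>R v" "\<And>w. w \<in> C \<Longrightarrow> 0 \<le> bary w y"
      by (auto simp: hull_eq)
    have "0 \<le> bary w x" if "w \<in> C" for w using y e v that by (auto simp: b bary_vertex)
    moreover have "e \<le> bary v x" using y e v by (auto simp: b bary_vertex)
    ultimately show "x \<in> convex hull C - cap v e" by (auto simp: hull_eq cap_def)
  qed
  then have "measure lebesgue (convex hull C - cap v e) = (1 - e) ^ DIM('a) * measure lebesgue (convex hull C)"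
    using measure_lebesgue_affine[of "1 - e" "e *\<^sub>R v" "convex hull C"] e by simp
  moreover have "measure lebesgue (convex hull C - cap v e) = measure lebesgue (convex hull C) - measure lebesgue (cap v e)"
    by (rule measurable_measure_Diff) (use lmeasurable_hull lmeasurable_cap in \<open>auto simp: fmeasurableD cap_def\<close>)
  ultimately show ?thesis by (simp add: algebra_simps)
qed

text \<open>Within height \<open>e\<close>, projecting a point to the facet changes each barycentric
  coordinate by at most \<open>M * e\<close>. A contraction \<open>h\<close> with ratio
  \<open>1 / r\<close> towards the centroid of the facet repairs this defect, so \<open>h\<close>
  maps the prism into the cap and the cap into the prism; volumes scale by
  \<open>r ^ DIM('a)\<close>.\<close>

lemma slab_cap_compare:
  assumes v: "v \<in> C" and e: "0 \<le> e"
    and M: "\<And>w. w \<in> C \<Longrightarrow> \<bar>(g w \<bullet> g v) / (g v \<bullet> g v)\<bar> \<le> M"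
    and r: "r = 1 + real DIM('a) * M * e"
  shows "measure lebesgue (slab v 0 e) \<le> r ^ DIM('a) * measure lebesgue (cap v e)" (is ?A)
    and "measure lebesgue (cap v e) \<le> r ^ DIM('a) * measure lebesgue (slab v 0 e)" (is ?B)
proof -
  define x0 where "x0 = facet_center v"
  define h where "h x = (1 / r) *\<^sub>R x + (1 - 1 / r) *\<^sub>R x0" for x
  have M0: "0 \<le> M" using M[OF v] by (meson abs_ge_zero order_trans)
  have r1: "r \<ge> 1" using M0 e by (simp add: r)
  have bh: "bary w (h x) = (1 / r) * bary w x + (1 - 1 / r) * bary w x0" for w x
    by (simp add: h_def bary_def inner_add_right algebra_simps)
  have b0: "bary v x0 = 0" using v by (simp add: x0_def bary_facet_center)
  have bpos: "0 \<le> bary w (h x)" if "- (M * e) \<le> bary w x" "w \<in> C" "w \<noteq> v" for w x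
  proof -
    \<comment> \<open>Origin of \<open>r\<close>: the other coordinates of the centroid are
      \<open>1 / DIM('a)\<close>, so \<open>(r - 1) / DIM('a) = M * e\<close> is precisely the
      possible defect.\<close>
    have "r * bary w (h x) = bary w x + (r - 1) * bary w x0" using r1 by (simp add: bh field_simps)
    also have "\<dots> = bary w x + M * e" using that v by (simp add: x0_def bary_facet_center r)
    finally have "0 \<le> r * bary w (h x)" using that by simp
    then show ?thesis using r1 by (simp add: zero_le_mult_iff)
  qed
  have corr: "\<bar>bary v x * ((g w \<bullet> g v) / (g v \<bullet> g v))\<bar> \<le> M * e"
    if "0 \<le> bary v x" "bary v x < e" "w \<in> C" for w x
  proof -
    have "\<bar>bary v x * ((g w \<bullet> g v) / (g v \<bullet> g v))\<bar> \<le> e * M"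
      unfolding abs_mult using that M by (intro mult_mono) auto
    then show ?thesis by (simp add: mult.commute)
  qed
  have bv: "0 \<le> bary v (h x) \<and> bary v (h x) < e" if "0 \<le> bary v x" "bary v x < e" for x
  proof -
    have "bary v x / r \<le> bary v x" using that r1 by (simp add: divide_le_eq mult_le_cancel_left1)
    then show ?thesis using that r1 by (simp add: bh b0)
  qed
  have meas: "measure lebesgue (h ` S) * r ^ DIM('a) = measure lebesgue S" for S
    using measure_lebesgue_affine[of "1 / r" "(1 - 1 / r) *\<^sub>R x0" S] r1
    by (simp add: h_def[abs_def] power_divide)
  have rd: "0 \<le> r ^ DIM('a)" using r1 by simp
  have h_meas: "h ` S \<in> sets lebesgue" if "S \<in> lmeasurable" for S
    using that unfolding h_def[abs_def]
    by (intro differentiable_image_in_sets_lebesgue) (auto intro!: derivative_intros)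
  have "h ` slab v 0 e \<subseteq> cap v e"
  proof (rule image_subsetI)
    fix x assume x: "x \<in> slab v 0 e"
    have "- (M * e) \<le> bary w x" if "w \<in> C" for w
    proof -
      have "0 \<le> bary w (proj v x)" using x that v by (auto simp: slab_def facet_eq)
      moreover have "\<bar>bary v x * ((g w \<bullet> g v) / (g v \<bullet> g v))\<bar> \<le> M * e"
        using corr x that by (simp add: slab_def)
      ultimately show ?thesis unfolding bary_proj by linarith
    qed
    then show "h x \<in> cap v e"
      using bpos bv[of x] x by (fastforce simp: slab_def cap_def hull_eq)
  qed
  then have "measure lebesgue (h ` slab v 0 e) \<le> measure lebesgue (cap v e)"
    using lmeasurable_slab[OF v] lmeasurable_cap
    by (intro measure_mono_fmeasurable h_meas) auto
  from mult_right_mono[OF this rd] show ?A unfolding meas by (simp only: mult.commute)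
  have "h ` cap v e \<subseteq> slab v 0 e"
  proof (rule image_subsetI)
    fix x assume x: "x \<in> cap v e"
    \<comment> \<open>The centre of the homothety lies in the hyperplane of the facet, so
      contraction and projection commute.\<close>
    have ph: "proj v (h x) = h (proj v x)"
      by (simp add: proj_def bh b0) (simp add: h_def scaleR_diff_right)
    have "- (M * e) \<le> bary w (proj v x)" if "w \<in> C" for w
    proof -
      have "0 \<le> bary w x" "0 \<le> bary v x" "bary v x < e" using x that v by (auto simp: cap_def hull_eq)
      then show ?thesis using corr[of x w] that unfolding bary_proj by linarith
    qed
    then have "\<forall>w\<in>C. 0 \<le> bary w (h (proj v x))"
      using bpos bh b0 bary_proj_same[OF v] by (metis add.right_neutral mult_zero_right order_refl)
    moreover have "bary v (h (proj v x)) = 0" using bh b0 bary_proj_same[OF v] by simp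
    ultimately show "h x \<in> slab v 0 e"
      using bv[of x] x v by (auto simp: slab_def cap_def hull_eq facet_eq ph)
  qed
  then have "measure lebesgue (h ` cap v e) \<le> measure lebesgue (slab v 0 e)"
    using lmeasurable_slab[OF v] lmeasurable_cap
    by (intro measure_mono_fmeasurable h_meas) auto
  from mult_right_mono[OF this rd] show ?B unfolding meas by (simp only: mult.commute)
qed

text \<open>Near the facet the simplex and the straight prism over the facet differ by homotheties of ratio
  tending to 1. Comparing the derivatives of their volumes at height 0 gives the cone formula.\<close>

lemma measure_face_slab:
  assumes v: "v \<in> C"
  shows "measure lebesgue (face_slab (convex hull (C - {v}))) =
    real DIM('a) * norm (g v) * measure lebesgue (convex hull C)"
proof -
  let ?d = "DIM('a)" and ?G = "norm (g v)" and ?K = "measure lebesgue (convex hull C)"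
  define S where "S = measure lebesgue (slab v 0 ?G)"
  define M where "M = (\<Sum>w\<in>C. \<bar>(g w \<bullet> g v) / (g v \<bullet> g v)\<bar>)"
  have M: "\<bar>(g w \<bullet> g v) / (g v \<bullet> g v)\<bar> \<le> M" if "w \<in> C" for w
    unfolding M_def using finite_C that by (intro member_le_sum) auto
  \<comment> \<open>With this height, \<open>N\<close> stacked prisms reach
    \<open>norm (g v)\<close>, that is, thickness one.\<close>
  define e where "e N = ?G / real N" for N
  define r where "r N = 1 + real ?d * M * e N" for N
  have e0: "e \<longlonglongrightarrow> 0" unfolding e_def by (rule lim_const_over_n)
  have r1: "r \<longlonglongrightarrow> 1 + real ?d * M * 0" unfolding r_def by (intro tendsto_intros e0)
  \<comment> \<open>For large \<open>N\<close> this is \<open>N\<close> times the volume of the cap: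
    \<open>1 - (1 - e) ^ d\<close> is \<open>e\<close> times the geometric sum, and
    \<open>N * e N = norm (g v)\<close>. In this form the limit is visible without
    differentiation.\<close>
  define q where "q N = ?G * (\<Sum>i<?d. (1 - e N) ^ i) * ?K" for N
  have "q \<longlonglongrightarrow> ?G * (\<Sum>i<?d. (1 - 0) ^ i) * ?K" unfolding q_def by (intro tendsto_intros e0)
  then have q: "q \<longlonglongrightarrow> real ?d * ?G * ?K" by (simp add: mult.commute)
  have G: "?G > 0" using g_nonzero[OF v] by simp
  have ev: "\<forall>\<^sub>F N in sequentially. S \<le> r N ^ ?d * q N \<and> q N \<le> r N ^ ?d * S"
  proof -
    have "\<forall>\<^sub>F N in sequentially. e N < 1" using order_tendstoD(2)[OF e0, of 1] by simp
    moreover have "\<forall>\<^sub>F N in sequentially. N > 0" by (rule eventually_gt_at_top)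
    ultimately show ?thesis
    proof eventually_elim
      case (elim N)
      have eN: "0 < e N" "real N * e N = ?G" using G elim(2) by (simp_all add: e_def)
      note eN = eN(1) elim(1) eN(2)
      have S: "S = real N * measure lebesgue (slab v 0 (e N))"
        using measure_slab_mult[OF v, of "e N" N] eN by (simp add: S_def)
      have "1 - (1 - e N) ^ ?d = e N * (\<Sum>i<?d. (1 - e N) ^ i)"
        using one_diff_power_eq[of "1 - e N" ?d] by simp
      then have qN: "q N = real N * measure lebesgue (cap v (e N))"
        using measure_cap[OF v eN(1,2)] by (simp add: q_def eN(3)[symmetric])
      show ?case
        using slab_cap_compare[OF v less_imp_le[OF eN(1)] M r_def] elim
        by (simp add: S qN mult.left_commute mult_left_mono)
    qed
  qed
  have rd: "(\<lambda>N. r N ^ ?d) \<longlonglongrightarrow> 1" using tendsto_power[OF r1, of ?d] by simp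
  have "(\<lambda>N. r N ^ ?d * q N) \<longlonglongrightarrow> 1 * (real ?d * ?G * ?K)" by (intro tendsto_mult rd q)
  then have "S \<le> 1 * (real ?d * ?G * ?K)"
    by (rule tendsto_lowerbound) (use ev in \<open>auto elim: eventually_mono\<close>)
  moreover have "(\<lambda>N. r N ^ ?d * S) \<longlonglongrightarrow> 1 * S" by (intro tendsto_mult rd tendsto_const)
  then have "real ?d * ?G * ?K \<le> 1 * S"
    by (rule tendsto_le[OF _ _ q, rotated]) (use ev in \<open>auto elim: eventually_mono\<close>)
  ultimately show ?thesis using measure_face_slab_slab[OF v] by (simp add: S_def)
qed

end

text \<open>For each vertex \<open>w\<close> choose another vertex \<open>u\<close> as origin. The
  differences to \<open>u\<close> are independent, so a linear functional can be prescribed as 1 on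
  \<open>w - u\<close> and 0 on the others; its representing vector is \<open>g w\<close>, and
  \<open>c w\<close> makes the affine function vanish at \<open>u\<close>.\<close>

lemma ex_bary_simplex:
  fixes C :: "'a::euclidean_space set"
  assumes ind: "\<not> affine_dependent C" and card: "card C = Suc DIM('a)"
  obtains g c where "bary_simplex C g c"
proof -
  have fin: "finite C" using ind by (rule aff_independent_finite)
  have "\<exists>gw cw. \<forall>v\<in>C. gw \<bullet> v + cw = (if v = w then 1 else 0::real)" if w: "w \<in> C" for w
  proof -
    have "card (C - {w}) > 0" using card w fin by (simp add: card_Diff_singleton)
    then obtain u where u: "u \<in> C" "u \<noteq> w" by (metis Diff_iff card_gt_0_iff ex_in_conv insertI1)
    have "independent ((\<lambda>x. -u + x) ` (C - {u}))"
      using affine_dependent_iff_dependent2[OF u(1)] ind by blast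
    then have "\<exists>f::'a \<Rightarrow> real. linear f \<and>
        (\<forall>x\<in>(\<lambda>x. -u + x) ` (C - {u}). f x = (if x = w - u then 1 else 0))"
      by (rule linear_independent_extend)
    then obtain f :: "'a \<Rightarrow> real" where f: "linear f"
        "\<forall>x\<in>(\<lambda>x. -u + x) ` (C - {u}). f x = (if x = w - u then 1 else 0)" by blast
    define gw where "gw = adjoint f 1"
    have gw: "gw \<bullet> x = f x" for x using adjoint_works[OF f(1), of x 1] by (simp add: gw_def inner_commute)
    have "gw \<bullet> v + (- (gw \<bullet> u)) = (if v = w then 1 else 0)" if "v \<in> C" for v
    proof (cases "v = u")
      case False
      then have "f (v - u) = (if v = w then 1 else 0)" using f(2) that by auto
      then show ?thesis by (simp add: gw[symmetric] inner_diff_right)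
    qed (use u in auto)
    then show ?thesis by blast
  qed
  then obtain g c where gc: "\<And>w v. w \<in> C \<Longrightarrow> v \<in> C \<Longrightarrow> g w \<bullet> v + c w = (if v = w then 1 else 0::real)"
    by metis
  have "(\<Sum>w\<in>C. g w \<bullet> x + c w) = 1 \<and> (\<Sum>w\<in>C. (g w \<bullet> x + c w) *\<^sub>R w) = x" for x
  proof -
    have "x \<in> affine hull C" using affine_independent_span_eq[OF ind card] by simp
    then obtain u where u: "sum u C = 1" "(\<Sum>v\<in>C. u v *\<^sub>R v) = x"
      unfolding affine_hull_finite[OF fin] by auto
    have "g w \<bullet> x + c w = u w" if "w \<in> C" for w
    proof -
      have "g w \<bullet> x + c w = (\<Sum>v\<in>C. u v * (g w \<bullet> v)) + c w * sum u C"
        by (simp add: u(2)[symmetric] inner_sum_right u(1))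
      also have "\<dots> = (\<Sum>v\<in>C. u v * (g w \<bullet> v + c w))"
        by (simp add: sum.distrib sum_distrib_left algebra_simps)
      also have "\<dots> = (\<Sum>v\<in>C. if v = w then u v else 0)"
        using that by (intro sum.cong) (auto simp: gc)
      also have "\<dots> = u w" using that fin by simp
      finally show ?thesis .
    qed
    then show ?thesis using u by simp
  qed
  then have "bary_simplex C g c" using fin card gc by unfold_locales auto
  then show ?thesis by (rule that)
qed

section \<open>Test functions and integration by parts\<close>

lemma GDERIV_unique:
  assumes "GDERIV f x :> g" "GDERIV f x :> g'" shows "g = g'"
proof -
  have "(\<lambda>h. h \<bullet> g) = (\<lambda>h. h \<bullet> g')"
    using assms has_derivative_unique unfolding gderiv_def by blast
  then show ?thesis by (metis vector_eq_ldot)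
qed

lemma gradient_eq: "GDERIV f x :> g \<Longrightarrow> gradient f x = g"
  unfolding gradient_def by (auto intro: GDERIV_unique)

lemma differentiable_GDERIV_gradient:
  fixes f :: "'a::euclidean_space \<Rightarrow> real"
  assumes "f differentiable (at x)" shows "GDERIV f x :> gradient f x"
proof -
  obtain D where D: "(f has_derivative D) (at x)" using assms by (auto simp: differentiable_def)
  then have "linear D" by (rule has_derivative_linear)
  then have "D h = h \<bullet> adjoint D 1" for h using adjoint_works[of D h 1] by simp
  then have "D = (\<lambda>h. h \<bullet> adjoint D 1)" by (rule ext)
  then have "GDERIV f x :> adjoint D 1" using D by (simp add: gderiv_def)
  then show ?thesis using gradient_eq by metis
qed

text \<open>Unlike \<open>test_function\<close>, this carries the gradient explicitly and allows any
  compact set outside which the function vanishes; both are easier to verify for concrete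
  cutoffs.\<close>

definition C1_supported :: "('a::euclidean_space \<Rightarrow> real) \<Rightarrow> ('a \<Rightarrow> 'a) \<Rightarrow> 'a set \<Rightarrow> bool" where
  "C1_supported \<phi> G K \<longleftrightarrow>
     (\<forall>x. GDERIV \<phi> x :> G x) \<and> continuous_on UNIV G \<and> compact K \<and> (\<forall>x. x \<notin> K \<longrightarrow> \<phi> x = 0)"

lemma C1_supported_gradient: "C1_supported \<phi> G K \<Longrightarrow> gradient \<phi> = G"
  by (auto simp: C1_supported_def gradient_eq)

lemma test_function_C1_supported:
  "test_function \<Omega> \<phi> \<Longrightarrow> C1_supported \<phi> (gradient \<phi>) (closure {x. \<phi> x \<noteq> 0})"
  using closure_subset[of "{x. \<phi> x \<noteq> 0}"]
  by (auto simp: test_function_def C1_supported_def intro: differentiable_GDERIV_gradient)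

lemma C1_supported_test_function:
  assumes "C1_supported \<phi> G K" "K \<subseteq> \<Omega>" shows "test_function \<Omega> \<phi>"
proof -
  have "closure {x. \<phi> x \<noteq> 0} \<subseteq> K"
    using assms by (intro closure_minimal compact_imp_closed) (auto simp: C1_supported_def)
  moreover have "bounded K" using assms by (auto simp: C1_supported_def compact_imp_bounded)
  ultimately have "compact (closure {x. \<phi> x \<noteq> 0})" "closure {x. \<phi> x \<noteq> 0} \<subseteq> \<Omega>"
    using assms by (auto simp: compact_eq_bounded_closed bounded_subset)
  then show ?thesis
    using assms C1_supported_gradient[OF assms(1)]
    by (auto simp: test_function_def C1_supported_def gderiv_def differentiable_def)
qed

lemma C1_supported_outside:
  assumes "C1_supported \<phi> G K" "x \<notin> K" shows "\<phi> x = 0" "G x = 0"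
proof -
  show "\<phi> x = 0" using assms by (auto simp: C1_supported_def)
  have "open (- K)" using assms by (auto simp: C1_supported_def compact_imp_closed)
  have "((\<lambda>_. 0) has_derivative (\<lambda>h. h \<bullet> 0)) (at x)" by simp
  then have "GDERIV \<phi> x :> 0" unfolding gderiv_def
    by (rule has_derivative_transform_within_open[OF _ \<open>open (- K)\<close>])
      (use assms in \<open>auto simp: C1_supported_def\<close>)
  then show "G x = 0" using assms(1) GDERIV_unique unfolding C1_supported_def by metis
qed

lemma C1_supported_continuous:
  assumes "C1_supported \<phi> G K"
  shows "continuous_on UNIV \<phi>" "continuous_on UNIV G"
  using assms
  by (auto simp: C1_supported_def gderiv_def intro!: has_derivative_continuous_on[where f'="\<lambda>x h. h \<bullet> G x"])

lemma integrable_continuous_supported: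
  fixes f :: "'a::euclidean_space \<Rightarrow> 'b::euclidean_space"
  assumes "continuous_on UNIV f" "compact K" "\<And>x. x \<notin> K \<Longrightarrow> f x = 0"
  shows "integrable lborel f"
proof -
  have "integrable lborel (\<lambda>x. indicator K x *\<^sub>R f x)"
    using assms by (intro borel_integrable_compact) (auto intro: continuous_on_subset)
  moreover have "indicator K x *\<^sub>R f x = f x" for x using assms(3) by (auto simp: indicator_def)
  ultimately show ?thesis by simp
qed

lemma C1_supported_integrable:
  assumes "C1_supported \<phi> G K"
  shows "integrable lborel \<phi>" "integrable lborel G"
  using C1_supported_continuous[OF assms] C1_supported_outside[OF assms] assms
  by (auto simp: C1_supported_def intro!: integrable_continuous_supported[where K=K])

lemma lborel_integral_translation:
  fixes f :: "'a::euclidean_space \<Rightarrow> real"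
  assumes "f \<in> borel_measurable borel"
  shows "(LINT x|lborel. f (x + c)) = (LINT x|lborel. f x)"
proof -
  have "(LINT x|lborel. f x) = (LINT x|distr lborel borel ((+) c). f x)" by (simp add: lborel_distr_plus)
  also have "\<dots> = (LINT x|lborel. f (c + x))" by (rule integral_distr) (use assms in auto)
  finally show ?thesis by (simp add: add.commute)
qed

text \<open>Since \<open>S\<close> is invariant along \<open>w\<close>, translation invariance of
  Lebesgue measure makes every difference quotient integrate to zero over \<open>S\<close>. The
  whole space yields integration by parts; a half-space with tangential \<open>w\<close> yields the
  absence of boundary terms.\<close>

lemma integral_directional_derivative:
  assumes \<phi>: "C1_supported \<phi> G K" and S: "S \<in> sets borel"
    and inv: "\<And>t x. x + t *\<^sub>R w \<in> S \<longleftrightarrow> x \<in> S"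
  shows "(LINT x|lborel. indicator S x * (w \<bullet> G x)) = 0"
proof -
  note cont = C1_supported_continuous[OF \<phi>]
  have GD: "\<And>x. GDERIV \<phi> x :> G x" and K: "compact K" using \<phi> by (auto simp: C1_supported_def)
  have [measurable]: "\<phi> \<in> borel_measurable borel" "G \<in> borel_measurable borel" "S \<in> sets borel"
    using cont S by (auto intro: borel_measurable_continuous_onI)
  define t where "t n = 1 / real (Suc n)" for n
  define D where "D n x = (\<phi> (x + t n *\<^sub>R w) - \<phi> x) / t n" for n x
  have t: "0 < t n" "t n \<le> 1" for n by (auto simp: t_def)
  have t0: "t \<longlonglongrightarrow> 0" unfolding t_def using LIMSEQ_inverse_real_of_nat by (simp add: inverse_eq_divide)
  obtain R where R: "\<And>x. x \<in> K \<Longrightarrow> norm x \<le> R"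
    using compact_imp_bounded[OF K] by (auto simp: bounded_iff)
  have "bounded (G ` K)"
    using K cont by (intro compact_imp_bounded compact_continuous_image) (auto intro: continuous_on_subset)
  then obtain B where "\<forall>x\<in>G ` K. norm x \<le> B" by (auto simp: bounded_iff)
  then have B: "norm (G x) \<le> \<bar>B\<bar>" for x
    using C1_supported_outside[OF \<phi>, of x] by (cases "x \<in> K") (auto intro: order_trans)
  have lip: "\<bar>\<phi> y - \<phi> x\<bar> \<le> \<bar>B\<bar> * norm (y - x)" for x y
  proof -
    have "norm (\<phi> y - \<phi> x) \<le> \<bar>B\<bar> * norm (y - x)"
    proof (rule differentiable_bound[where S=UNIV and f'="\<lambda>x h. h \<bullet> G x"])
      fix x
      have "norm (h \<bullet> G x) \<le> \<bar>B\<bar> * norm h" for h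
        using Cauchy_Schwarz_ineq2[of h "G x"] mult_left_mono[OF B[of x], of "norm h"]
        by (simp add: mult.commute)
      then show "onorm (\<lambda>h. h \<bullet> G x) \<le> \<bar>B\<bar>" by (intro onorm_bound) auto
    qed (use GD in \<open>auto simp: gderiv_def\<close>)
    then show ?thesis by simp
  qed
  have intS: "integrable lborel (\<lambda>x. indicator S x * f x)" if "integrable lborel f" for f :: "'a \<Rightarrow> real"
    using integrable_mult_indicator[OF _ that, of S] S by simp
  have i1: "integrable lborel \<phi>" using C1_supported_integrable[OF \<phi>] by simp
  have i2: "integrable lborel (\<lambda>x. \<phi> (x + c))" for c
  proof -
    have "integrable (distr lborel borel ((+) c)) \<phi>" using i1 by (simp add: lborel_distr_plus)
    then show ?thesis by (subst (asm) integrable_distr_eq) (auto simp: add.commute)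
  qed
  have zero: "(LINT x|lborel. indicator S x * D n x) = 0" for n
  proof -
    have "(LINT x|lborel. indicator S x * \<phi> (x + t n *\<^sub>R w)) = (LINT x|lborel. indicator S (x + t n *\<^sub>R w) * \<phi> (x + t n *\<^sub>R w))"
      by (simp add: indicator_def inv)
    also have "\<dots> = (LINT x|lborel. indicator S x * \<phi> x)"
      by (rule lborel_integral_translation[where f="\<lambda>x. indicator S x * \<phi> x"]) measurable
    finally have "(LINT x|lborel. indicator S x * \<phi> (x + t n *\<^sub>R w) - indicator S x * \<phi> x) = 0"
      by (subst Bochner_Integration.integral_diff) (auto intro!: intS i1 i2)
    then have "(LINT x|lborel. (indicator S x * \<phi> (x + t n *\<^sub>R w) - indicator S x * \<phi> x) / t n) = 0"
      by simp
    then show ?thesis by (simp add: D_def right_diff_distrib diff_divide_distrib)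
  qed
  \<comment> \<open>Domination: the Lipschitz bound gives \<open>\<bar>B\<bar> * norm w\<close>, and
    since all steps are at most one, every quotient vanishes outside the ball of radius
    \<open>R + norm w\<close>.\<close>
  have "(\<lambda>n. LINT x|lborel. indicator S x * D n x) \<longlonglongrightarrow> (LINT x|lborel. indicator S x * (w \<bullet> G x))"
  proof (rule integral_dominated_convergence[where w="\<lambda>x. (\<bar>B\<bar> * norm w) * indicator (cball 0 (R + norm w)) x"])
    show "integrable lborel (\<lambda>x. (\<bar>B\<bar> * norm w) * indicator (cball 0 (R + norm w)) x)"
      by (intro integrable_mult_right integrable_real_indicator) (use emeasure_bounded_finite[OF bounded_cball] in auto)
    show "AE x in lborel. (\<lambda>n. indicator S x * D n x) \<longlonglongrightarrow> indicator S x * (w \<bullet> G x)"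
    proof (rule AE_I2)
      fix x
      have "((\<lambda>s. \<phi> (x + s *\<^sub>R w)) has_derivative (\<lambda>s. (s *\<^sub>R w) \<bullet> G x)) (at 0)"
        using GD[of x] unfolding gderiv_def
        by (intro has_derivative_compose[where f="\<lambda>s. x + s *\<^sub>R w" and g=\<phi>]) (auto intro!: derivative_eq_intros)
      note der = this
      have "((\<lambda>s. \<phi> (x + s *\<^sub>R w)) has_real_derivative (w \<bullet> G x)) (at 0)"
      proof -
        have "(\<lambda>s. (s *\<^sub>R w) \<bullet> G x) = (*) (w \<bullet> G x)" by (rule ext) simp
        then show ?thesis using der by (simp add: has_field_derivative_def)
      qed
      then have "((\<lambda>s. (\<phi> (x + (0 + s) *\<^sub>R w) - \<phi> (x + 0 *\<^sub>R w)) / s) \<longlongrightarrow> w \<bullet> G x) (at 0)"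
        unfolding DERIV_def .
      moreover have "filterlim t (at 0) sequentially"
        using t0 t(1) by (auto simp: filterlim_at less_imp_neq[symmetric] intro!: always_eventually)
      ultimately have "(\<lambda>n. D n x) \<longlonglongrightarrow> w \<bullet> G x"
        unfolding D_def using filterlim_compose by fastforce
      then show "(\<lambda>n. indicator S x * D n x) \<longlonglongrightarrow> indicator S x * (w \<bullet> G x)"
        by (intro tendsto_intros)
    qed
    show "AE x in lborel. norm (indicator S x * D n x) \<le> (\<bar>B\<bar> * norm w) * indicator (cball 0 (R + norm w)) x" for n
    proof (rule AE_I2)
      fix x
      have "\<bar>\<phi> (x + t n *\<^sub>R w) - \<phi> x\<bar> \<le> \<bar>B\<bar> * (t n * norm w)"
        using lip[of "x + t n *\<^sub>R w" x] t(1)[of n] by simp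
      then have *: "\<bar>D n x\<bar> \<le> \<bar>B\<bar> * norm w"
        using t(1)[of n] by (simp add: D_def divide_le_eq algebra_simps)
      have **: "D n x = 0" if "x \<notin> cball 0 (R + norm w)"
      proof -
        have "norm x > R + norm w" using that by simp
        moreover have "t n * norm w \<le> norm w" using t[of n] mult_right_mono[of "t n" 1 "norm w"] by simp
        moreover have "norm x \<le> norm (x + t n *\<^sub>R w) + t n * norm w"
          using norm_triangle_ineq4[of "x + t n *\<^sub>R w" "t n *\<^sub>R w"] t(1)[of n] by simp
        ultimately have "norm (x + t n *\<^sub>R w) > R" "norm x > R" using norm_ge_zero[of w] by linarith+
        then have "x + t n *\<^sub>R w \<notin> K" "x \<notin> K" using R by force+
        then show ?thesis using C1_supported_outside[OF \<phi>] by (simp add: D_def)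
      qed
      show "norm (indicator S x * D n x) \<le> (\<bar>B\<bar> * norm w) * indicator (cball 0 (R + norm w)) x"
        using * ** by (cases "x \<in> cball 0 (R + norm w)") (auto simp: indicator_def)
    qed
  qed (simp_all add: D_def)
  then show ?thesis unfolding zero using LIMSEQ_unique tendsto_const by blast
qed

lemma C1_supported_mult:
  assumes \<phi>: "C1_supported \<phi> G K" and h: "\<And>x. GDERIV h x :> H x" "continuous_on UNIV H"
  shows "C1_supported (\<lambda>x. h x * \<phi> x) (\<lambda>x. h x *\<^sub>R G x + \<phi> x *\<^sub>R H x) K"
proof -
  have "continuous_on UNIV h"
    using h by (auto simp: gderiv_def intro!: has_derivative_continuous_on[where f'="\<lambda>x k. k \<bullet> H x"])
  then show ?thesis
    using \<phi> h C1_supported_continuous[OF \<phi>]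
    by (auto simp: C1_supported_def intro!: GDERIV_mult continuous_intros)
qed

lemma GDERIV_inner_left: "GDERIV (\<lambda>x. i \<bullet> x + c) x :> i"
  by (auto simp: gderiv_def inner_commute intro!: derivative_eq_intros)

text \<open>The derivative of \<open>(i \<bullet> x) * \<phi> x\<close> in direction
  \<open>i\<close> has integral zero. Summing over the basis produces \<open>x \<bullet> G x\<close>
  and \<open>DIM('a)\<close> copies of \<open>\<phi>\<close>.\<close>

lemma integral_affine_field:
  assumes \<phi>: "C1_supported \<phi> G K"
  shows "(LINT x|lborel. (a + b *\<^sub>R (x::'a::euclidean_space)) \<bullet> G x) = - (b * DIM('a)) * (LINT x|lborel. \<phi> x)"
proof -
  note cont = C1_supported_continuous[OF \<phi>] and out = C1_supported_outside[OF \<phi>]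
  have K: "compact K" using \<phi> by (simp add: C1_supported_def)
  have ia: "integrable lborel (\<lambda>x. a \<bullet> G x)"
    using K by (intro integrable_continuous_supported[where K=K] continuous_intros cont) (auto simp: out)
  have ix: "integrable lborel (\<lambda>x. x \<bullet> G x)"
    using K by (intro integrable_continuous_supported[where K=K] continuous_intros cont) (auto simp: out)
  have i\<phi>: "integrable lborel \<phi>" using C1_supported_integrable[OF \<phi>] by simp
  have a0: "(LINT x|lborel. a \<bullet> G x) = 0"
    using integral_directional_derivative[OF \<phi>, of UNIV a] by simp
  have i0: "(LINT x|lborel. (i \<bullet> x) * (i \<bullet> G x) + \<phi> x) = 0"
    and ii: "integrable lborel (\<lambda>x. (i \<bullet> x) * (i \<bullet> G x) + \<phi> x)" if "i \<in> Basis" for i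
  proof -
    have *: "C1_supported (\<lambda>x. (i \<bullet> x) * \<phi> x) (\<lambda>x. (i \<bullet> x) *\<^sub>R G x + \<phi> x *\<^sub>R i) K"
      using GDERIV_inner_left[of i 0] by (intro C1_supported_mult[OF \<phi>]) (auto intro: continuous_intros)
    show "(LINT x|lborel. (i \<bullet> x) * (i \<bullet> G x) + \<phi> x) = 0"
      using integral_directional_derivative[OF *, of UNIV i] that by (simp add: inner_add_right)
    show "integrable lborel (\<lambda>x. (i \<bullet> x) * (i \<bullet> G x) + \<phi> x)"
      using K by (intro integrable_continuous_supported[where K=K] continuous_intros cont) (auto simp: out)
  qed
  have "(LINT x|lborel. x \<bullet> G x + real DIM('a) * \<phi> x) = (LINT x|lborel. (\<Sum>i\<in>Basis. (i \<bullet> x) * (i \<bullet> G x) + \<phi> x))"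
  proof (rule Bochner_Integration.integral_cong[OF refl])
    fix x
    show "x \<bullet> G x + real DIM('a) * \<phi> x = (\<Sum>i\<in>Basis. (i \<bullet> x) * (i \<bullet> G x) + \<phi> x)"
      unfolding euclidean_inner[of x "G x"] sum.distrib by (simp add: inner_commute)
  qed
  also have "\<dots> = 0" by (simp add: Bochner_Integration.integral_sum ii i0)
  finally have "(LINT x|lborel. x \<bullet> G x) = - real DIM('a) * (LINT x|lborel. \<phi> x)"
    using ix i\<phi> by simp
  moreover have "(LINT x|lborel. (a + b *\<^sub>R x) \<bullet> G x) = (LINT x|lborel. a \<bullet> G x) + b * (LINT x|lborel. x \<bullet> G x)"
    using ia ix by (simp add: inner_add_left)
  ultimately show ?thesis using a0 by simp
qed

section \<open>Explicit cutoff functions of class C1\<close>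

definition pos_sq :: "real \<Rightarrow> real" where "pos_sq t = (max 0 t)\<^sup>2"

lemma DERIV_pos_sq: "DERIV pos_sq t :> 2 * max 0 t"
proof (cases t "0::real" rule: linorder_cases)
  case less
  have "DERIV (\<lambda>_. 0) t :> 0" by simp
  then have "DERIV pos_sq t :> 0"
    by (rule DERIV_cong_ev[THEN iffD1, rotated -1])
      (use less in \<open>auto simp: pos_sq_def eventually_nhds intro!: exI[of _ "{..<0}"]\<close>)
  then show ?thesis using less by simp
next
  case greater
  have "DERIV (\<lambda>t. t\<^sup>2) t :> 2 * t" by (auto intro!: derivative_eq_intros)
  then have "DERIV pos_sq t :> 2 * t"
    by (rule DERIV_cong_ev[THEN iffD1, rotated -1])
      (use greater in \<open>auto simp: pos_sq_def eventually_nhds intro!: exI[of _ "{0<..}"]\<close>)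
  then show ?thesis using greater by simp
next
  case equal
  have "((\<lambda>h. (pos_sq (0 + h) - pos_sq 0) / h) \<longlongrightarrow> 0) (at 0)"
  proof (rule Lim_null_comparison)
    show "\<forall>\<^sub>F h in at 0. norm ((pos_sq (0 + h) - pos_sq 0) / h) \<le> \<bar>h\<bar>"
      by (rule always_eventually) (auto simp: pos_sq_def max_def power2_eq_square)
    show "((\<lambda>h::real. \<bar>h\<bar>) \<longlongrightarrow> 0) (at 0)" by (intro tendsto_eq_intros) auto
  qed
  then show ?thesis using equal by (simp add: DERIV_def)
qed

text \<open>A rational step: zero for \<open>t \<le> 0\<close>, then
  \<open>t\<^sup>2 / (1 + t\<^sup>2)\<close>, which stays below 1 and tends to 1. It is of class C1,
  which is all that \<open>test_function\<close> demands.\<close>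

definition smooth_step :: "real \<Rightarrow> real" where "smooth_step t = pos_sq t / (1 + t\<^sup>2)"

lemma DERIV_smooth_step:
  "DERIV smooth_step t :> (2 * max 0 t * (1 + t\<^sup>2) - pos_sq t * (2 * t)) / ((1 + t\<^sup>2) * (1 + t\<^sup>2))"
proof -
  have "1 + t\<^sup>2 \<noteq> 0" by (smt (verit) zero_le_power2)
  moreover have "((\<lambda>t. 1 + t\<^sup>2) has_real_derivative 2 * t) (at t)" by (auto intro!: derivative_eq_intros)
  ultimately show ?thesis unfolding smooth_step_def[abs_def] by (intro DERIV_divide DERIV_pos_sq)
qed

definition C1 :: "('a::euclidean_space \<Rightarrow> real) \<Rightarrow> bool" where
  "C1 f \<longleftrightarrow> (\<exists>G. (\<forall>x. GDERIV f x :> G x) \<and> continuous_on UNIV G)"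

lemma C1I: "(\<And>x. GDERIV f x :> G x) \<Longrightarrow> continuous_on UNIV G \<Longrightarrow> C1 f"
  by (auto simp: C1_def)

lemma C1_continuous:
  assumes "C1 f" shows "continuous_on UNIV f"
proof -
  obtain G where "\<And>x. (f has_derivative (\<lambda>h. h \<bullet> G x)) (at x)"
    using assms by (auto simp: C1_def gderiv_def)
  then show ?thesis by (rule has_derivative_continuous_on)
qed

lemma C1_const: "C1 (\<lambda>x. c)"
  unfolding C1_def by (intro exI[of _ "\<lambda>x. 0"]) (auto intro: GDERIV_const)

lemma C1_mult:
  assumes "C1 f" "C1 h" shows "C1 (\<lambda>x. f x * h x)"
proof -
  obtain F H where *: "\<And>x. GDERIV f x :> F x" "continuous_on UNIV F"
      "\<And>x. GDERIV h x :> H x" "continuous_on UNIV H"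
    using assms unfolding C1_def by blast
  show ?thesis
  proof (rule C1I)
    show "GDERIV (\<lambda>x. f x * h x) x :> f x *\<^sub>R H x + h x *\<^sub>R F x" for x
      by (intro GDERIV_mult *)
    show "continuous_on UNIV (\<lambda>x. f x *\<^sub>R H x + h x *\<^sub>R F x)"
      by (intro continuous_intros * C1_continuous assms)
  qed
qed

lemma C1_prod: "finite I \<Longrightarrow> (\<And>i. i \<in> I \<Longrightarrow> C1 (f i)) \<Longrightarrow> C1 (\<lambda>x. \<Prod>i\<in>I. f i x)"
  by (induction I rule: finite_induct) (auto intro: C1_const C1_mult)

lemma C1_compose_affine:
  assumes "\<And>t. DERIV s t :> s' t" "continuous_on UNIV s'"
  shows "C1 (\<lambda>x. s (i \<bullet> x + c))"
proof -
  have "GDERIV (\<lambda>x. s (i \<bullet> x + c)) x :> s' (i \<bullet> x + c) *\<^sub>R i" for x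
    by (rule GDERIV_DERIV_compose[OF GDERIV_inner_left assms(1)])
  moreover have "continuous_on UNIV (\<lambda>x. s' (i \<bullet> x + c) *\<^sub>R i)"
    by (intro continuous_intros continuous_on_compose2[OF assms(2)]) auto
  ultimately show ?thesis by (rule C1I)
qed

lemma C1_smooth_step: "C1 (\<lambda>x. smooth_step (i \<bullet> x + c))"
proof (rule C1_compose_affine[OF DERIV_smooth_step])
  have "(1 + t\<^sup>2) * (1 + t\<^sup>2) \<noteq> 0" for t :: real by (smt (verit) no_zero_divisors zero_le_power2)
  then show "continuous_on UNIV (\<lambda>t. (2 * max 0 t * (1 + t\<^sup>2) - pos_sq t * (2 * t)) / ((1 + t\<^sup>2) * (1 + t\<^sup>2)))"
    unfolding pos_sq_def by (intro continuous_intros) auto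
qed

lemma smooth_step_bounds: "0 \<le> smooth_step t" "smooth_step t \<le> 1"
proof -
  have "0 < 1 + t\<^sup>2" by (smt (verit) zero_le_power2)
  moreover have "pos_sq t \<le> 1 + t\<^sup>2" by (auto simp: pos_sq_def max_def)
  ultimately show "0 \<le> smooth_step t" "smooth_step t \<le> 1" by (auto simp: smooth_step_def pos_sq_def)
qed

lemma smooth_step_nonpos: "t \<le> 0 \<Longrightarrow> smooth_step t = 0"
  by (simp add: smooth_step_def pos_sq_def)

text \<open>The shift by one makes the function vanish already for \<open>t \<le> 1 / k\<close> when
  \<open>k > 0\<close>. This keeps the cutoffs supported in a compact subset of an open box and does
  not affect the pointwise limit.\<close>

lemma smooth_step_limit:
  "(\<lambda>k. smooth_step (real k * t - 1)) \<longlonglongrightarrow> (if t > 0 then 1 else 0)"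
proof (cases "t > 0")
  case True
  have lim: "filterlim (\<lambda>k. real k * t - 1) at_top sequentially"
    unfolding diff_conv_add_uminus add.commute[of _ "- 1"]
    by (intro filterlim_tendsto_add_at_top[OF tendsto_const] filterlim_at_top_mult_tendsto_pos[OF tendsto_const True]
        filterlim_real_sequentially)
  have "filterlim (\<lambda>u::real. 1 + u\<^sup>2) at_top at_top"
    by (intro filterlim_tendsto_add_at_top[OF tendsto_const] filterlim_pow_at_top filterlim_ident) simp
  then have "((\<lambda>u::real. 1 - 1 / (1 + u\<^sup>2)) \<longlongrightarrow> 1 - 0) at_top"
    by (intro tendsto_diff tendsto_const tendsto_divide_0[where c=1] filterlim_at_top_imp_at_infinity)
  moreover have "1 - 1 / (1 + u\<^sup>2) = u\<^sup>2 / (1 + u\<^sup>2)" for u :: real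
  proof -
    have "1 + u\<^sup>2 \<noteq> 0" by (smt (verit) zero_le_power2)
    then show ?thesis by (simp add: field_simps)
  qed
  ultimately have "((\<lambda>u::real. u\<^sup>2 / (1 + u\<^sup>2)) \<longlongrightarrow> 1) at_top" by simp
  moreover have "\<forall>\<^sub>F u in at_top. u\<^sup>2 / (1 + u\<^sup>2) = smooth_step u"
    using eventually_ge_at_top[of 0] by eventually_elim (simp add: smooth_step_def pos_sq_def)
  ultimately have "(smooth_step \<longlongrightarrow> 1) at_top" by (simp add: tendsto_cong)
  from filterlim_compose[OF this lim] show ?thesis using True by simp
next
  case False
  have "smooth_step (real k * t - 1) = 0" for k
    using False mult_nonneg_nonpos[of "real k" t] by (intro smooth_step_nonpos) auto
  then show ?thesis using False by simp
qed

text \<open>The product over the coordinates of steps in the distances to the two opposite sides of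
  the box. The clauses are those needed for dominated convergence towards the indicator.\<close>

lemma box_cutoff:
  fixes a b :: "'a::euclidean_space"
  obtains \<Phi> :: "nat \<Rightarrow> 'a \<Rightarrow> real"
  where "\<And>U k. box a b \<subseteq> U \<Longrightarrow> test_function U (\<Phi> k)"
    and "\<And>k x. x \<notin> box a b \<Longrightarrow> \<Phi> k x = 0"
    and "\<And>k x. \<bar>\<Phi> k x\<bar> \<le> 1"
    and "\<And>x. (\<lambda>k. \<Phi> k x) \<longlonglongrightarrow> indicator (box a b) x"
    and "\<And>k. \<Phi> k \<in> borel_measurable borel"
proof -
  define \<Phi> :: "nat \<Rightarrow> 'a \<Rightarrow> real" where
    "\<Phi> k x = (\<Prod>i\<in>Basis. smooth_step (real k * (i \<bullet> (x - a)) - 1) * smooth_step (real k * (i \<bullet> (b - x)) - 1))" for k x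
  have C1: "C1 (\<Phi> k)" for k
  proof -
    have *: "smooth_step (real k * (i \<bullet> (x - a)) - 1) = smooth_step ((real k *\<^sub>R i) \<bullet> x + (- (real k * (i \<bullet> a)) - 1))"
      "smooth_step (real k * (i \<bullet> (b - x)) - 1) = smooth_step ((- real k *\<^sub>R i) \<bullet> x + (real k * (i \<bullet> b) - 1))" for i x
      by (simp_all add: inner_diff_right algebra_simps)
    show ?thesis unfolding \<Phi>_def[abs_def] * by (intro C1_prod C1_mult C1_smooth_step) auto
  qed
  \<comment> \<open>The points at which no factor is cut off by the shift. It is closed and inside
    the open box, hence a compact set carrying \<open>\<Phi> k\<close>; for \<open>k = 0\<close> it
    is empty.\<close>
  define L where "L k = {x. \<forall>i\<in>Basis. 1 \<le> real k * (i \<bullet> (x - a)) \<and> 1 \<le> real k * (i \<bullet> (b - x))}" for k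
  have L: "L k \<subseteq> box a b" for k
  proof
    fix x assume x: "x \<in> L k"
    have "0 < i \<bullet> (x - a) \<and> 0 < i \<bullet> (b - x)" if "i \<in> Basis" for i
    proof -
      have "0 < real k * (i \<bullet> (x - a))" "0 < real k * (i \<bullet> (b - x))" using x that by (force simp: L_def)+
      then show ?thesis by (auto simp: zero_less_mult_iff)
    qed
    then show "x \<in> box a b" by (auto simp: mem_box inner_diff_right inner_commute)
  qed
  have L_compact: "compact (L k)" for k
  proof -
    have "closed (L k)"
    proof -
      have "L k = (\<Inter>i\<in>Basis. {x. 1 \<le> real k * (i \<bullet> (x - a))} \<inter> {x. 1 \<le> real k * (i \<bullet> (b - x))})"
        by (auto simp: L_def)
      also have "closed \<dots>" by (intro closed_INT ballI closed_Int closed_Collect_le continuous_intros)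
      finally show ?thesis .
    qed
    moreover have "bounded (L k)" using L bounded_box bounded_subset by blast
    ultimately show ?thesis by (simp add: compact_eq_bounded_closed)
  qed
  have out: "\<Phi> k x = 0" if xL: "x \<notin> L k" for k x
  proof -
    obtain i where i0: "i \<in> Basis" "\<not> (1 \<le> real k * (i \<bullet> (x - a)) \<and> 1 \<le> real k * (i \<bullet> (b - x)))"
      using xL by (auto simp: L_def)
    then have i: "i \<in> Basis" "real k * (i \<bullet> (x - a)) - 1 \<le> 0 \<or> real k * (i \<bullet> (b - x)) - 1 \<le> 0"
      by linarith+
    then show ?thesis unfolding \<Phi>_def
      by (intro prod_zero bexI[of _ i]) (auto simp: smooth_step_nonpos)
  qed
  have "C1_supported (\<Phi> k) (gradient (\<Phi> k)) (L k)" for k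
  proof -
    obtain G where G: "\<And>x. GDERIV (\<Phi> k) x :> G x" "continuous_on UNIV G"
      using C1[of k] by (auto simp: C1_def)
    then have "gradient (\<Phi> k) = G" by (auto simp: gradient_eq)
    then show ?thesis using G L_compact out by (simp add: C1_supported_def)
  qed
  then have 1: "test_function U (\<Phi> k)" if "box a b \<subseteq> U" for U k
    using C1_supported_test_function L[of k] that by blast
  have 2: "\<Phi> k x = 0" if "x \<notin> box a b" for k x using that out L by blast
  have 3: "\<bar>\<Phi> k x\<bar> \<le> 1" for k x
  proof -
    have "0 \<le> \<Phi> k x" unfolding \<Phi>_def by (intro prod_nonneg) (auto simp: smooth_step_bounds)
    moreover have "\<Phi> k x \<le> 1" unfolding \<Phi>_def by (intro prod_le_1) (auto simp: smooth_step_bounds mult_le_one)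
    ultimately show ?thesis by simp
  qed
  have 4: "(\<lambda>k. \<Phi> k x) \<longlonglongrightarrow> indicator (box a b) x" for x
  proof -
    have "(\<lambda>k. \<Phi> k x) \<longlonglongrightarrow> (\<Prod>i\<in>Basis. (if i \<bullet> (x - a) > 0 then 1 else 0) * (if i \<bullet> (b - x) > 0 then 1 else 0))"
      unfolding \<Phi>_def by (intro tendsto_intros smooth_step_limit)
    also have "(\<Prod>i\<in>Basis. (if i \<bullet> (x - a) > 0 then 1 else 0) * (if i \<bullet> (b - x) > 0 then 1 else 0)) = (indicator (box a b) x :: real)"
    proof (cases "x \<in> box a b")
      case True
      then show ?thesis by (auto simp: mem_box inner_diff_right inner_commute intro!: prod.neutral)
    next
      case False
      then obtain i where "i \<in> Basis" "\<not> (0 < i \<bullet> (x - a) \<and> 0 < i \<bullet> (b - x))"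
        by (auto simp: mem_box inner_diff_right inner_commute)
      then show ?thesis using False by (auto intro!: bexI[of _ i])
    qed
    finally show ?thesis .
  qed
  have 5: "\<Phi> k \<in> borel_measurable borel" for k
    using C1_continuous[OF C1] by (rule borel_measurable_continuous_onI)
  show ?thesis by (rule that[of \<Phi>]) (use 1 2 3 4 5 in auto)
qed

text \<open>As \<open>ennreal\<close> truncates negative values, \<open>?M\<close> and
  \<open>?N\<close> have the positive and the negative part of \<open>h\<close> as densities. They
  agree on boxes, an intersection-stable generator of the Borel sets, so they coincide, and so do
  their densities almost everywhere.\<close>

lemma AE_zero_if_box_integrals_zero:
  fixes h :: "'a::euclidean_space \<Rightarrow> real"
  assumes h: "integrable lborel h"
    and box: "\<And>a b. (LINT x|lborel. indicator (box a b) x * h x) = 0"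
  shows "AE x in lborel. h x = 0"
proof -
  have [measurable]: "h \<in> borel_measurable borel" using h by auto
  let ?M = "density lborel (\<lambda>x. ennreal (h x))" and ?N = "density lborel (\<lambda>x. ennreal (- h x))"
  have ib: "integrable lborel (\<lambda>x. indicator A x * h x)" if "A \<in> sets borel" for A
    using integrable_mult_indicator[OF _ h, of A] that by simp
  have eq: "emeasure ?M (box a b) = emeasure ?N (box a b)" for a b
  proof -
    let ?f = "\<lambda>x. indicator (box a b) x * h x"
    have i: "integrable lborel ?f" by (rule ib) simp
    have "enn2real (\<integral>\<^sup>+x. ?f x \<partial>lborel) = enn2real (\<integral>\<^sup>+x. - ?f x \<partial>lborel)"
      using real_lebesgue_integral_def[OF i] box[of a b] by simp
    moreover have "(\<integral>\<^sup>+x. ?f x \<partial>lborel) \<noteq> \<infinity>" "(\<integral>\<^sup>+x. - ?f x \<partial>lborel) \<noteq> \<infinity>"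
      using i unfolding real_integrable_def by auto
    moreover have "u = v" if "enn2real u = enn2real v" "u \<noteq> \<infinity>" "v \<noteq> \<infinity>" for u v
    proof -
      have "ennreal (enn2real u) = u" "ennreal (enn2real v) = v" using that(2,3) by (simp_all add: less_top)
      then show ?thesis using that(1) by metis
    qed
    ultimately have *: "(\<integral>\<^sup>+x. ?f x \<partial>lborel) = (\<integral>\<^sup>+x. - ?f x \<partial>lborel)" by blast
    have "emeasure ?M (box a b) = (\<integral>\<^sup>+x. ?f x \<partial>lborel)" "emeasure ?N (box a b) = (\<integral>\<^sup>+x. - ?f x \<partial>lborel)"
      by (auto simp: emeasure_density intro!: nn_integral_cong split: split_indicator)
    then show ?thesis using * by simp
  qed
  have "?M = ?N"
  proof (rule measure_eqI_generator_eq)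
    let ?E = "range (\<lambda>(a, b). box a b :: 'a set)"
    show "Int_stable ?E" by (auto simp: Int_stable_def box_Int_box)
    show "sets ?M = sigma_sets UNIV ?E" "sets ?N = sigma_sets UNIV ?E" by (simp_all add: borel_eq_box)
    show "emeasure ?M X = emeasure ?N X" if "X \<in> ?E" for X using that eq by auto
    let ?A = "\<lambda>n::nat. box (- (real n *\<^sub>R One)) (real n *\<^sub>R One) :: 'a set"
    show "range ?A \<subseteq> ?E" by auto
    show "(\<Union>i. ?A i) = UNIV" by (rule UN_box_eq_UNIV)
    show "emeasure ?M (?A i) \<noteq> \<infinity>" for i
    proof -
      have "emeasure ?M (?A i) \<le> (\<integral>\<^sup>+x. h x \<partial>lborel)"
        by (auto simp: emeasure_density intro!: nn_integral_mono split: split_indicator)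
      moreover have "(\<integral>\<^sup>+x. h x \<partial>lborel) \<noteq> \<infinity>" using h unfolding real_integrable_def by auto
      ultimately show ?thesis by (auto simp: top_unique)
    qed
  qed auto
  then have "AE x in lborel. ennreal (h x) = ennreal (- h x)"
    by (intro sigma_finite_measure.density_unique[OF lborel.sigma_finite_measure_axioms]) auto
  moreover have "u = 0" if "ennreal u = ennreal (- u)" for u :: real
  proof (cases "u \<ge> 0")
    case True
    then have "ennreal u = 0" using that by (simp add: ennreal_neg)
    then show ?thesis using True by simp
  next
    case False
    then have "ennreal (- u) = 0" using that by (simp add: ennreal_neg)
    then show ?thesis using False by simp
  qed
  ultimately show ?thesis by (auto elim: eventually_mono)
qed

section \<open>Square-integrable functions and the fundamental lemma\<close>

lemma borel_imp_lebesgue_measurable: "f \<in> borel_measurable borel \<Longrightarrow> f \<in> borel_measurable lebesgue"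
  by (rule measurable_completion) simp

lemma L2_inner_lebesgue:
  "\<Omega> \<in> sets lebesgue \<Longrightarrow> L2_inner \<Omega> u v = (LINT x|lebesgue. indicator \<Omega> x * (u x \<bullet> v x))"
  unfolding L2_inner_def by (subst integral_restrict_space) auto

lemma L2_inner_integrable:
  assumes "u \<in> L2 \<Omega>" "v \<in> L2 \<Omega>"
  shows "integrable (lebesgue_on \<Omega>) (\<lambda>x. u x \<bullet> v x)"
proof (rule Bochner_Integration.integrable_bound)
  show "integrable (lebesgue_on \<Omega>) (\<lambda>x. (norm (u x))\<^sup>2 + (norm (v x))\<^sup>2)"
    using assms by (auto simp: L2_def)
  show "(\<lambda>x. u x \<bullet> v x) \<in> borel_measurable (lebesgue_on \<Omega>)"
    using assms by (auto simp: L2_def)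
  have "\<bar>a \<bullet> b\<bar> \<le> (norm a)\<^sup>2 + (norm b)\<^sup>2" for a b :: 'b
  proof -
    have "\<bar>a \<bullet> b\<bar> \<le> norm a * norm b" by (rule Cauchy_Schwarz_ineq2)
    also have "\<dots> \<le> (norm a)\<^sup>2 + (norm b)\<^sup>2"
      using sum_squares_bound[of "norm a" "norm b"] zero_le_power2[of "norm a"] zero_le_power2[of "norm b"]
        mult_nonneg_nonneg[OF norm_ge_zero[of a] norm_ge_zero[of b]] by linarith
    finally show ?thesis .
  qed
  then show "AE x in lebesgue_on \<Omega>. norm (u x \<bullet> v x) \<le> norm ((norm (u x))\<^sup>2 + (norm (v x))\<^sup>2)"
    by simp
qed

lemma L2_lincomb:
  assumes "u \<in> L2 \<Omega>" "v \<in> L2 \<Omega>"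
  shows "(\<lambda>x. a *\<^sub>R u x + b *\<^sub>R v x) \<in> L2 \<Omega>"
proof -
  have m: "(\<lambda>x. a *\<^sub>R u x + b *\<^sub>R v x) \<in> borel_measurable (lebesgue_on \<Omega>)"
    using assms by (auto simp: L2_def)
  have "(norm (a *\<^sub>R u x + b *\<^sub>R v x))\<^sup>2 = a * (a * (u x \<bullet> u x)) + 2 * (a * (b * (u x \<bullet> v x))) + b * (b * (v x \<bullet> v x))" for x
    by (simp add: power2_norm_eq_inner inner_add_left inner_add_right inner_commute algebra_simps)
  moreover have "integrable (lebesgue_on \<Omega>) (\<lambda>x. a * (a * (u x \<bullet> u x)) + 2 * (a * (b * (u x \<bullet> v x))) + b * (b * (v x \<bullet> v x)))"
    using L2_inner_integrable assms by (intro Bochner_Integration.integrable_add integrable_mult_right) blast+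
  ultimately show ?thesis using m by (simp add: L2_def)
qed

lemma zero_L2: "(\<lambda>x. 0) \<in> L2 \<Omega>"
  by (simp add: L2_def)

lemma L2_inner_commute: "L2_inner \<Omega> u v = L2_inner \<Omega> v u"
  by (simp add: L2_inner_def inner_commute)

lemma L2_inner_lincomb_left:
  assumes "u \<in> L2 \<Omega>" "v \<in> L2 \<Omega>" "w \<in> L2 \<Omega>"
  shows "L2_inner \<Omega> (\<lambda>x. a *\<^sub>R u x + b *\<^sub>R v x) w = a * L2_inner \<Omega> u w + b * L2_inner \<Omega> v w"
  using L2_inner_integrable[OF assms(1,3)] L2_inner_integrable[OF assms(2,3)]
  by (simp add: L2_inner_def inner_add_left)

lemma L2_inner_lincomb_right:
  assumes "u \<in> L2 \<Omega>" "v \<in> L2 \<Omega>" "w \<in> L2 \<Omega>"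
  shows "L2_inner \<Omega> w (\<lambda>x. a *\<^sub>R u x + b *\<^sub>R v x) = a * L2_inner \<Omega> w u + b * L2_inner \<Omega> w v"
  using L2_inner_lincomb_left[OF assms] by (simp add: L2_inner_commute)

lemma L2_inner_cong:
  assumes "ae_eq \<Omega> u u'" "ae_eq \<Omega> v v'" "u \<in> L2 \<Omega>" "v \<in> L2 \<Omega>" "u' \<in> L2 \<Omega>" "v' \<in> L2 \<Omega>"
  shows "L2_inner \<Omega> u v = L2_inner \<Omega> u' v'"
  unfolding L2_inner_def
proof (rule integral_cong_AE)
  show "AE x in lebesgue_on \<Omega>. u x \<bullet> v x = u' x \<bullet> v' x"
    using assms(1,2) unfolding ae_eq_def by eventually_elim simp
qed (use assms in \<open>auto simp: L2_def\<close>)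

lemma L2_inner_self_nonneg: "0 \<le> L2_inner \<Omega> u u"
  by (simp add: L2_inner_def)

lemma L2_inner_self_zero:
  assumes "u \<in> L2 \<Omega>" "L2_inner \<Omega> u u = 0" shows "ae_eq \<Omega> u (\<lambda>x. 0)"
  using assms integral_nonneg_eq_0_iff_AE[OF L2_inner_integrable[OF assms(1,1)]]
  by (simp add: L2_inner_def ae_eq_def)

lemma ae_eq_refl: "ae_eq \<Omega> u u" by (simp add: ae_eq_def)

lemma ae_eq_sym: "ae_eq \<Omega> u v \<Longrightarrow> ae_eq \<Omega> v u" by (simp add: ae_eq_def eq_commute)

lemma ae_eq_trans:
  assumes "ae_eq \<Omega> u v" "ae_eq \<Omega> v w" shows "ae_eq \<Omega> u w"
  using assms unfolding ae_eq_def by eventually_elim simp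

lemma ae_eq_lincomb:
  fixes u :: "'a::euclidean_space \<Rightarrow> 'b::real_vector"
  assumes "ae_eq \<Omega> u u'" "ae_eq \<Omega> v v'"
  shows "ae_eq \<Omega> (\<lambda>x. a *\<^sub>R u x + b *\<^sub>R v x) (\<lambda>x. a *\<^sub>R u' x + b *\<^sub>R v' x)"
  using assms unfolding ae_eq_def by eventually_elim simp

lemma ae_eq_restrict_space_iff:
  "S \<in> sets lebesgue \<Longrightarrow> ae_eq S u v \<longleftrightarrow> (AE x in lebesgue. x \<in> S \<longrightarrow> u x = v x)"
  unfolding ae_eq_def by (rule AE_restrict_space_iff) simp

lemma ae_eq_subset:
  assumes "ae_eq S u v" "R \<subseteq> S" "S \<in> sets lebesgue" "R \<in> sets lebesgue"
  shows "ae_eq R u v"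
  using assms by (auto simp: ae_eq_restrict_space_iff elim!: eventually_mono)

lemma L2_subset:
  assumes "u \<in> L2 S" "R \<subseteq> S" "S \<in> sets lebesgue" "R \<in> sets lebesgue"
  shows "u \<in> L2 R"
proof -
  have "u \<in> borel_measurable (lebesgue_on R)"
    using assms(1,2) measurable_restrict_mono by (auto simp: L2_def)
  have "integrable lebesgue (\<lambda>x. indicator S x *\<^sub>R (norm (u x))\<^sup>2)"
    using assms by (subst integrable_restrict_space[symmetric]) (auto simp: L2_def)
  then have "integrable lebesgue (\<lambda>x. indicator R x *\<^sub>R (indicator S x *\<^sub>R (norm (u x))\<^sup>2))"
    using assms(4) by (rule integrable_mult_indicator[rotated])
  moreover have "indicator R x *\<^sub>R (indicator S x *\<^sub>R (norm (u x))\<^sup>2) = indicator R x *\<^sub>R (norm (u x))\<^sup>2" for x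
    using assms(2) by (auto simp: indicator_def)
  ultimately have "integrable lebesgue (\<lambda>x. indicator R x *\<^sub>R (norm (u x))\<^sup>2)" by (simp only:)
  then have "integrable (lebesgue_on R) (\<lambda>x. (norm (u x))\<^sup>2)"
    using assms by (subst integrable_restrict_space) auto
  then show ?thesis using \<open>u \<in> borel_measurable (lebesgue_on R)\<close> by (simp add: L2_def)
qed

lemma bounded_L2:
  fixes u :: "'a::euclidean_space \<Rightarrow> 'b::euclidean_space"
  assumes "S \<in> lmeasurable" "u \<in> borel_measurable (lebesgue_on S)" "\<And>x. x \<in> S \<Longrightarrow> norm (u x) \<le> B"
  shows "u \<in> L2 S"
proof -
  have "integrable (lebesgue_on S) (\<lambda>x. (norm (u x))\<^sup>2)"
  proof (rule Bochner_Integration.integrable_bound)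
    have "integrable lebesgue (\<lambda>x. indicator S x *\<^sub>R B\<^sup>2)" using assms(1) by (auto simp: fmeasurable_def)
    then show "integrable (lebesgue_on S) (\<lambda>x. B\<^sup>2)"
      using assms(1) by (subst integrable_restrict_space) (auto simp: fmeasurable_def)
    show "AE x in lebesgue_on S. norm ((norm (u x))\<^sup>2) \<le> norm (B\<^sup>2)"
      using assms(3) by (intro AE_I2) (auto simp: power_mono space_restrict_space)
  qed (use assms in auto)
  then show ?thesis using assms by (simp add: L2_def)
qed

lemma continuous_supported_L2:
  fixes f :: "'a::euclidean_space \<Rightarrow> 'b::euclidean_space"
  assumes f: "continuous_on UNIV f" "compact K" "\<And>x. x \<notin> K \<Longrightarrow> f x = 0" and S: "S \<in> sets lebesgue"
  shows "f \<in> L2 S"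
proof (rule L2_subset[where S=UNIV])
  have f2: "continuous_on UNIV (\<lambda>x. (norm (f x))\<^sup>2)" by (intro continuous_intros f)
  then have "integrable lborel (\<lambda>x. (norm (f x))\<^sup>2)"
    using f by (intro integrable_continuous_supported[where K=K]) auto
  then have "integrable lebesgue (\<lambda>x. (norm (f x))\<^sup>2)"
    using f2 by (subst integrable_completion) (auto intro: borel_measurable_continuous_onI)
  moreover have "f \<in> borel_measurable lebesgue"
    using borel_measurable_continuous_onI[OF f(1)] by (rule borel_imp_lebesgue_measurable)
  ultimately show "f \<in> L2 UNIV" by (simp add: L2_def lebesgue_on_UNIV_eq)
qed (use S in auto)

lemma test_function_L2:
  assumes "test_function U \<phi>" "S \<in> sets lebesgue"
  shows "\<phi> \<in> L2 S" "gradient \<phi> \<in> L2 S"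
proof -
  let ?K = "closure {x. \<phi> x \<noteq> 0}"
  have *: "C1_supported \<phi> (gradient \<phi>) ?K" using assms(1) by (rule test_function_C1_supported)
  then have K: "compact ?K" unfolding C1_supported_def by blast
  show "\<phi> \<in> L2 S"
    by (rule continuous_supported_L2[OF C1_supported_continuous(1)[OF *] K C1_supported_outside(1)[OF *] assms(2)])
  show "gradient \<phi> \<in> L2 S"
    by (rule continuous_supported_L2[OF C1_supported_continuous(2)[OF *] K C1_supported_outside(2)[OF *] assms(2)])
qed

lemma test_function_outside:
  assumes "test_function U \<phi>" "x \<notin> U" shows "\<phi> x = 0" "gradient \<phi> x = 0"
  using C1_supported_outside[OF test_function_C1_supported[OF assms(1)], of x] assms
  by (auto simp: test_function_def)

lemma L2_inner_supported:
  assumes "\<And>x. x \<notin> R \<Longrightarrow> v x = 0" "R \<subseteq> S" "S \<in> sets lebesgue" "R \<in> sets lebesgue"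
  shows "L2_inner S u v = L2_inner R u v"
  unfolding L2_inner_lebesgue[OF assms(3)] L2_inner_lebesgue[OF assms(4)]
  using assms by (intro Bochner_Integration.integral_cong refl) (auto simp: indicator_def)

text \<open>The fundamental lemma of the calculus of variations. Cutoffs converging to the indicator
  of a box in \<open>U\<close> show that the integral of \<open>g\<close> over each such box
  vanishes; uniqueness on each box and a countable cover of \<open>U\<close> do the rest.\<close>

lemma ae_eq_zero_if_test_integrals_zero:
  fixes g :: "'a::euclidean_space \<Rightarrow> real"
  assumes U: "open U" and g: "g \<in> L2 U"
    and test: "\<And>\<phi>. test_function U \<phi> \<Longrightarrow> L2_inner U g \<phi> = 0"
  shows "ae_eq U g (\<lambda>x. 0)"
proof -
  have Us: "U \<in> sets lebesgue" using U by simp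
  have ig2: "integrable lebesgue (\<lambda>x. indicator U x *\<^sub>R (norm (g x))\<^sup>2)"
    using g Us by (subst integrable_restrict_space[symmetric]) (auto simp: L2_def)
  have mg: "(\<lambda>x. indicator U x *\<^sub>R g x) \<in> borel_measurable lebesgue"
    using g Us by (subst borel_measurable_restrict_space_iff[symmetric]) (auto simp: L2_def)
  have ibox: "integrable lebesgue (\<lambda>x. indicator (box a b) x * g x)" if "box a b \<subseteq> U" for a b
  proof (rule Bochner_Integration.integrable_bound)
    have "integrable lebesgue (\<lambda>x. indicator (box a b) x :: real)"
      by (rule integrable_real_indicator) (auto simp: emeasure_lborel_box_eq)
    then show "integrable lebesgue (\<lambda>x. indicator (box a b) x + indicator U x *\<^sub>R (norm (g x))\<^sup>2)"
      using ig2 by (rule Bochner_Integration.integrable_add)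
    have "(\<lambda>x. indicator (box a b) x * (indicator U x *\<^sub>R g x)) \<in> borel_measurable lebesgue"
      using mg by (intro borel_measurable_times borel_measurable_indicator) auto
    also have "(\<lambda>x. indicator (box a b) x * (indicator U x *\<^sub>R g x)) = (\<lambda>x. indicator (box a b) x * g x)"
      using that by (intro ext) (auto simp: indicator_def)
    finally show "(\<lambda>x. indicator (box a b) x * g x) \<in> borel_measurable lebesgue" .
    have "\<bar>t\<bar> \<le> 1 + t\<^sup>2" for t :: real
      using sum_squares_bound[of "\<bar>t\<bar>" 1] abs_ge_zero[of t] by simp
    then show "AE x in lebesgue. norm (indicator (box a b) x * g x)
        \<le> norm (indicator (box a b) x + indicator U x *\<^sub>R (norm (g x))\<^sup>2)"
      using that by (intro AE_I2) (auto simp: indicator_def)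
  qed
  have zero: "(LINT x|lebesgue. indicator (box a b) x * g x) = 0" if ab: "box a b \<subseteq> U" for a b
  proof -
    obtain \<Phi> :: "nat \<Rightarrow> 'a \<Rightarrow> real" where
      \<Phi>: "\<And>k. test_function U (\<Phi> k)" "\<And>k x. x \<notin> box a b \<Longrightarrow> \<Phi> k x = 0" "\<And>k x. \<bar>\<Phi> k x\<bar> \<le> 1"
        "\<And>x. (\<lambda>k. \<Phi> k x) \<longlonglongrightarrow> indicator (box a b) x" "\<And>k. \<Phi> k \<in> borel_measurable borel"
      using box_cutoff[of a b] ab by metis
    have "(\<lambda>k. LINT x|lebesgue. \<Phi> k x * (indicator (box a b) x * g x)) \<longlonglongrightarrow>
        (LINT x|lebesgue. indicator (box a b) x * (indicator (box a b) x * g x))"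
    proof (rule integral_dominated_convergence[where w="\<lambda>x. norm (indicator (box a b) x * g x)"])
      note m = borel_measurable_integrable[OF ibox[OF ab]]
      show "(\<lambda>x. indicator (box a b) x * (indicator (box a b) x * g x)) \<in> borel_measurable lebesgue"
        by (rule borel_measurable_times[OF borel_measurable_indicator m]) auto
      have "\<Phi> k \<in> borel_measurable lebesgue" for k using \<Phi>(5) by (rule borel_imp_lebesgue_measurable)
      then show "(\<lambda>x. \<Phi> k x * (indicator (box a b) x * g x)) \<in> borel_measurable lebesgue" for k
        using m by (rule borel_measurable_times)
      show "integrable lebesgue (\<lambda>x. norm (indicator (box a b) x * g x))"
        using ibox[OF ab] by (rule integrable_norm)
      show "AE x in lebesgue. (\<lambda>k. \<Phi> k x * (indicator (box a b) x * g x)) \<longlonglongrightarrow>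
          indicator (box a b) x * (indicator (box a b) x * g x)"
        by (intro AE_I2 tendsto_intros \<Phi>)
      show "AE x in lebesgue. norm (\<Phi> k x * (indicator (box a b) x * g x)) \<le> norm (indicator (box a b) x * g x)" for k
        using \<Phi>(3) by (intro AE_I2) (auto simp: abs_mult mult_left_le_one_le)
    qed
    moreover have "(LINT x|lebesgue. \<Phi> k x * (indicator (box a b) x * g x)) = L2_inner U g (\<Phi> k)" for k
      unfolding L2_inner_lebesgue[OF Us]
      using \<Phi>(2) ab by (intro Bochner_Integration.integral_cong refl) (auto simp: indicator_def)
    moreover have "L2_inner U g (\<Phi> k) = 0" for k using test \<Phi>(1) by blast
    ultimately have "(\<lambda>k::nat. 0::real) \<longlonglongrightarrow>
        (LINT x|lebesgue. indicator (box a b) x * (indicator (box a b) x * g x))" by (simp only:)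
    moreover have "indicator (box a b) x * (indicator (box a b) x * g x) = indicator (box a b) x * g x" for x
      by (simp add: indicator_def)
    ultimately show ?thesis by (simp add: LIMSEQ_const_iff)
  qed
  have AE_box: "AE x in lebesgue. x \<in> box a b \<longrightarrow> g x = 0" if ab: "box a b \<subseteq> U" for a b
  proof -
    \<comment> \<open>Restriction to one box, extended by zero. It is replaced by a Borel version
      \<open>h'\<close> in order to work with \<open>lborel\<close>; the test boxes may now be
      arbitrary, since the intersection of two boxes is a box inside \<open>U\<close>.\<close>
    let ?h = "\<lambda>x. indicator (box a b) x * g x"
    obtain h' where h': "h' \<in> borel_measurable lborel" "AE x in lborel. ?h x = h' x"
      using completion_ex_borel_measurable_real[OF borel_measurable_integrable[OF ibox[OF ab]]] by auto
    have h'm: "h' \<in> borel_measurable lebesgue" using h'(1) by (intro borel_imp_lebesgue_measurable) simp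
    have AEh': "AE x in lebesgue. ?h x = h' x" using h'(2) by (rule AE_completion)
    have "integrable lebesgue h'"
      using ibox[OF ab] integrable_cong_AE[OF borel_measurable_integrable[OF ibox[OF ab]] h'm AEh'] by blast
    then have ih': "integrable lborel h'" using h'(1) by (simp add: integrable_completion)
    have "(LINT x|lborel. indicator (box c d) x * h' x) = 0" for c d
    proof -
      obtain a' b' where box: "box a b \<inter> box c d = box a' b'" by (simp add: box_Int_box)
      have "(LINT x|lborel. indicator (box c d) x * h' x) = (LINT x|lebesgue. indicator (box c d) x * h' x)"
        using h'(1) by (subst integral_completion) auto
      also have "\<dots> = (LINT x|lebesgue. indicator (box c d) x * ?h x)"
      proof (rule integral_cong_AE)
        show "AE x in lebesgue. indicator (box c d) x * h' x = indicator (box c d) x * ?h x"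
          using AEh' by eventually_elim simp
      qed (use h'm borel_measurable_integrable[OF ibox[OF ab]] in \<open>auto intro!: borel_measurable_times borel_measurable_indicator\<close>)
      also have "\<dots> = (LINT x|lebesgue. indicator (box a' b') x * g x)"
        by (intro Bochner_Integration.integral_cong refl) (auto simp: box[symmetric] indicator_def)
      also have "\<dots> = 0" using zero ab box by blast
      finally show ?thesis .
    qed
    then have "AE x in lborel. h' x = 0" using AE_zero_if_box_integrals_zero[OF ih'] by blast
    then have "AE x in lebesgue. h' x = 0" by (rule AE_completion)
    with AEh' show ?thesis by eventually_elim (auto simp: indicator_def)
  qed
  \<comment> \<open>Countability of the cover allows the exceptional null sets to be united.\<close>
  obtain \<B> where \<B>: "countable \<B>" "\<B> \<subseteq> Pow U" "\<And>X. X \<in> \<B> \<Longrightarrow> \<exists>a b. X = box a b" "\<Union>\<B> = U"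
    using open_countable_Union_open_box[OF U] by blast
  have "AE x in lebesgue. x \<in> X \<longrightarrow> g x = 0" if X: "X \<in> \<B>" for X
  proof -
    obtain a b where "X = box a b" using \<B>(3)[OF X] by blast
    moreover have "X \<subseteq> U" using \<B>(2) X by blast
    ultimately show ?thesis using AE_box[of a b] by simp
  qed
  then have "AE x in lebesgue. \<forall>X\<in>\<B>. x \<in> X \<longrightarrow> g x = 0"
    by (intro AE_ball_countable[OF \<B>(1), THEN iffD2] ballI)
  then have "AE x in lebesgue. x \<in> U \<longrightarrow> g x = 0"
    by eventually_elim (use \<B>(4) in auto)
  then show ?thesis using Us by (simp add: ae_eq_restrict_space_iff)
qed

section \<open>The weak divergence\<close>

lemma is_weak_div_unique:
  assumes \<Omega>: "open \<Omega>" and "is_weak_div \<Omega> q g" "is_weak_div \<Omega> q g'"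
  shows "ae_eq \<Omega> g g'"
proof -
  have L2: "g \<in> L2 \<Omega>" "g' \<in> L2 \<Omega>" using assms by (auto simp: is_weak_div_def)
  let ?d = "\<lambda>x. 1 *\<^sub>R g x + (- 1) *\<^sub>R g' x"
  have "ae_eq \<Omega> ?d (\<lambda>x. 0)"
  proof (rule ae_eq_zero_if_test_integrals_zero[OF \<Omega> L2_lincomb[OF L2]])
    fix \<phi> assume \<phi>: "test_function \<Omega> \<phi>"
    have "L2_inner \<Omega> ?d \<phi> = 1 * L2_inner \<Omega> g \<phi> + (- 1) * L2_inner \<Omega> g' \<phi>"
      using \<Omega> by (intro L2_inner_lincomb_left L2 test_function_L2[OF \<phi>]) simp
    also have "\<dots> = 0" using assms(2,3) \<phi> by (simp add: is_weak_div_def)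
    finally show "L2_inner \<Omega> ?d \<phi> = 0" .
  qed
  then show ?thesis unfolding ae_eq_def by eventually_elim simp
qed

lemma weak_div_is_weak_div: "q \<in> Hdiv \<Omega> \<Longrightarrow> is_weak_div \<Omega> q (weak_div \<Omega> q)"
  unfolding Hdiv_def weak_div_def using someI_ex[of "is_weak_div \<Omega> q"] by auto

lemma weak_div_L2: "q \<in> Hdiv \<Omega> \<Longrightarrow> weak_div \<Omega> q \<in> L2 \<Omega>"
  using weak_div_is_weak_div by (auto simp: is_weak_div_def)

lemma Hdiv_L2: "q \<in> Hdiv \<Omega> \<Longrightarrow> q \<in> L2 \<Omega>"
  by (simp add: Hdiv_def)

lemma is_weak_div_lincomb:
  assumes \<Omega>: "open \<Omega>" and "p \<in> L2 \<Omega>" "q \<in> L2 \<Omega>" "is_weak_div \<Omega> p g" "is_weak_div \<Omega> q h"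
  shows "is_weak_div \<Omega> (\<lambda>x. a *\<^sub>R p x + b *\<^sub>R q x) (\<lambda>x. a *\<^sub>R g x + b *\<^sub>R h x)"
  unfolding is_weak_div_def
proof (intro conjI allI impI)
  have L2: "g \<in> L2 \<Omega>" "h \<in> L2 \<Omega>" using assms by (auto simp: is_weak_div_def)
  then show "(\<lambda>x. a *\<^sub>R g x + b *\<^sub>R h x) \<in> L2 \<Omega>" by (rule L2_lincomb)
  fix \<phi> assume \<phi>: "test_function \<Omega> \<phi>"
  have "\<phi> \<in> L2 \<Omega>" "gradient \<phi> \<in> L2 \<Omega>" using test_function_L2[OF \<phi>] \<Omega> by auto
  then show "L2_inner \<Omega> (\<lambda>x. a *\<^sub>R p x + b *\<^sub>R q x) (gradient \<phi>) = - L2_inner \<Omega> (\<lambda>x. a *\<^sub>R g x + b *\<^sub>R h x) \<phi>"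
    using assms \<phi> L2 by (simp only: L2_inner_lincomb_left) (simp add: is_weak_div_def)
qed

lemma Hdiv_lincomb:
  assumes "open \<Omega>" "p \<in> Hdiv \<Omega>" "q \<in> Hdiv \<Omega>"
  shows "(\<lambda>x. a *\<^sub>R p x + b *\<^sub>R q x) \<in> Hdiv \<Omega>"
  using is_weak_div_lincomb[OF assms(1) Hdiv_L2[OF assms(2)] Hdiv_L2[OF assms(3)]
      weak_div_is_weak_div[OF assms(2)] weak_div_is_weak_div[OF assms(3)], of a b]
    L2_lincomb[OF Hdiv_L2[OF assms(2)] Hdiv_L2[OF assms(3)], of a b]
  unfolding Hdiv_def by blast

text \<open>Only almost everywhere, since \<open>SOME\<close> chooses the representative for the
  combination independently of those for the summands.\<close>

lemma weak_div_lincomb: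
  assumes "open \<Omega>" "p \<in> Hdiv \<Omega>" "q \<in> Hdiv \<Omega>"
  shows "ae_eq \<Omega> (weak_div \<Omega> (\<lambda>x. a *\<^sub>R p x + b *\<^sub>R q x)) (\<lambda>x. a *\<^sub>R weak_div \<Omega> p x + b *\<^sub>R weak_div \<Omega> q x)"
  by (rule is_weak_div_unique[OF assms(1) weak_div_is_weak_div[OF Hdiv_lincomb[OF assms]]
      is_weak_div_lincomb[OF assms(1) Hdiv_L2[OF assms(2)] Hdiv_L2[OF assms(3)]
      weak_div_is_weak_div[OF assms(2)] weak_div_is_weak_div[OF assms(3)]]])

lemma zero_Hdiv: "open \<Omega> \<Longrightarrow> (\<lambda>x. 0) \<in> Hdiv \<Omega>"
proof -
  assume "open \<Omega>"
  have "is_weak_div \<Omega> (\<lambda>x. 0) (\<lambda>x. 0)" by (simp add: is_weak_div_def zero_L2 L2_inner_def)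
  then show ?thesis by (auto simp: Hdiv_def zero_L2)
qed

text \<open>Literal equality holds here: fields that agree almost everywhere satisfy the same
  predicate \<open>is_weak_div \<Omega>\<close>, so \<open>SOME\<close> returns the same
  function.\<close>

lemma weak_div_cong:
  assumes \<Omega>: "open \<Omega>" and "ae_eq \<Omega> p q" "p \<in> Hdiv \<Omega>" "q \<in> Hdiv \<Omega>"
  shows "weak_div \<Omega> p = weak_div \<Omega> q"
proof -
  have "L2_inner \<Omega> p (gradient \<phi>) = L2_inner \<Omega> q (gradient \<phi>)" if "test_function \<Omega> \<phi>" for \<phi>
    using assms Hdiv_L2 that \<Omega> by (intro L2_inner_cong ae_eq_refl test_function_L2[OF that]) auto
  then have "is_weak_div \<Omega> p = is_weak_div \<Omega> q" unfolding is_weak_div_def by (intro ext) auto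
  then show ?thesis by (simp add: weak_div_def)
qed

lemma hdiv_inner_commute: "hdiv_inner \<Omega> p q = hdiv_inner \<Omega> q p"
  by (simp add: hdiv_inner_def L2_inner_commute)

lemma hdiv_inner_lincomb_left:
  assumes \<Omega>: "open \<Omega>" and H: "p \<in> Hdiv \<Omega>" "q \<in> Hdiv \<Omega>" "r \<in> Hdiv \<Omega>"
  shows "hdiv_inner \<Omega> (\<lambda>x. a *\<^sub>R p x + b *\<^sub>R q x) r = a * hdiv_inner \<Omega> p r + b * hdiv_inner \<Omega> q r"
proof -
  have "L2_inner \<Omega> (weak_div \<Omega> (\<lambda>x. a *\<^sub>R p x + b *\<^sub>R q x)) (weak_div \<Omega> r) =
      L2_inner \<Omega> (\<lambda>x. a *\<^sub>R weak_div \<Omega> p x + b *\<^sub>R weak_div \<Omega> q x) (weak_div \<Omega> r)"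
    by (intro L2_inner_cong weak_div_lincomb ae_eq_refl weak_div_L2 L2_lincomb Hdiv_lincomb assms)
  also have "\<dots> = a * L2_inner \<Omega> (weak_div \<Omega> p) (weak_div \<Omega> r) + b * L2_inner \<Omega> (weak_div \<Omega> q) (weak_div \<Omega> r)"
    by (intro L2_inner_lincomb_left weak_div_L2 H)
  finally show ?thesis
    unfolding hdiv_inner_def by (simp add: L2_inner_lincomb_left Hdiv_L2 H algebra_simps)
qed

lemma hdiv_inner_cong:
  assumes "open \<Omega>" "ae_eq \<Omega> p p'" "ae_eq \<Omega> q q'" "p \<in> Hdiv \<Omega>" "p' \<in> Hdiv \<Omega>" "q \<in> Hdiv \<Omega>" "q' \<in> Hdiv \<Omega>"
  shows "hdiv_inner \<Omega> p q = hdiv_inner \<Omega> p' q'"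
  using weak_div_cong[of \<Omega> p p'] weak_div_cong[of \<Omega> q q'] L2_inner_cong[of \<Omega> p p' q q'] assms Hdiv_L2
  by (auto simp: hdiv_inner_def)

lemma hdiv_inner_lincomb_right:
  assumes "open \<Omega>" "p \<in> Hdiv \<Omega>" "q \<in> Hdiv \<Omega>" "r \<in> Hdiv \<Omega>"
  shows "hdiv_inner \<Omega> r (\<lambda>x. a *\<^sub>R p x + b *\<^sub>R q x) = a * hdiv_inner \<Omega> r p + b * hdiv_inner \<Omega> r q"
  unfolding hdiv_inner_commute[of \<Omega> r] by (rule hdiv_inner_lincomb_left[OF assms])

lemma bilinear_form_hdiv_inner:
  assumes "open \<Omega>" shows "bilinear_form_on \<Omega> (Hdiv \<Omega>) (Hdiv \<Omega>) (hdiv_inner \<Omega>)"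
  unfolding bilinear_form_on_def
  by (intro conjI ballI allI impI hdiv_inner_cong hdiv_inner_lincomb_left hdiv_inner_lincomb_right assms)

lemma hdiv_inner_self_zero:
  assumes "q \<in> Hdiv \<Omega>" "hdiv_inner \<Omega> q q = 0" shows "ae_eq \<Omega> q (\<lambda>x. 0)"
  using assms L2_inner_self_nonneg[of \<Omega> q] L2_inner_self_nonneg[of \<Omega> "weak_div \<Omega> q"]
  by (intro L2_inner_self_zero Hdiv_L2) (auto simp: hdiv_inner_def)

lemma L2_inner_lborel:
  fixes u v :: "'a::euclidean_space \<Rightarrow> 'b::euclidean_space"
  assumes S: "S \<in> sets borel" and c: "continuous_on UNIV u" "continuous_on UNIV v"
  shows "L2_inner S u v = (LINT x|lborel. indicator S x * (u x \<bullet> v x))"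
proof -
  have [measurable]: "u \<in> borel_measurable borel" "v \<in> borel_measurable borel" "S \<in> sets borel"
    using S c by (auto intro: borel_measurable_continuous_onI)
  have "S \<in> sets lebesgue" using S by simp
  then show ?thesis
    unfolding L2_inner_lebesgue[OF \<open>S \<in> sets lebesgue\<close>] by (subst integral_completion) auto
qed

text \<open>The weak divergence is local: a test function on \<open>U\<close> is also one on
  \<open>\<Omega>\<close>, and on \<open>U\<close> integration by parts gives the classical
  divergence of \<open>a + b x\<close>. The fundamental lemma on \<open>U\<close> then identifies
  the two.\<close>

lemma weak_div_affine:
  fixes q :: "'a::euclidean_space \<Rightarrow> 'a"
  assumes \<Omega>: "open \<Omega>" and q: "q \<in> Hdiv \<Omega>" and U: "open U" "bounded U" "U \<subseteq> \<Omega>"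
    and aff: "ae_eq U q (\<lambda>x. a + b *\<^sub>R x)"
  shows "ae_eq U (weak_div \<Omega> q) (\<lambda>x. b * DIM('a))"
proof -
  have s: "\<Omega> \<in> sets lebesgue" "U \<in> sets lebesgue" using \<Omega> U by auto
  have qL: "q \<in> L2 U" using L2_subset[OF Hdiv_L2[OF q] U(3) s] .
  have gL: "weak_div \<Omega> q \<in> L2 U" using L2_subset[OF weak_div_L2[OF q] U(3) s] .
  have Um: "U \<in> lmeasurable" using U by (intro bounded_set_imp_lmeasurable) auto
  have cL: "(\<lambda>x. b * DIM('a)) \<in> L2 U" by (rule bounded_L2[OF Um _ order_refl]) auto
  obtain B where B: "\<And>x. x \<in> U \<Longrightarrow> norm x \<le> B" using U(2) by (auto simp: bounded_iff)
  have pL: "(\<lambda>x. a + b *\<^sub>R x) \<in> L2 U"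
  proof (rule bounded_L2[OF Um])
    have "(\<lambda>x. a + b *\<^sub>R x) \<in> borel_measurable lebesgue" by (intro borel_imp_lebesgue_measurable) simp
    then show "(\<lambda>x. a + b *\<^sub>R x) \<in> borel_measurable (lebesgue_on U)" by (rule measurable_restrict_space1)
    show "norm (a + b *\<^sub>R x) \<le> norm a + \<bar>b\<bar> * B" if "x \<in> U" for x
      using norm_triangle_ineq[of a "b *\<^sub>R x"] mult_left_mono[OF B[OF that], of "\<bar>b\<bar>"] by simp
  qed
  let ?d = "\<lambda>x. 1 *\<^sub>R weak_div \<Omega> q x + (- 1) *\<^sub>R (b * DIM('a))"
  have "ae_eq U ?d (\<lambda>x. 0)"
  proof (rule ae_eq_zero_if_test_integrals_zero[OF U(1) L2_lincomb[OF gL cL]])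
    fix \<phi> assume \<phi>: "test_function U \<phi>"
    have \<phi>\<Omega>: "test_function \<Omega> \<phi>" using \<phi> U(3) unfolding test_function_def by blast
    note L = test_function_L2[OF \<phi> s(2)] and out = test_function_outside[OF \<phi>]
    note C = test_function_C1_supported[OF \<phi>]
    have cont: "continuous_on UNIV \<phi>" "continuous_on UNIV (gradient \<phi>)"
      using C1_supported_continuous[OF C] by auto
    have "L2_inner U (weak_div \<Omega> q) \<phi> = L2_inner \<Omega> (weak_div \<Omega> q) \<phi>"
      using L2_inner_supported[of U \<phi> \<Omega>] out U s by simp
    also have "\<dots> = - L2_inner \<Omega> q (gradient \<phi>)"
      using weak_div_is_weak_div[OF q] \<phi>\<Omega> by (simp add: is_weak_div_def)
    also have "L2_inner \<Omega> q (gradient \<phi>) = L2_inner U q (gradient \<phi>)"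
      using L2_inner_supported[of U "gradient \<phi>" \<Omega>] out U s by simp
    also have "\<dots> = L2_inner U (\<lambda>x. a + b *\<^sub>R x) (gradient \<phi>)"
      by (rule L2_inner_cong[OF aff ae_eq_refl qL L(2) pL L(2)])
    also have "\<dots> = (LINT x|lborel. indicator U x * ((a + b *\<^sub>R x) \<bullet> gradient \<phi> x))"
      using U cont by (intro L2_inner_lborel) (auto intro!: continuous_intros)
    also have "\<dots> = (LINT x|lborel. (a + b *\<^sub>R x) \<bullet> gradient \<phi> x)"
      using out by (intro Bochner_Integration.integral_cong refl) (auto simp: indicator_def)
    also have "\<dots> = - (b * DIM('a)) * (LINT x|lborel. \<phi> x)"
      by (rule integral_affine_field[OF C])
    finally have 1: "L2_inner U (weak_div \<Omega> q) \<phi> = (b * DIM('a)) * (LINT x|lborel. \<phi> x)" by simp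
    have "L2_inner U (\<lambda>x. b * DIM('a)) \<phi> = (LINT x|lborel. indicator U x * ((b * DIM('a)) \<bullet> \<phi> x))"
      using U cont by (intro L2_inner_lborel) auto
    also have "\<dots> = (LINT x|lborel. (b * DIM('a)) * \<phi> x)"
      using out by (intro Bochner_Integration.integral_cong refl) (auto simp: indicator_def)
    finally have 2: "L2_inner U (\<lambda>x. b * DIM('a)) \<phi> = (b * DIM('a)) * (LINT x|lborel. \<phi> x)" by simp
    have "L2_inner U ?d \<phi> = 1 * L2_inner U (weak_div \<Omega> q) \<phi> + (- 1) * L2_inner U (\<lambda>x. b * DIM('a)) \<phi>"
      by (rule L2_inner_lincomb_left[OF gL cL L(1)])
    then show "L2_inner U ?d \<phi> = 0" using 1 2 by simp
  qed
  then show ?thesis unfolding ae_eq_def by eventually_elim simp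
qed

section \<open>Galerkin problems and separability in finite dimension\<close>

definition lin_closed :: "('a \<Rightarrow> 'b::real_vector) set \<Rightarrow> bool" where
  "lin_closed V \<longleftrightarrow> (\<lambda>x. 0) \<in> V \<and> (\<forall>u\<in>V. \<forall>v\<in>V. \<forall>a b. (\<lambda>x. a *\<^sub>R u x + b *\<^sub>R v x) \<in> V)"

lemma lin_closedD: "lin_closed V \<Longrightarrow> u \<in> V \<Longrightarrow> v \<in> V \<Longrightarrow> (\<lambda>x. a *\<^sub>R u x + b *\<^sub>R v x) \<in> V"
  by (simp add: lin_closed_def)

lemma lin_closed_zero: "lin_closed V \<Longrightarrow> (\<lambda>x. 0) \<in> V"
  by (simp add: lin_closed_def)

lemma lin_closed_scale: "lin_closed V \<Longrightarrow> u \<in> V \<Longrightarrow> (\<lambda>x. a *\<^sub>R u x) \<in> V"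
  using lin_closedD[of V u u a 0] by simp

lemma lin_closed_sum:
  assumes "lin_closed V" "finite F" "F \<subseteq> V" shows "(\<lambda>x. \<Sum>g\<in>F. c g *\<^sub>R g x) \<in> V"
  using assms(2,3)
proof (induction F rule: finite_induct)
  case empty then show ?case using assms(1) by (simp add: lin_closed_zero)
next
  case (insert h F)
  then have "(\<lambda>x. c h *\<^sub>R h x + 1 *\<^sub>R (\<Sum>g\<in>F. c g *\<^sub>R g x)) \<in> V"
    using assms(1) by (intro lin_closedD) auto
  then show ?case using insert by simp
qed

lemma fun_span_insert:
  assumes V: "lin_closed V"
  shows "fun_span (V \<union> {s}) = {(\<lambda>x. v x + c *\<^sub>R s x) | v c. v \<in> V}"
proof (intro equalityI subsetI)
  fix u assume "u \<in> fun_span (V \<union> {s})"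
  then obtain F c where F: "finite F" "F \<subseteq> V \<union> {s}" "u = (\<lambda>x. \<Sum>g\<in>F. c g *\<^sub>R g x)"
    by (auto simp: fun_span_def)
  have *: "(\<lambda>x. \<Sum>g\<in>F - {s}. c g *\<^sub>R g x) \<in> V"
    using F by (intro lin_closed_sum[OF V]) auto
  have "u = (\<lambda>x. (\<Sum>g\<in>F - {s}. c g *\<^sub>R g x) + (if s \<in> F then c s else 0) *\<^sub>R s x)"
    using F(1) by (intro ext) (auto simp: F(3) sum.remove[of F s] add.commute)
  with * show "u \<in> {(\<lambda>x. v x + c *\<^sub>R s x) | v c. v \<in> V}"
    by (intro CollectI exI[of _ "\<lambda>x. \<Sum>g\<in>F - {s}. c g *\<^sub>R g x"] exI[of _ "if s \<in> F then c s else 0"] conjI)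
next
  fix u assume "u \<in> {(\<lambda>x. v x + c *\<^sub>R s x) | v c. v \<in> V}"
  then obtain v c where u: "u = (\<lambda>x. v x + c *\<^sub>R s x)" and v: "v \<in> V" by blast
  show "u \<in> fun_span (V \<union> {s})"
  \<comment> \<open>A finite set cannot hold the same function twice; if \<open>v\<close> and
    \<open>s\<close> coincide, their coefficients have to be merged.\<close>
  proof (cases "v = s")
    case True
    then show ?thesis unfolding fun_span_def u
      by (intro CollectI exI[of _ "{s}"] exI[of _ "\<lambda>_. 1 + c"]) (auto simp: scaleR_left_distrib)
  next
    case False
    then show ?thesis unfolding fun_span_def u using v
      by (intro CollectI exI[of _ "{v, s}"] exI[of _ "\<lambda>g. if g = s then c else 1"]) auto
  qed
qed

lemma snapshot_space_SucI:
  assumes "lin_closed (snapshot_space s n)" "v \<in> snapshot_space s n" "u = (\<lambda>x. v x + c *\<^sub>R s (Suc n) x)"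
  shows "u \<in> snapshot_space s (Suc n)"
  unfolding snapshot_space.simps fun_span_insert[OF assms(1)] using assms(2,3) by blast

lemma snapshot_space_SucE:
  assumes "lin_closed (snapshot_space s n)" "u \<in> snapshot_space s (Suc n)"
  obtains v c where "v \<in> snapshot_space s n" "u = (\<lambda>x. v x + c *\<^sub>R s (Suc n) x)"
  using assms(2) unfolding snapshot_space.simps fun_span_insert[OF assms(1)] by blast

lemma lin_closed_snapshot_space: "lin_closed (snapshot_space s n)"
proof (induction n)
  case 0 then show ?case by (simp add: lin_closed_def)
next
  case (Suc n)
  show ?case unfolding lin_closed_def
  proof (intro conjI ballI allI)
    show "(\<lambda>x. 0) \<in> snapshot_space s (Suc n)"
      by (rule snapshot_space_SucI[OF Suc lin_closed_zero[OF Suc], of _ 0]) simp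
    fix u v a b assume u: "u \<in> snapshot_space s (Suc n)" and v: "v \<in> snapshot_space s (Suc n)"
    obtain u' c where u': "u' \<in> snapshot_space s n" "u = (\<lambda>x. u' x + c *\<^sub>R s (Suc n) x)"
      by (rule snapshot_space_SucE[OF Suc u])
    obtain v' d where v': "v' \<in> snapshot_space s n" "v = (\<lambda>x. v' x + d *\<^sub>R s (Suc n) x)"
      by (rule snapshot_space_SucE[OF Suc v])
    show "(\<lambda>x. a *\<^sub>R u x + b *\<^sub>R v x) \<in> snapshot_space s (Suc n)"
      by (rule snapshot_space_SucI[OF Suc lin_closedD[OF Suc u'(1) v'(1), of a b], of _ "a * c + b * d"])
        (simp add: u'(2) v'(2) algebra_simps)
  qed
qed

lemmas snapshot_SucI = snapshot_space_SucI[OF lin_closed_snapshot_space]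
  and snapshot_SucE = snapshot_space_SucE[OF lin_closed_snapshot_space]

text \<open>Replacing the newest snapshot by its difference with an old element does not change the
  space; the multiple of \<open>w\<close> is absorbed by the old part.\<close>

lemma snapshot_space_decomp:
  assumes w: "w \<in> snapshot_space s n" and v: "v \<in> snapshot_space s (Suc n)"
    and g: "g = (\<lambda>x. 1 *\<^sub>R s (Suc n) x + (- 1) *\<^sub>R w x)"
  obtains v' c where "v' \<in> snapshot_space s n" "v = (\<lambda>x. 1 *\<^sub>R v' x + c *\<^sub>R g x)"
proof -
  obtain v0 c where v0: "v0 \<in> snapshot_space s n" "v = (\<lambda>x. v0 x + c *\<^sub>R s (Suc n) x)"
    by (rule snapshot_SucE[OF v])
  show ?thesis
    by (rule that[OF lin_closedD[OF lin_closed_snapshot_space v0(1) w, of 1 c], of c])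
      (simp add: v0(2) g algebra_simps)
qed

lemma snapshot_space_subset:
  assumes W: "lin_closed W" and s: "\<And>k. k \<in> {1..n} \<Longrightarrow> s k \<in> W"
  shows "snapshot_space s n \<subseteq> W"
  using s
proof (induction n)
  case 0 then show ?case using lin_closed_zero[OF W] by simp
next
  case (Suc n)
  then have IH: "snapshot_space s n \<subseteq> W" "s (Suc n) \<in> W" by auto
  show ?case
  proof
    fix u assume "u \<in> snapshot_space s (Suc n)"
    then obtain v c where "v \<in> snapshot_space s n" "u = (\<lambda>x. v x + c *\<^sub>R s (Suc n) x)"
      by (rule snapshot_SucE)
    then show "u \<in> W" using lin_closedD[OF W _ IH(2), of v 1 c] IH(1) by auto
  qed
qed

definition linear_form_on :: "('a \<Rightarrow> 'b::real_vector) set \<Rightarrow> (('a \<Rightarrow> 'b) \<Rightarrow> real) \<Rightarrow> bool" where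
  "linear_form_on W l \<longleftrightarrow> (\<forall>u\<in>W. \<forall>v\<in>W. \<forall>a b. l (\<lambda>x. a *\<^sub>R u x + b *\<^sub>R v x) = a * l u + b * l v)"

lemma linear_form_onD:
  "linear_form_on W l \<Longrightarrow> u \<in> W \<Longrightarrow> v \<in> W \<Longrightarrow> l (\<lambda>x. a *\<^sub>R u x + b *\<^sub>R v x) = a * l u + b * l v"
  by (simp add: linear_form_on_def)

lemma bilinear_form_onD:
  assumes "bilinear_form_on \<Omega> V W A"
  shows "v \<in> V \<Longrightarrow> v' \<in> V \<Longrightarrow> w \<in> W \<Longrightarrow> w' \<in> W \<Longrightarrow> ae_eq \<Omega> v v' \<Longrightarrow> ae_eq \<Omega> w w' \<Longrightarrow> A v w = A v' w'"
    and "v \<in> V \<Longrightarrow> v' \<in> V \<Longrightarrow> w \<in> W \<Longrightarrow> A (\<lambda>x. a *\<^sub>R v x + b *\<^sub>R v' x) w = a * A v w + b * A v' w"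
    and "v \<in> V \<Longrightarrow> w \<in> W \<Longrightarrow> w' \<in> W \<Longrightarrow> A v (\<lambda>x. a *\<^sub>R w x + b *\<^sub>R w' x) = a * A v w + b * A v w'"
  using assms unfolding bilinear_form_on_def by blast+

lemma bilinear_form_on_subset:
  "bilinear_form_on \<Omega> V W A \<Longrightarrow> V' \<subseteq> V \<Longrightarrow> W' \<subseteq> W \<Longrightarrow> bilinear_form_on \<Omega> V' W' A"
  unfolding bilinear_form_on_def by (blast dest: subsetD)

text \<open>Functions are considered modulo \<open>ae_eq\<close>, so bases and Gram matrices are avoided: a new snapshot
  \<open>s\<close> is replaced by \<open>g = s - w\<close> with \<open>A g v = 0\<close> on the previous space. Either \<open>A g g = 0\<close>, and
  then \<open>g\<close> contributes nothing, or the coefficient of \<open>g\<close> is \<open>l g / A g g\<close> up to a correction.\<close>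

lemma galerkin_solution_exists:
  assumes A: "bilinear_form_on \<Omega> W W A" and W: "lin_closed W"
    and definite: "\<And>v. v \<in> W \<Longrightarrow> A v v = 0 \<Longrightarrow> ae_eq \<Omega> v (\<lambda>x. 0)"
    and s: "\<And>k. k \<in> {1..n} \<Longrightarrow> s k \<in> W"
    and l: "linear_form_on W l" "\<And>v. v \<in> W \<Longrightarrow> ae_eq \<Omega> v (\<lambda>x. 0) \<Longrightarrow> l v = 0"
  shows "\<exists>u. galerkin_solution (snapshot_space s n) A l u"
  using s l
proof (induction n arbitrary: l)
  case 0
  have "A (\<lambda>x. 0) (\<lambda>x. 0) = 0" using bilinear_form_onD(2)[OF A, of "\<lambda>x. 0" "\<lambda>x. 0" "\<lambda>x. 0" 0 0] lin_closed_zero[OF W] by simp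
  moreover have "l (\<lambda>x. 0) = 0" using 0 lin_closed_zero[OF W] by (auto simp: ae_eq_refl)
  ultimately show ?case by (simp add: galerkin_solution_def)
next
  case (Suc n)
  let ?V = "snapshot_space s n" and ?s = "s (Suc n)"
  note VW = snapshot_space_subset[OF W, of n s]
  have VW: "?V \<subseteq> W" using Suc.prems by (intro VW) auto
  have sW: "?s \<in> W" using Suc.prems by auto
  have "linear_form_on W (A ?s)"
    using bilinear_form_onD(3)[OF A sW] by (auto simp: linear_form_on_def)
  moreover have A0: "A x v = 0" if "x \<in> W" "v \<in> W" "ae_eq \<Omega> v (\<lambda>x. 0)" for x v
  proof -
    have "A x v = A x (\<lambda>x. 0)"
      using that by (intro bilinear_form_onD(1)[OF A] ae_eq_refl lin_closed_zero[OF W])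
    also have "\<dots> = 0"
      using bilinear_form_onD(3)[OF A that(1), of "\<lambda>x. 0" "\<lambda>x. 0" 0 0] lin_closed_zero[OF W] by simp
    finally show ?thesis .
  qed
  \<comment> \<open>The projection of the new snapshot solves the same kind of problem with the
    functional \<open>A ?s\<close>; this is why the induction generalises over
    \<open>l\<close>.\<close>
  ultimately obtain w where w: "w \<in> ?V" "\<And>v. v \<in> ?V \<Longrightarrow> A w v = A ?s v"
    using Suc.IH[of "A ?s"] Suc.prems sW by (auto simp: galerkin_solution_def)
  obtain u where u: "u \<in> ?V" "\<And>v. v \<in> ?V \<Longrightarrow> A u v = l v"
    using Suc.IH[of l] Suc.prems by (auto simp: galerkin_solution_def)
  define g where "g = (\<lambda>x. 1 *\<^sub>R ?s x + (- 1) *\<^sub>R w x)"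
  have wW: "w \<in> W" and uW: "u \<in> W" using w u VW by auto
  have gW: "g \<in> W" unfolding g_def by (rule lin_closedD[OF W sW wW])
  have gv: "A g v = 0" if "v \<in> ?V" for v
    using bilinear_form_onD(2)[OF A sW wW, of v 1 "-1"] w(2)[OF that] that VW by (auto simp: g_def)
  \<comment> \<open>\<open>A\<close> need not be symmetric: \<open>A g v = 0\<close> on the old
    space does not give \<open>A u g = 0\<close>, whence the correction. If
    \<open>A g g = 0\<close>, then \<open>g\<close> is null and both \<open>A u g\<close> and
    \<open>l g\<close> vanish, so \<open>c = 0\<close> satisfies the equation below.\<close>
  define c where "c = (if A g g = 0 then 0 else (l g - A u g) / A g g)"
  have cg: "A u g + c * A g g = l g"
  proof (cases "A g g = 0")
    case True
    then show ?thesis using definite[OF gW] A0[OF uW gW] Suc.prems(3)[OF gW] by simp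
  qed (simp add: c_def)
  let ?u = "\<lambda>x. 1 *\<^sub>R u x + c *\<^sub>R g x"
  have "?u \<in> snapshot_space s (Suc n)"
    by (rule snapshot_SucI[OF lin_closedD[OF lin_closed_snapshot_space u(1) w(1), of 1 "- c"], of _ c])
      (simp add: g_def algebra_simps)
  moreover have "A ?u v = l v" if v: "v \<in> snapshot_space s (Suc n)" for v
  proof -
    obtain v' d where v': "v' \<in> ?V" "v = (\<lambda>x. 1 *\<^sub>R v' x + d *\<^sub>R g x)" 
      by (rule snapshot_space_decomp[OF w(1) v g_def])
    have v'W: "v' \<in> W" using v' VW by auto
    have Au: "A ?u y = 1 * A u y + c * A g y" if "y \<in> W" for y
      by (rule bilinear_form_onD(2)[OF A uW gW that])
    have uW': "?u \<in> W" by (rule lin_closedD[OF W uW gW])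
    have "A ?u v = 1 * A ?u v' + d * A ?u g"
      unfolding v'(2) by (rule bilinear_form_onD(3)[OF A uW' v'W gW])
    also have "\<dots> = l v' + d * l g"
      using Au[OF v'W] Au[OF gW] cg gv[OF v'(1)] u(2)[OF v'(1)] by simp
    also have "\<dots> = l v"
      unfolding v'(2) using linear_form_onD[OF Suc.prems(2) v'W gW, of 1 d] by simp
    finally show ?thesis .
  qed
  ultimately show ?case unfolding galerkin_solution_def by blast
qed

lemma uniquely_solvable_snapshot_space:
  assumes A: "bilinear_form_on \<Omega> W W A" and W: "lin_closed W"
    and definite: "\<And>v. v \<in> W \<Longrightarrow> A v v = 0 \<Longrightarrow> ae_eq \<Omega> v (\<lambda>x. 0)"
    and s: "\<And>k. k \<in> {1..n} \<Longrightarrow> s k \<in> W"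
    and l: "linear_form_on W l" "\<And>v. v \<in> W \<Longrightarrow> ae_eq \<Omega> v (\<lambda>x. 0) \<Longrightarrow> l v = 0"
  shows "uniquely_solvable \<Omega> (snapshot_space s n) A l"
  unfolding uniquely_solvable_def
proof (intro conjI allI impI)
  show "\<exists>u. galerkin_solution (snapshot_space s n) A l u"
    by (rule galerkin_solution_exists[OF A W definite s l])
  have VW: "snapshot_space s n \<subseteq> W" by (rule snapshot_space_subset[OF W s])
  fix u u' assume "galerkin_solution (snapshot_space s n) A l u" "galerkin_solution (snapshot_space s n) A l u'"
  then have u: "u \<in> snapshot_space s n" "u' \<in> snapshot_space s n"
    "\<And>v. v \<in> snapshot_space s n \<Longrightarrow> A u v = A u' v"
    by (auto simp: galerkin_solution_def)
  let ?d = "\<lambda>x. 1 *\<^sub>R u x + (- 1) *\<^sub>R u' x"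
  have d: "?d \<in> snapshot_space s n" by (rule lin_closedD[OF lin_closed_snapshot_space u(1,2)])
  have "A ?d ?d = 1 * A u ?d + (- 1) * A u' ?d"
    using u d VW by (intro bilinear_form_onD(2)[OF A]) auto
  then have "A ?d ?d = 0" using u(3)[OF d] by simp
  then have "ae_eq \<Omega> ?d (\<lambda>x. 0)" using definite d VW by blast
  then show "ae_eq \<Omega> u u'" unfolding ae_eq_def by eventually_elim simp
qed

lemma lin_closed_L2: "lin_closed (L2 \<Omega>)"
  by (simp add: lin_closed_def zero_L2 L2_lincomb)

lemma bilinear_form_L2_inner: "bilinear_form_on \<Omega> (L2 \<Omega>) (L2 \<Omega>) (L2_inner \<Omega>)"
  unfolding bilinear_form_on_def
  by (intro conjI ballI allI impI L2_inner_cong L2_inner_lincomb_left L2_inner_lincomb_right)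

lemma L2_inner_zero_left: "L2_inner \<Omega> (\<lambda>x. 0) v = 0"
  by (simp add: L2_inner_def)

lemma L2_inner_ae_zero:
  "u \<in> L2 \<Omega> \<Longrightarrow> v \<in> L2 \<Omega> \<Longrightarrow> ae_eq \<Omega> u (\<lambda>x. 0) \<Longrightarrow> L2_inner \<Omega> u v = 0"
  using L2_inner_cong[of \<Omega> u "\<lambda>x. 0" v v] by (simp add: ae_eq_refl zero_L2 L2_inner_zero_left)

lemma L2_inner_ae_zero_right:
  "u \<in> L2 \<Omega> \<Longrightarrow> v \<in> L2 \<Omega> \<Longrightarrow> ae_eq \<Omega> v (\<lambda>x. 0) \<Longrightarrow> L2_inner \<Omega> u v = 0"
  using L2_inner_ae_zero[of v \<Omega> u] by (simp add: L2_inner_commute[of \<Omega> u v])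

text \<open>Gram-Schmidt modulo null functions. Only the reproducing formula is recorded; members of
  the family may be zero, so independence of the snapshots is not an issue.\<close>

lemma orthonormal_frame:
  fixes s :: "nat \<Rightarrow> 'a::euclidean_space \<Rightarrow> 'b::euclidean_space"
  assumes s: "\<And>k. k \<in> {1..n} \<Longrightarrow> s k \<in> L2 \<Omega>"
  shows "\<exists>(m::nat) e. (\<forall>i<m. e i \<in> snapshot_space s n) \<and>
    (\<forall>v\<in>snapshot_space s n. ae_eq \<Omega> v (\<lambda>x. \<Sum>i<m. L2_inner \<Omega> (e i) v *\<^sub>R e i x))"
  using s
proof (induction n)
  case 0 show ?case by (intro exI[of _ 0]) (simp add: ae_eq_refl)
next
  case (Suc n)
  let ?V = "snapshot_space s n" and ?s = "s (Suc n)"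
  have VL: "?V \<subseteq> L2 \<Omega>" using Suc.prems by (intro snapshot_space_subset lin_closed_L2) auto
  have sL: "?s \<in> L2 \<Omega>" using Suc.prems by auto
  have "\<exists>(m::nat) e. (\<forall>i<m. e i \<in> ?V) \<and> (\<forall>v\<in>?V. ae_eq \<Omega> v (\<lambda>x. \<Sum>i<m. L2_inner \<Omega> (e i) v *\<^sub>R e i x))"
    by (rule Suc.IH) (use Suc.prems in auto)
  then obtain m :: nat and e :: "nat \<Rightarrow> 'a \<Rightarrow> 'b" where me: "\<And>i. i < m \<Longrightarrow> e i \<in> ?V"
      "\<And>v. v \<in> ?V \<Longrightarrow> ae_eq \<Omega> v (\<lambda>x. \<Sum>i<m. L2_inner \<Omega> (e i) v *\<^sub>R e i x)"
    by blast
  obtain w where w: "w \<in> ?V" "\<And>v. v \<in> ?V \<Longrightarrow> L2_inner \<Omega> w v = L2_inner \<Omega> ?s v"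
  proof -
    have "\<exists>u. galerkin_solution ?V (L2_inner \<Omega>) (L2_inner \<Omega> ?s) u"
    proof (rule galerkin_solution_exists[OF bilinear_form_L2_inner lin_closed_L2])
      show "linear_form_on (L2 \<Omega>) (L2_inner \<Omega> ?s)"
        by (auto simp: linear_form_on_def L2_inner_lincomb_right sL)
      show "s k \<in> L2 \<Omega>" if "k \<in> {1..n}" for k using Suc.prems that by auto
    qed (simp_all add: L2_inner_self_zero L2_inner_ae_zero_right sL)
    then show ?thesis using that unfolding galerkin_solution_def by blast
  qed
  define g where "g = (\<lambda>x. 1 *\<^sub>R ?s x + (- 1) *\<^sub>R w x)"
  have wL: "w \<in> L2 \<Omega>" using w VL by auto
  have gL: "g \<in> L2 \<Omega>" unfolding g_def by (rule L2_lincomb[OF sL wL])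
  have gv: "L2_inner \<Omega> g v = 0" if "v \<in> ?V" for v
    using L2_inner_lincomb_left[OF sL wL, of v 1 "-1"] w(2)[OF that] that VL by (auto simp: g_def)
  have gS: "g \<in> snapshot_space s (Suc n)"
    by (rule snapshot_SucI[OF lin_closed_scale[OF lin_closed_snapshot_space w(1), of "- 1"], of _ 1])
      (simp add: g_def)
  have VS: "?V \<subseteq> snapshot_space s (Suc n)"
    by (auto intro: snapshot_SucI[where c=0] simp del: snapshot_space.simps)
  define G where "G = L2_inner \<Omega> g g"
  have G0: "0 \<le> G" unfolding G_def by (rule L2_inner_self_nonneg)
  define e' where "e' = e(m := (\<lambda>x. (1 / sqrt G) *\<^sub>R g x))"
  have e'm: "e' m = (\<lambda>x. (1 / sqrt G) *\<^sub>R g x)" and e'i: "i < m \<Longrightarrow> e' i = e i" for i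
    by (auto simp: e'_def)
  have "\<forall>i<Suc m. e' i \<in> snapshot_space s (Suc n)"
    using me(1) VS lin_closed_scale[OF lin_closed_snapshot_space gS] by (auto simp: less_Suc_eq e'm e'i)
  moreover have "ae_eq \<Omega> v (\<lambda>x. \<Sum>i<Suc m. L2_inner \<Omega> (e' i) v *\<^sub>R e' i x)"
    if v: "v \<in> snapshot_space s (Suc n)" for v
  proof -
    obtain v' c where v': "v' \<in> ?V" "v = (\<lambda>x. 1 *\<^sub>R v' x + c *\<^sub>R g x)" 
      by (rule snapshot_space_decomp[OF w(1) v g_def])
    have v'L: "v' \<in> L2 \<Omega>" using v' VL by auto
    have split: "L2_inner \<Omega> y v = L2_inner \<Omega> y v' + c * L2_inner \<Omega> y g" if "y \<in> L2 \<Omega>" for y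
      unfolding v'(2) using L2_inner_lincomb_right[OF v'L gL that, of 1 c] by simp
    have ei: "L2_inner \<Omega> (e i) v = L2_inner \<Omega> (e i) v'" if "i < m" for i
      using split[of "e i"] me(1)[OF that] VL gv[of "e i"] by (auto simp: L2_inner_commute[of \<Omega> "e i" g])
    have "L2_inner \<Omega> g v = c * G" using split[OF gL] gv[OF v'(1)] by (simp add: G_def)
    moreover have "L2_inner \<Omega> (\<lambda>x. (1 / sqrt G) *\<^sub>R g x + 0 *\<^sub>R g x) v = (1 / sqrt G) * L2_inner \<Omega> g v + 0 * L2_inner \<Omega> g v"
      unfolding v'(2) by (rule L2_inner_lincomb_left[OF gL gL L2_lincomb[OF v'L gL]])
    ultimately have em: "L2_inner \<Omega> (e' m) v = c * G / sqrt G" by (simp add: e'm)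
    \<comment> \<open>For \<open>G = 0\<close> the convention \<open>1 / 0 = 0\<close> turns
      \<open>e' m\<close> into the zero function; this is the right value, as \<open>g\<close> is
      then null.\<close>
    have term_m: "L2_inner \<Omega> (e' m) v *\<^sub>R e' m x = (if G = 0 then 0 else c *\<^sub>R g x)" for x
      using G0 by (simp add: em) (simp add: e'm)
    have "ae_eq \<Omega> (\<lambda>x. c *\<^sub>R g x) (\<lambda>x. if G = 0 then 0 else c *\<^sub>R g x)"
    proof (cases "G = 0")
      case True
      then have "ae_eq \<Omega> g (\<lambda>x. 0)" using L2_inner_self_zero[OF gL] by (simp add: G_def)
      then show ?thesis using True unfolding ae_eq_def by (auto elim: eventually_mono)
    qed (simp add: ae_eq_refl)
    with me(2)[OF v'(1)] show ?thesis
      unfolding ae_eq_def sum.lessThan_Suc term_m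
    proof eventually_elim
      case (elim x)
      have "(\<Sum>i<m. L2_inner \<Omega> (e' i) v *\<^sub>R e' i x) = (\<Sum>i<m. L2_inner \<Omega> (e i) v' *\<^sub>R e i x)"
        using ei e'i by (intro sum.cong) auto
      moreover have "v x = v' x + c *\<^sub>R g x" by (simp add: v'(2))
      ultimately show ?case using elim by simp
    qed
  qed
  ultimately show ?case by blast
qed

section \<open>Separable dependence on finite-dimensional spaces\<close>

lemma depends_separably_subset:
  assumes "depends_separably \<Omega> P V W b" "V' \<subseteq> V" "W' \<subseteq> W"
  shows "depends_separably \<Omega> P V' W' b"
proof -
  obtain \<Xi> \<theta> c where *: "\<forall>\<xi>\<in>{1..\<Xi>::nat}. bilinear_form_on \<Omega> V W (c \<xi>)"
      "\<forall>\<mu>\<in>P. \<forall>v\<in>V. \<forall>w\<in>W. b \<mu> v w = (\<Sum>\<xi>=1..\<Xi>. \<theta> \<xi> \<mu> * c \<xi> v w)"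
    using assms(1) unfolding depends_separably_def by blast
  then have "\<forall>\<xi>\<in>{1..\<Xi>}. bilinear_form_on \<Omega> V' W' (c \<xi>)"
    using bilinear_form_on_subset assms by blast
  moreover have "\<forall>\<mu>\<in>P. \<forall>v\<in>V'. \<forall>w\<in>W'. b \<mu> v w = (\<Sum>\<xi>=1..\<Xi>. \<theta> \<xi> \<mu> * c \<xi> v w)"
    using * assms by blast
  ultimately show ?thesis unfolding depends_separably_def by blast
qed

text \<open>The properties are inherited from the components; closedness of the spaces is what lets
  the expansion be applied to the linear combinations. In the main proof this yields bilinearity of
  \<open>a \<mu>\<close> and its independence of representatives without splitting face
  integrals.\<close>

lemma depends_separably_bilinear:
  assumes "depends_separably \<Omega> P V W b" "\<mu> \<in> P" and V: "lin_closed V" and W: "lin_closed W"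
  shows "bilinear_form_on \<Omega> V W (b \<mu>)"
proof -
  obtain \<Xi> \<theta> c where *: "\<And>\<xi>. \<xi> \<in> {1..\<Xi>::nat} \<Longrightarrow> bilinear_form_on \<Omega> V W (c \<xi>)"
      "\<And>v w. v \<in> V \<Longrightarrow> w \<in> W \<Longrightarrow> b \<mu> v w = (\<Sum>\<xi>=1..\<Xi>. \<theta> \<xi> \<mu> * c \<xi> v w)"
    using assms(1,2) unfolding depends_separably_def by blast
  show ?thesis unfolding bilinear_form_on_def
  proof (intro conjI ballI allI impI)
    fix v v' w w' assume "v \<in> V" "v' \<in> V" "w \<in> W" "w' \<in> W" "ae_eq \<Omega> v v'" "ae_eq \<Omega> w w'"
    then show "b \<mu> v w = b \<mu> v' w'"
      using bilinear_form_onD(1)[OF *(1)] by (auto simp: *(2) intro!: sum.cong)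
  next
    fix v v' w and x y :: real assume "v \<in> V" "v' \<in> V" "w \<in> W"
    then show "b \<mu> (\<lambda>z. x *\<^sub>R v z + y *\<^sub>R v' z) w = x * b \<mu> v w + y * b \<mu> v' w"
      using bilinear_form_onD(2)[OF *(1), of _ v v' w x y] lin_closedD[OF V, of v v' x y]
      by (simp add: *(2) sum_distrib_left sum.distrib[symmetric] algebra_simps)
  next
    fix v w w' and x y :: real assume "v \<in> V" "w \<in> W" "w' \<in> W"
    then show "b \<mu> v (\<lambda>z. x *\<^sub>R w z + y *\<^sub>R w' z) = x * b \<mu> v w + y * b \<mu> v w'"
      using bilinear_form_onD(3)[OF *(1), of _ v w w' x y] lin_closedD[OF W, of w w' x y]
      by (simp add: *(2) sum_distrib_left sum.distrib[symmetric] algebra_simps)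
  qed
qed

lemma bilinear_form_sum_left:
  assumes b: "bilinear_form_on \<Omega> V W b" and V: "lin_closed V" and w: "w \<in> W"
    and e: "\<And>i. i < (m::nat) \<Longrightarrow> e i \<in> V"
  shows "(\<lambda>x. \<Sum>i<m. k i *\<^sub>R e i x) \<in> V"
    and "b (\<lambda>x. \<Sum>i<m. k i *\<^sub>R e i x) w = (\<Sum>i<m. k i * b (e i) w)"
proof -
  have "(\<lambda>x. \<Sum>i<m. k i *\<^sub>R e i x) \<in> V \<and> b (\<lambda>x. \<Sum>i<m. k i *\<^sub>R e i x) w = (\<Sum>i<m. k i * b (e i) w)"
    using e
  proof (induction m)
    case 0
    show ?case using bilinear_form_onD(2)[OF b, of "\<lambda>x. 0" "\<lambda>x. 0" w 0 0] lin_closed_zero[OF V] w by simp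
  next
    case (Suc m)
    then have IH: "(\<lambda>x. \<Sum>i<m. k i *\<^sub>R e i x) \<in> V" "b (\<lambda>x. \<Sum>i<m. k i *\<^sub>R e i x) w = (\<Sum>i<m. k i * b (e i) w)" by auto
    have e: "e m \<in> V" using Suc.prems by simp
    show ?case
      using lin_closedD[OF V IH(1) e, of 1 "k m"] bilinear_form_onD(2)[OF b IH(1) e w, of 1 "k m"] IH(2) by simp
  qed
  then show "(\<lambda>x. \<Sum>i<m. k i *\<^sub>R e i x) \<in> V"
    and "b (\<lambda>x. \<Sum>i<m. k i *\<^sub>R e i x) w = (\<Sum>i<m. k i * b (e i) w)" by auto
qed

lemma bilinear_form_swap: "bilinear_form_on \<Omega> V W b \<Longrightarrow> bilinear_form_on \<Omega> W V (\<lambda>w v. b v w)"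
  unfolding bilinear_form_on_def by blast

text \<open>The matrix entries of the forms serve as parameter functionals.\<close>

lemma depends_separably_finite_dimensional:
  fixes s :: "nat \<Rightarrow> 'a::euclidean_space \<Rightarrow> 'b::euclidean_space" and t :: "nat \<Rightarrow> 'a \<Rightarrow> 'c::euclidean_space"
  assumes s: "\<And>k. k \<in> {1..n} \<Longrightarrow> s k \<in> L2 \<Omega>" and t: "\<And>k. k \<in> {1..n'} \<Longrightarrow> t k \<in> L2 \<Omega>"
    and b: "\<And>\<mu>. \<mu> \<in> P \<Longrightarrow> bilinear_form_on \<Omega> (snapshot_space s n) (snapshot_space t n') (b \<mu>)"
  shows "depends_separably \<Omega> P (snapshot_space s n) (snapshot_space t n') b"
proof -
  let ?V = "snapshot_space s n" and ?W = "snapshot_space t n'"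
  have VL: "?V \<subseteq> L2 \<Omega>" "?W \<subseteq> L2 \<Omega>" by (rule snapshot_space_subset[OF lin_closed_L2 s] snapshot_space_subset[OF lin_closed_L2 t]; assumption)+
  note V = lin_closed_snapshot_space[of s n] and W = lin_closed_snapshot_space[of t n']
  obtain m e where e: "\<And>i. i < (m::nat) \<Longrightarrow> e i \<in> ?V"
      "\<And>v. v \<in> ?V \<Longrightarrow> ae_eq \<Omega> v (\<lambda>x. \<Sum>i<m. L2_inner \<Omega> (e i) v *\<^sub>R e i x)"
    using orthonormal_frame[of n s \<Omega>, OF s] by blast
  obtain m' e' where e': "\<And>i. i < (m'::nat) \<Longrightarrow> e' i \<in> ?W"
      "\<And>v. v \<in> ?W \<Longrightarrow> ae_eq \<Omega> v (\<lambda>x. \<Sum>i<m'. L2_inner \<Omega> (e' i) v *\<^sub>R e' i x)"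
    using orthonormal_frame[of n' t \<Omega>, OF t] by blast
  let ?I = "{..<m} \<times> {..<m'}"
  \<comment> \<open>Pairs of frame indices are renumbered by the single index
    \<open>1..\<Xi>\<close> that \<open>depends_separably\<close> prescribes.\<close>
  obtain h where h: "bij_betw h {1..card ?I} ?I"
    using ex_bij_betw_nat_finite_1[of ?I] by auto
  define \<theta> where "\<theta> \<xi> \<mu> = b \<mu> (e (fst (h \<xi>))) (e' (snd (h \<xi>)))" for \<xi> \<mu>
  define c where "c \<xi> v w = L2_inner \<Omega> (e (fst (h \<xi>))) v * L2_inner \<Omega> (e' (snd (h \<xi>))) w" for \<xi> v w
  have "bilinear_form_on \<Omega> ?V ?W (c \<xi>)" if "\<xi> \<in> {1..card ?I}" for \<xi>
  proof -
    have "h \<xi> \<in> ?I" using bij_betwE[OF h] that by blast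
    then have "fst (h \<xi>) < m" "snd (h \<xi>) < m'" by auto
    then have E: "e (fst (h \<xi>)) \<in> L2 \<Omega>" "e' (snd (h \<xi>)) \<in> L2 \<Omega>" using e(1) e'(1) VL by blast+
    show ?thesis unfolding bilinear_form_on_def c_def
    proof (intro conjI ballI allI impI)
      fix v v' w w' assume "v \<in> ?V" "v' \<in> ?V" "w \<in> ?W" "w' \<in> ?W" "ae_eq \<Omega> v v'" "ae_eq \<Omega> w w'"
      then show "L2_inner \<Omega> (e (fst (h \<xi>))) v * L2_inner \<Omega> (e' (snd (h \<xi>))) w =
          L2_inner \<Omega> (e (fst (h \<xi>))) v' * L2_inner \<Omega> (e' (snd (h \<xi>))) w'"
        using VL E by (intro arg_cong2[where f="(*)"] L2_inner_cong ae_eq_refl) auto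
    next
      fix v v' w and x y :: real assume "v \<in> ?V" "v' \<in> ?V" "w \<in> ?W"
      then show "L2_inner \<Omega> (e (fst (h \<xi>))) (\<lambda>z. x *\<^sub>R v z + y *\<^sub>R v' z) * L2_inner \<Omega> (e' (snd (h \<xi>))) w =
          x * (L2_inner \<Omega> (e (fst (h \<xi>))) v * L2_inner \<Omega> (e' (snd (h \<xi>))) w) +
          y * (L2_inner \<Omega> (e (fst (h \<xi>))) v' * L2_inner \<Omega> (e' (snd (h \<xi>))) w)"
        using L2_inner_lincomb_right[OF subsetD[OF VL(1)] subsetD[OF VL(1)] E(1), of v v' x y]
        by (simp add: algebra_simps)
    next
      fix v w w' and x y :: real assume "v \<in> ?V" "w \<in> ?W" "w' \<in> ?W"
      then show "L2_inner \<Omega> (e (fst (h \<xi>))) v * L2_inner \<Omega> (e' (snd (h \<xi>))) (\<lambda>z. x *\<^sub>R w z + y *\<^sub>R w' z) =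
          x * (L2_inner \<Omega> (e (fst (h \<xi>))) v * L2_inner \<Omega> (e' (snd (h \<xi>))) w) +
          y * (L2_inner \<Omega> (e (fst (h \<xi>))) v * L2_inner \<Omega> (e' (snd (h \<xi>))) w')"
        using L2_inner_lincomb_right[OF subsetD[OF VL(2)] subsetD[OF VL(2)] E(2), of w w' x y]
        by (simp add: algebra_simps)
    qed
  qed
  moreover have "b \<mu> v w = (\<Sum>\<xi>=1..card ?I. \<theta> \<xi> \<mu> * c \<xi> v w)" if \<mu>: "\<mu> \<in> P" and v: "v \<in> ?V" and w: "w \<in> ?W" for \<mu> v w
  proof -
    let ?k = "\<lambda>i. L2_inner \<Omega> (e i) v" and ?k' = "\<lambda>j. L2_inner \<Omega> (e' j) w"
    let ?v = "\<lambda>x. \<Sum>i<m. ?k i *\<^sub>R e i x" and ?w = "\<lambda>x. \<Sum>j<m'. ?k' j *\<^sub>R e' j x"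
    note B = b[OF \<mu>] and B' = bilinear_form_swap[OF b[OF \<mu>]]
    have vV: "?v \<in> ?V" by (rule bilinear_form_sum_left(1)[OF B V w]) (rule e(1))
    have wW: "?w \<in> ?W" by (rule bilinear_form_sum_left(1)[OF B' W v]) (rule e'(1))
    have "b \<mu> v w = b \<mu> ?v ?w"
      by (rule bilinear_form_onD(1)[OF B v vV w wW e(2)[OF v] e'(2)[OF w]])
    also have "\<dots> = (\<Sum>i<m. ?k i * b \<mu> (e i) ?w)"
      by (rule bilinear_form_sum_left(2)[OF B V wW]) (rule e(1))
    also have "\<dots> = (\<Sum>i<m. \<Sum>j<m'. b \<mu> (e i) (e' j) * (?k i * ?k' j))"
    proof (rule sum.cong[OF refl])
      fix i assume "i \<in> {..<m}"
      then have "e i \<in> ?V" using e(1) by simp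
      have "b \<mu> (e i) ?w = (\<Sum>j<m'. ?k' j * b \<mu> (e i) (e' j))"
        by (rule bilinear_form_sum_left(2)[OF B' W \<open>e i \<in> ?V\<close>]) (rule e'(1))
      then show "?k i * b \<mu> (e i) ?w = (\<Sum>j<m'. b \<mu> (e i) (e' j) * (?k i * ?k' j))"
        by (simp add: sum_distrib_left mult_ac)
    qed
    also have "\<dots> = (\<Sum>p\<in>?I. b \<mu> (e (fst p)) (e' (snd p)) * (?k (fst p) * ?k' (snd p)))"
      by (simp add: sum.cartesian_product case_prod_beta)
    also have "\<dots> = (\<Sum>\<xi>=1..card ?I. \<theta> \<xi> \<mu> * c \<xi> v w)"
      unfolding \<theta>_def c_def by (rule sum.reindex_bij_betw[OF h, symmetric])
    finally show ?thesis .
  qed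
  ultimately show ?thesis unfolding depends_separably_def by blast
qed

section \<open>Continuity of normal components\<close>

lemma lborel_integral_point_reflection:
  fixes f :: "'a::euclidean_space \<Rightarrow> real"
  assumes [measurable]: "f \<in> borel_measurable borel"
  shows "(LINT x|lborel. f (t - x)) = (LINT x|lborel. f x)"
proof -
  have eq: "(lborel :: 'a measure) = distr lborel borel (\<lambda>x. t + (- 1) *\<^sub>R x)"
    using lborel_affine[of "- 1" t] by (simp add: density_1)
  have "(LINT x|lborel. f x) = (LINT x|distr lborel borel (\<lambda>x. t + (- 1) *\<^sub>R x). f x)"
    by (subst eq) (rule refl)
  also have "\<dots> = (LINT x|lborel. f (t + (- 1) *\<^sub>R x))" by (rule integral_distr) auto
  finally show ?thesis by simp
qed

text \<open>A function of the squared distance, hence differentiable at the centre as well. Its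
  gradient always points towards \<open>x0\<close>, which determines its sign on half-balls.\<close>

lemma radial_cutoff:
  fixes x0 :: "'a::euclidean_space"
  shows "C1_supported (\<lambda>x. pos_sq (r\<^sup>2 - (norm (x - x0))\<^sup>2))
    (\<lambda>x. (- 4 * max 0 (r\<^sup>2 - (norm (x - x0))\<^sup>2)) *\<^sub>R (x - x0)) (cball x0 \<bar>r\<bar>)"
  unfolding C1_supported_def
proof (intro conjI allI impI)
  fix x :: 'a
  have "GDERIV (\<lambda>x. r\<^sup>2 - (norm (x - x0))\<^sup>2) x :> (- 2) *\<^sub>R (x - x0)"
    unfolding gderiv_def power2_norm_eq_inner
    by (auto intro!: derivative_eq_intros simp: fun_eq_iff inner_commute inner_diff_left inner_diff_right algebra_simps)
  from GDERIV_DERIV_compose[OF this DERIV_pos_sq]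
  show "GDERIV (\<lambda>x. pos_sq (r\<^sup>2 - (norm (x - x0))\<^sup>2)) x :> (- 4 * max 0 (r\<^sup>2 - (norm (x - x0))\<^sup>2)) *\<^sub>R (x - x0)"
    by (rule GDERIV_subst) simp
next
  fix x assume "x \<notin> cball x0 \<bar>r\<bar>"
  then have "\<bar>r\<bar> \<le> \<bar>norm (x - x0)\<bar>" by (simp add: dist_norm norm_minus_commute)
  then have "r\<^sup>2 \<le> (norm (x - x0))\<^sup>2" by (rule abs_le_square_iff[THEN iffD1])
  then show "pos_sq (r\<^sup>2 - (norm (x - x0))\<^sup>2) = 0" by (simp add: pos_sq_def)
qed (auto intro!: continuous_intros)

text \<open>Testing with a radial bump centred at \<open>x0\<close>: by translation invariance only normal components
  contribute to the integral over a half-ball, and by point symmetry the two half-balls contribute with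
  opposite signs, while the divergence terms cancel on each of them.\<close>

lemma normal_component_continuous:
  fixes q :: "'a::euclidean_space \<Rightarrow> 'a"
  assumes \<Omega>: "open \<Omega>" and q: "q \<in> Hdiv \<Omega>" and n: "norm n = 1" and e: "e > 0" "ball x0 e \<subseteq> \<Omega>"
    and q1: "ae_eq (ball x0 e \<inter> {x. n \<bullet> (x - x0) < 0}) q (\<lambda>x. a1 + b1 *\<^sub>R x)"
    and q2: "ae_eq (ball x0 e \<inter> {x. n \<bullet> (x - x0) > 0}) q (\<lambda>x. a2 + b2 *\<^sub>R x)"
  shows "(a1 + b1 *\<^sub>R x0) \<bullet> n = (a2 + b2 *\<^sub>R x0) \<bullet> n"
proof -
  let ?d = "real DIM('a)"
  define H1 where "H1 = {x. n \<bullet> (x - x0) < 0}"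
  define H2 where "H2 = {x. n \<bullet> (x - x0) > 0}"
  \<comment> \<open>The bump is supported in the closed ball of radius \<open>r\<close>, which must
    fit into the open ball of radius \<open>e\<close>.\<close>
  define r where "r = e / 2"
  define \<phi> where "\<phi> x = pos_sq (r\<^sup>2 - (norm (x - x0))\<^sup>2)" for x
  define G where "G x = (- 4 * max 0 (r\<^sup>2 - (norm (x - x0))\<^sup>2)) *\<^sub>R (x - x0)" for x
  define D where "D = weak_div \<Omega> q"
  have r: "0 < r" "r < e" using e by (auto simp: r_def)
  have C: "C1_supported \<phi> G (cball x0 r)"
    using radial_cutoff[of r x0] r(1) by (simp add: \<phi>_def[abs_def] G_def[abs_def])
  have test: "test_function \<Omega> \<phi>"
    using e(2) r by (intro C1_supported_test_function[OF C]) auto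
  have grad: "gradient \<phi> = G" by (rule C1_supported_gradient[OF C])
  have cont: "continuous_on UNIV \<phi>" "continuous_on UNIV G" using C1_supported_continuous[OF C] by auto
  have out: "\<phi> x = 0" "G x = 0" if "x \<notin> ball x0 e" for x
    using C1_supported_outside[OF C, of x] that r by auto
  have outc: "\<phi> x = 0" "G x = 0" if "x \<notin> cball x0 r" for x
    using C1_supported_outside[OF C, of x] that by auto
  have H_open: "open H1" "open H2"
    unfolding H1_def H2_def by (intro open_Collect_less continuous_intros)+
  have H_borel [measurable]: "H1 \<in> sets borel" "H2 \<in> sets borel" using H_open by auto
  have \<Omega>s: "\<Omega> \<in> sets lebesgue" using \<Omega> by simp
  have U1: "open (ball x0 e \<inter> H1)" "bounded (ball x0 e \<inter> H1)" "ball x0 e \<inter> H1 \<subseteq> \<Omega>"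
    and U2: "open (ball x0 e \<inter> H2)" "bounded (ball x0 e \<inter> H2)" "ball x0 e \<inter> H2 \<subseteq> \<Omega>"
    using H_open e(2) by (auto intro: bounded_subset[OF bounded_ball])
  have D1: "ae_eq (ball x0 e \<inter> H1) D (\<lambda>x. b1 * ?d)"
    unfolding D_def by (rule weak_div_affine[OF \<Omega> q U1]) (use q1 in \<open>simp add: H1_def\<close>)
  have D2: "ae_eq (ball x0 e \<inter> H2) D (\<lambda>x. b2 * ?d)"
    unfolding D_def by (rule weak_div_affine[OF \<Omega> q U2]) (use q2 in \<open>simp add: H2_def\<close>)
  have null: "AE x in lebesgue. n \<bullet> x \<noteq> n \<bullet> x0"
  proof -
    have "negligible {x. n \<bullet> x = n \<bullet> x0}" using n by (intro negligible_hyperplane) auto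
    then have "{x. n \<bullet> x = n \<bullet> x0} \<in> null_sets lebesgue" by (simp add: negligible_iff_null_sets)
    then have "AE x in lebesgue. x \<notin> {x. n \<bullet> x = n \<bullet> x0}" by (rule AE_not_in)
    then show ?thesis by simp
  qed
  define f1 where "f1 x = (a1 + b1 *\<^sub>R x) \<bullet> G x + b1 * ?d * \<phi> x" for x
  define f2 where "f2 x = (a2 + b2 *\<^sub>R x) \<bullet> G x + b2 * ?d * \<phi> x" for x
  have fcont: "continuous_on UNIV f1" "continuous_on UNIV f2"
    unfolding f1_def[abs_def] f2_def[abs_def] by (intro continuous_intros cont)+
  have AE: "AE x in lebesgue. indicator \<Omega> x * (q x \<bullet> G x) + indicator \<Omega> x * (D x * \<phi> x) =
      indicator H1 x * f1 x + indicator H2 x * f2 x"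
  proof -
    have "AE x in lebesgue. x \<in> ball x0 e \<inter> H1 \<longrightarrow> q x = a1 + b1 *\<^sub>R x"
      "AE x in lebesgue. x \<in> ball x0 e \<inter> H1 \<longrightarrow> D x = b1 * ?d"
      "AE x in lebesgue. x \<in> ball x0 e \<inter> H2 \<longrightarrow> q x = a2 + b2 *\<^sub>R x"
      "AE x in lebesgue. x \<in> ball x0 e \<inter> H2 \<longrightarrow> D x = b2 * ?d"
      using q1 q2 D1 D2 U1 U2 unfolding H1_def[symmetric] H2_def[symmetric]
      by (auto simp: ae_eq_restrict_space_iff)
    with null show ?thesis
    proof eventually_elim
      case (elim x)
      show ?case
      proof (cases "x \<in> ball x0 e")
        case True
        then have "x \<in> \<Omega>" using e(2) by auto
        have "n \<bullet> (x - x0) \<noteq> 0" using elim(1) by (simp add: inner_diff_right)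
        then have "n \<bullet> (x - x0) < 0 \<or> n \<bullet> (x - x0) > 0" by linarith
        then consider "x \<in> H1" "x \<notin> H2" | "x \<in> H2" "x \<notin> H1" unfolding H1_def H2_def by fastforce
        then show ?thesis
          using elim True \<open>x \<in> \<Omega>\<close> by cases (auto simp: f1_def f2_def)
      next
        case False
        then show ?thesis using out[OF False] by (simp add: f1_def f2_def)
      qed
    qed
  qed
  have L: "\<phi> \<in> L2 \<Omega>" "G \<in> L2 \<Omega>" using test_function_L2[OF test \<Omega>s] grad by auto
  have int: "integrable lebesgue (\<lambda>x. indicator \<Omega> x * (q x \<bullet> G x))" "integrable lebesgue (\<lambda>x. indicator \<Omega> x * (D x * \<phi> x))"
    using L2_inner_integrable[OF Hdiv_L2[OF q] L(2)] L2_inner_integrable[OF weak_div_L2[OF q] L(1)] \<Omega>s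
    by (auto simp: integrable_restrict_space D_def)
  have supp: "integrable lborel h" if "continuous_on UNIV h" "\<And>x. x \<notin> cball x0 r \<Longrightarrow> h x = 0" for h :: "'a \<Rightarrow> real"
    using that by (intro integrable_continuous_supported[where K="cball x0 r"]) auto
  have suppS: "integrable lborel (\<lambda>x. indicator S x * h x)"
    if "continuous_on UNIV h" "\<And>x. x \<notin> cball x0 r \<Longrightarrow> h x = 0" "S \<in> sets borel" for h :: "'a \<Rightarrow> real" and S
    using integrable_mult_indicator[OF _ supp[OF that(1,2)], of S] that(3) by simp
  define I where "I S h = (LINT x|lborel. indicator S x * h x)" for S :: "'a set" and h :: "'a \<Rightarrow> real"
  have split: "I H1 h + I H2 h = (LINT x|lborel. h x)"
    if h: "continuous_on UNIV h" "\<And>x. x \<notin> cball x0 r \<Longrightarrow> h x = 0" for h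
  proof -
    have [measurable]: "h \<in> borel_measurable borel" using h(1) by (rule borel_measurable_continuous_onI)
    have "I H1 h + I H2 h = (LINT x|lborel. indicator H1 x * h x + indicator H2 x * h x)"
      unfolding I_def using suppS[OF h] H_borel by simp
    also have "\<dots> = (LINT x|lborel. h x)"
    proof (rule integral_cong_AE)
      have "AE x in lborel. n \<bullet> x \<noteq> n \<bullet> x0" using null by (subst (asm) AE_completion_iff) simp_all
      then show "AE x in lborel. indicator H1 x * h x + indicator H2 x * h x = h x"
        by eventually_elim (auto simp: H1_def H2_def indicator_def inner_diff_right)
    qed measurable
    finally show ?thesis .
  qed
  have reflect: "I H2 h = I H1 (\<lambda>x. h (2 *\<^sub>R x0 - x))" if h: "continuous_on UNIV h" for h
  proof -
    have [measurable]: "h \<in> borel_measurable borel" using h(1) by (rule borel_measurable_continuous_onI)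
    have "I H2 h = (LINT x|lborel. indicator H2 (2 *\<^sub>R x0 - x) * h (2 *\<^sub>R x0 - x))"
      unfolding I_def by (rule lborel_integral_point_reflection[symmetric, where f="\<lambda>x. indicator H2 x * h x"]) measurable
    also have "\<dots> = I H1 (\<lambda>x. h (2 *\<^sub>R x0 - x))"
      unfolding I_def by (intro Bochner_Integration.integral_cong refl)
        (auto simp: H1_def H2_def indicator_def inner_diff_right algebra_simps)
    finally show ?thesis .
  qed
  \<comment> \<open>The integrand belonging to the field \<open>x - x0\<close>, whose divergence is
    \<open>DIM('a)\<close>. It is even about \<open>x0\<close> and has total integral zero, so it
    integrates to zero over each half.\<close>
  define E where "E x = (x - x0) \<bullet> G x + ?d * \<phi> x" for x
  have Ec: "continuous_on UNIV E" unfolding E_def[abs_def] by (intro continuous_intros cont)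
  have Eo: "E x = 0" if "x \<notin> cball x0 r" for x using outc[OF that] by (simp add: E_def)
  have "(LINT x|lborel. E x) = 0"
  proof -
    have "(LINT x|lborel. E x) = (LINT x|lborel. (- x0 + 1 *\<^sub>R x) \<bullet> G x) + ?d * (LINT x|lborel. \<phi> x)"
    proof -
      have "integrable lborel (\<lambda>x. (- x0 + 1 *\<^sub>R x) \<bullet> G x)" "integrable lborel \<phi>"
        using outc by (auto intro!: supp continuous_intros cont)
      then show ?thesis by (simp add: E_def)
    qed
    also have "\<dots> = 0" unfolding integral_affine_field[OF C] by simp
    finally show ?thesis .
  qed
  moreover have "E (2 *\<^sub>R x0 - x) = E x" for x
    by (simp add: E_def G_def \<phi>_def scaleR_2 norm_minus_commute inner_diff_left inner_diff_right algebra_simps)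
  then have "I H2 E = I H1 E" using reflect[OF Ec] by simp
  ultimately have E0: "I H1 E = 0" "I H2 E = 0" using split[OF Ec Eo] by auto
  have Gc: "continuous_on UNIV (\<lambda>x. w \<bullet> G x)" for w by (intro continuous_intros cont)
  have Go: "w \<bullet> G x = 0" if "x \<notin> cball x0 r" for w x using outc[OF that] by simp
  \<comment> \<open>The half-ball integral of the normal derivative; the other half contributes
    \<open>- c\<close>, because the integral over the whole space vanishes.\<close>
  define c where "c = I H1 (\<lambda>x. n \<bullet> G x)"
  have c2: "I H2 (\<lambda>x. n \<bullet> G x) = - c"
    using split[OF Gc Go, of n] integral_directional_derivative[OF C, of UNIV n] by (simp add: c_def)
  \<comment> \<open>Splitting \<open>p\<close> into normal and tangential parts: both half-spaces
    are invariant along the tangential part \<open>w\<close>, so its contribution is zero.\<close>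
  have tang: "I H (\<lambda>x. p \<bullet> G x) = (p \<bullet> n) * I H (\<lambda>x. n \<bullet> G x)" if H: "H = H1 \<or> H = H2" for p H
  proof -
    define w where "w = p - (p \<bullet> n) *\<^sub>R n"
    have nw: "n \<bullet> w = 0" using n by (simp add: w_def inner_diff_right norm_eq_1 inner_commute)
    have "I H (\<lambda>x. w \<bullet> G x) = 0"
      unfolding I_def
    proof (rule integral_directional_derivative[OF C])
      show "H \<in> sets borel" using H H_borel by auto
      show "x + t *\<^sub>R w \<in> H \<longleftrightarrow> x \<in> H" for t x
        using H nw by (auto simp: H1_def H2_def inner_diff_right inner_add_right)
    qed
    moreover have "I H (\<lambda>x. w \<bullet> G x) = I H (\<lambda>x. p \<bullet> G x) - (p \<bullet> n) * I H (\<lambda>x. n \<bullet> G x)"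
    proof -
      have "I H (\<lambda>x. w \<bullet> G x) = (LINT x|lborel. indicator H x * (p \<bullet> G x) - (p \<bullet> n) * (indicator H x * (n \<bullet> G x)))"
        unfolding I_def w_def by (intro Bochner_Integration.integral_cong refl) (simp add: inner_diff_left algebra_simps)
      also have "\<dots> = I H (\<lambda>x. p \<bullet> G x) - (p \<bullet> n) * I H (\<lambda>x. n \<bullet> G x)"
        unfolding I_def using suppS[OF Gc Go] H H_borel
        by (subst Bochner_Integration.integral_diff) auto
      finally show ?thesis .
    qed
    ultimately show ?thesis by simp
  qed
  \<comment> \<open>Splitting \<open>a + b x\<close> into the constant \<open>a + b x0\<close> and
    \<open>b (x - x0)\<close>: the second part together with the divergence term is
    \<open>b * E\<close> and drops out.\<close>
  have affine: "I H (\<lambda>x. (a + b *\<^sub>R x) \<bullet> G x + b * ?d * \<phi> x) = ((a + b *\<^sub>R x0) \<bullet> n) * I H (\<lambda>x. n \<bullet> G x)"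
    if H: "H = H1 \<or> H = H2" for a b H
  proof -
    have "I H (\<lambda>x. (a + b *\<^sub>R x) \<bullet> G x + b * ?d * \<phi> x) =
        (LINT x|lborel. indicator H x * ((a + b *\<^sub>R x0) \<bullet> G x) + b * (indicator H x * E x))"
      unfolding I_def by (intro Bochner_Integration.integral_cong refl)
        (simp add: E_def inner_diff_left inner_add_left algebra_simps)
    also have "\<dots> = I H (\<lambda>x. (a + b *\<^sub>R x0) \<bullet> G x) + b * I H E"
      unfolding I_def using suppS[OF Gc Go] suppS[OF Ec Eo] H H_borel
      by (subst Bochner_Integration.integral_add) auto
    also have "I H E = 0" using E0 H by auto
    finally show ?thesis unfolding tang[OF H, of "a + b *\<^sub>R x0"] by simp
  qed
  have "0 = (LINT x|lebesgue. indicator \<Omega> x * (q x \<bullet> G x) + indicator \<Omega> x * (D x * \<phi> x))"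
  proof -
    have "L2_inner \<Omega> q G = - L2_inner \<Omega> D \<phi>"
      using weak_div_is_weak_div[OF q] test grad by (auto simp: is_weak_div_def D_def)
    then show ?thesis using int by (simp add: L2_inner_lebesgue[OF \<Omega>s])
  qed
  also have "\<dots> = (LINT x|lebesgue. indicator H1 x * f1 x + indicator H2 x * f2 x)"
  proof (rule integral_cong_AE[OF _ _ AE])
    show "(\<lambda>x. indicator \<Omega> x * (q x \<bullet> G x) + indicator \<Omega> x * (D x * \<phi> x)) \<in> borel_measurable lebesgue"
      using int by (intro borel_measurable_add borel_measurable_integrable)
    have [measurable]: "f1 \<in> borel_measurable borel" "f2 \<in> borel_measurable borel"
      using fcont by (auto intro: borel_measurable_continuous_onI)
    show "(\<lambda>x. indicator H1 x * f1 x + indicator H2 x * f2 x) \<in> borel_measurable lebesgue"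
      by (rule borel_imp_lebesgue_measurable) measurable
  qed
  also have "\<dots> = (LINT x|lborel. indicator H1 x * f1 x + indicator H2 x * f2 x)"
  proof -
    have [measurable]: "f1 \<in> borel_measurable borel" "f2 \<in> borel_measurable borel"
      using fcont by (auto intro: borel_measurable_continuous_onI)
    show ?thesis by (rule integral_completion) measurable
  qed
  also have "\<dots> = I H1 f1 + I H2 f2"
  proof -
    have "f1 x = 0" "f2 x = 0" if "x \<notin> cball x0 r" for x using outc[OF that] by (auto simp: f1_def f2_def)
    then have "integrable lborel (\<lambda>x. indicator H1 x * f1 x)" "integrable lborel (\<lambda>x. indicator H2 x * f2 x)"
      using suppS fcont H_borel by blast+
    then show ?thesis by (simp add: I_def)
  qed
  also have "\<dots> = ((a1 + b1 *\<^sub>R x0) \<bullet> n - (a2 + b2 *\<^sub>R x0) \<bullet> n) * c"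
    unfolding f1_def[abs_def] f2_def[abs_def] using affine[of H1 a1 b1] affine[of H2 a2 b2] c2
    by (simp add: c_def left_diff_distrib)
  finally have prod: "((a1 + b1 *\<^sub>R x0) \<bullet> n - (a2 + b2 *\<^sub>R x0) \<bullet> n) * c = 0" by simp
  \<comment> \<open>The integrand is nonnegative on \<open>H1\<close> and strictly positive on the
    nonempty open half-ball of radius \<open>r\<close>.\<close>
  have "c \<noteq> 0"
  proof
    assume "c = 0"
    have i: "integrable lborel (\<lambda>x. indicator H1 x * (n \<bullet> G x))" by (rule suppS[OF Gc Go H_borel(1)])
    have nG: "n \<bullet> G x = (4 * max 0 (r\<^sup>2 - (norm (x - x0))\<^sup>2)) * (- (n \<bullet> (x - x0)))" for x
      by (simp add: G_def)
    have "0 \<le> indicator H1 x * (n \<bullet> G x)" for x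
      unfolding nG by (auto simp: H1_def indicator_def intro!: mult_nonpos_nonneg)
    then have "AE x in lborel. indicator H1 x * (n \<bullet> G x) = 0"
      using integral_nonneg_eq_0_iff_AE[OF i] \<open>c = 0\<close> by (simp add: c_def I_def)
    then have "AE x in lebesgue. indicator H1 x * (n \<bullet> G x) = 0" by (rule AE_completion)
    moreover have "n \<bullet> G x \<noteq> 0" if "x \<in> ball x0 r \<inter> H1" for x
    proof -
      have "\<bar>norm (x - x0)\<bar> < \<bar>r\<bar>" using that r by (simp add: dist_norm norm_minus_commute)
      then have "(norm (x - x0))\<^sup>2 < r\<^sup>2" using power2_strict_mono[of "norm (x - x0)" r] by simp
      then show ?thesis using that unfolding nG H1_def by auto
    qed
    ultimately have "AE x in lebesgue. x \<notin> ball x0 r \<inter> H1"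
      by (auto elim!: eventually_mono simp: indicator_def)
    moreover have "ball x0 r \<inter> H1 \<in> sets lebesgue" using H_open by auto
    ultimately have "ball x0 r \<inter> H1 \<in> null_sets lebesgue" by (simp add: AE_iff_null_sets)
    then have "negligible (ball x0 r \<inter> H1)" by (simp add: negligible_iff_null_sets)
    moreover have "open (ball x0 r \<inter> H1)" using H_open by auto
    moreover have "x0 - (r / 2) *\<^sub>R n \<in> ball x0 r \<inter> H1"
      using r n power2_norm_eq_inner[of n] by (simp add: H1_def dist_norm)
    ultimately show False using open_not_negligible by blast
  qed
  then show ?thesis using prod by simp
qed

section \<open>Fluxes of affine fields through the facets of a simplex\<close>

context bary_simplex
begin

lemma hull_interior_nonempty: "interior (convex hull C) \<noteq> {}"
proof -
  have "x \<in> affine hull C" for x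
    using finite_C sum_bary[of x] sum_bary_vertex[of x]
    by (auto simp: affine_hull_finite intro!: exI[of _ "\<lambda>w. bary w x"])
  then have "affine hull (convex hull C) = UNIV" by auto
  moreover have "C \<noteq> {}" using card_C by auto
  ultimately show ?thesis
    using rel_interior_interior[of "convex hull C"] rel_interior_eq_empty[OF convex_convex_hull, of C] by auto
qed

text \<open>The centroid of the facet opposite \<open>v'\<close> has a positive coordinate at every
  other vertex. Injectivity permits sums over facets to be indexed by the opposite vertices.\<close>

lemma facet_hull_inj:
  assumes "v \<in> C" "v' \<in> C" "convex hull (C - {v}) = convex hull (C - {v'})"
  shows "v = v'"
proof (rule ccontr)
  assume "v \<noteq> v'"
  have "bary v (facet_center v') = 0"
    using facet_center_in[OF assms(2)] assms(1,3) by (auto simp: facet_eq)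
  then show False using bary_facet_center[OF assms(2,1)] \<open>v \<noteq> v'\<close> by (simp split: if_splits)
qed

lemma outward_inner_facet:
  assumes v: "v \<in> C" and x: "x \<in> convex hull (C - {v})"
  shows "x \<bullet> outward v = c v / norm (g v)"
proof -
  have "bary v x = 0" using x v by (simp add: facet_eq)
  then have "g v \<bullet> x = - c v" by (simp add: bary_def)
  then show ?thesis by (simp add: outward_def divide_inverse mult.commute inner_commute)
qed

text \<open>On a facet \<open>x \<bullet> outward v\<close> is constant, so the normal component of
  a Raviart-Thomas field is constant there and may be evaluated at the centroid.\<close>

lemma affine_flux_facet:
  assumes v: "v \<in> C" and x: "x \<in> convex hull (C - {v})"
  shows "(a + b *\<^sub>R x) \<bullet> outward v = (a + b *\<^sub>R facet_center v) \<bullet> outward v"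
  using outward_inner_facet[OF v x] outward_inner_facet[OF v facet_center_in[OF v]]
  by (simp add: inner_add_left)

text \<open>The cone formula gives the facet the weight \<open>norm (g v)\<close>, which cancels the
  normalisation of the normal. What remains is linear in \<open>g v\<close> and \<open>c v\<close>,
  and \<open>sum_g\<close> and \<open>sum_c\<close> finish.\<close>

lemma divergence_affine:
  "(\<Sum>v\<in>C. measure lebesgue (face_slab (convex hull (C - {v}))) * ((a + b *\<^sub>R facet_center v) \<bullet> outward v))
    = b * DIM('a) * measure lebesgue (convex hull C)"
proof -
  let ?k = "real DIM('a) * measure lebesgue (convex hull C)"
  have "measure lebesgue (face_slab (convex hull (C - {v}))) * ((a + b *\<^sub>R facet_center v) \<bullet> outward v)
      = ?k * (- (g v \<bullet> a) + b * c v)" if v: "v \<in> C" for v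
  proof -
    have "norm (g v) * ((a + b *\<^sub>R facet_center v) \<bullet> outward v) = norm (g v) * (a \<bullet> outward v) + b * c v"
      using outward_inner_facet[OF v facet_center_in[OF v]] g_nonzero[OF v]
      by (simp add: inner_add_left distrib_left)
    also have "norm (g v) * (a \<bullet> outward v) = - (g v \<bullet> a)"
      using g_nonzero[OF v] by (simp add: outward_def inner_commute)
    finally have "norm (g v) * ((a + b *\<^sub>R facet_center v) \<bullet> outward v) = - (g v \<bullet> a) + b * c v" .
    then have "?k * (norm (g v) * ((a + b *\<^sub>R facet_center v) \<bullet> outward v)) = ?k * (- (g v \<bullet> a) + b * c v)" by simp
    then show ?thesis by (simp add: measure_face_slab[OF v] mult_ac)
  qed
  then have "(\<Sum>v\<in>C. measure lebesgue (face_slab (convex hull (C - {v}))) * ((a + b *\<^sub>R facet_center v) \<bullet> outward v))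
      = (\<Sum>v\<in>C. ?k * (- (g v \<bullet> a) + b * c v))" by (rule sum.cong[OF refl])
  also have "\<dots> = ?k * (- ((\<Sum>v\<in>C. g v) \<bullet> a) + b * (\<Sum>v\<in>C. c v))"
    by (simp add: sum_distrib_left[symmetric] sum.distrib sum_negf inner_sum_left sum_subtractf)
  also have "\<dots> = b * DIM('a) * measure lebesgue (convex hull C)" by (simp add: sum_g sum_c)
  finally show ?thesis .
qed

text \<open>The surface measure is a pushforward of volume on the slab, and the integrand is
  constant after projection, so only the volume of the slab survives.\<close>

lemma surface_integral_affine_flux:
  assumes v: "v \<in> C"
  shows "(LINT x|surface_measure (convex hull (C - {v})). (a + b *\<^sub>R x) \<bullet> outward v) =
    measure lebesgue (face_slab (convex hull (C - {v}))) * ((a + b *\<^sub>R facet_center v) \<bullet> outward v)"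
proof -
  let ?\<Gamma> = "convex hull (C - {v})"
  let ?cp = "closest_point (affine hull ?\<Gamma>)"
  define S where "S = face_slab ?\<Gamma>"
  have cp: "?cp = proj v" using closest_point_facet[OF v] by auto
  have "closed S"
  proof -
    have "S = {x. \<bar>bary v x\<bar> \<le> norm (g v) / 2} \<inter> proj v -` ?\<Gamma>"
      by (auto simp: S_def face_slab_eq[OF v])
    also have "closed \<dots>"
      by (intro closed_Int closed_Collect_le closed_vimage compact_imp_closed compact_hulls continuous_intros)
    finally show ?thesis .
  qed
  then have S [measurable]: "S \<in> sets borel" by simp
  let ?M = "restrict_space lborel S"
  have cpm: "?cp \<in> ?M \<rightarrow>\<^sub>M borel"
  proof -
    have "proj v \<in> borel_measurable borel"
      by (rule borel_measurable_continuous_onI[OF continuous_on_proj])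
    then have "proj v \<in> borel_measurable lborel" by simp
    then show ?thesis unfolding cp by (rule measurable_restrict_space1)
  qed
  let ?f = "\<lambda>x. (a + b *\<^sub>R x) \<bullet> outward v"
  let ?k = "(a + b *\<^sub>R facet_center v) \<bullet> outward v"
  have fm [measurable]: "?f \<in> borel_measurable borel" by simp
  have "(LINT x|surface_measure ?\<Gamma>. ?f x) = (LINT x|distr ?M borel ?cp. ?f x)"
    unfolding surface_measure_def S_def by (rule integral_completion) simp
  also have "\<dots> = (LINT x|?M. ?f (?cp x))" by (rule integral_distr[OF cpm fm])
  also have "\<dots> = (LINT x|?M. ?k)"
  proof (rule Bochner_Integration.integral_cong[OF refl])
    fix x assume "x \<in> space ?M"
    then have "?cp x \<in> ?\<Gamma>" by (simp add: space_restrict_space S_def face_slab_def)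
    then show "?f (?cp x) = ?k" by (rule affine_flux_facet[OF v])
  qed
  also have "\<dots> = measure ?M (space ?M) * ?k" by simp
  also have "measure ?M (space ?M) = measure lebesgue S"
    using S by (simp add: space_restrict_space measure_restrict_space)
  finally show ?thesis by (simp add: S_def)
qed

end

text \<open>Continuity turns almost-everywhere equality into equality on the interior, and affinity
  along rays propagates it to the whole space. Affinity is stated along lines so that
  \<open>P1\<close> and \<open>RT0\<close> are both covered.\<close>

lemma affine_determined_by_ae_eq:
  fixes p q :: "'a::euclidean_space \<Rightarrow> 'b::euclidean_space"
  assumes K: "interior K \<noteq> {}" "K \<in> sets lebesgue" and ae: "ae_eq K p q"
    and c: "continuous_on UNIV p" "continuous_on UNIV q"
    and aff: "\<And>x y t. p (x + t *\<^sub>R (y - x)) = p x + t *\<^sub>R (p y - p x)"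
      "\<And>x y t. q (x + t *\<^sub>R (y - x)) = q x + t *\<^sub>R (q y - q x)"
  shows "p = q"
proof -
  have "closed {x. p x = q x}" by (intro closed_Collect_eq c)
  moreover have "AE x in lebesgue. x \<in> interior K \<longrightarrow> x \<in> {x. p x = q x}"
    using ae K(2) interior_subset[of K] by (auto simp: ae_eq_restrict_space_iff elim!: eventually_mono)
  ultimately have eq: "p x = q x" if "x \<in> interior K" for x
    using mem_closed_if_AE_lebesgue_open[of "interior K" "{x. p x = q x}" x] that by auto
  obtain x0 where x0: "x0 \<in> interior K" using K by blast
  obtain e where e: "e > 0" "ball x0 e \<subseteq> interior K" using x0 open_interior openE by blast
  show "p = q"
  proof
    fix y
    obtain t where t: "t > 0" "t * norm (y - x0) < e" using small_multiple[OF e(1)] .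
    then have "x0 + t *\<^sub>R (y - x0) \<in> ball x0 e" by (simp add: dist_norm)
    then have "p (x0 + t *\<^sub>R (y - x0)) = q (x0 + t *\<^sub>R (y - x0))" using eq e(2) by auto
    then have "t *\<^sub>R (p y - p x0) = t *\<^sub>R (q y - q x0)" unfolding aff using eq[OF x0] by simp
    then show "p y = q y" using t eq[OF x0] by simp
  qed
qed

lemma P1_affine:
  assumes "p \<in> P1"
  shows "continuous_on UNIV p" "p (x + t *\<^sub>R (y - x)) = p x + t *\<^sub>R (p y - p x)"
proof -
  obtain g c where p: "p = (\<lambda>x. g \<bullet> x + c)" using assms by (auto simp: P1_def)
  show "continuous_on UNIV p" unfolding p by (intro continuous_intros)
  show "p (x + t *\<^sub>R (y - x)) = p x + t *\<^sub>R (p y - p x)"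
    by (simp add: p inner_add_right inner_diff_right algebra_simps)
qed

lemma RT0_affine:
  assumes "p \<in> RT0"
  shows "continuous_on UNIV p" "p (x + t *\<^sub>R (y - x)) = p x + t *\<^sub>R (p y - p x)"
proof -
  obtain a b where p: "p = (\<lambda>x. a + b *\<^sub>R x)" using assms by (auto simp: RT0_def)
  show "continuous_on UNIV p" unfolding p by (intro continuous_intros)
  show "p (x + t *\<^sub>R (y - x)) = p x + t *\<^sub>R (p y - p x)"
    by (simp add: p algebra_simps)
qed

lemma elem_poly_eq:
  fixes p :: "'a::euclidean_space \<Rightarrow> 'b::euclidean_space"
  assumes K: "interior K \<noteq> {}" "K \<in> sets lebesgue" and p: "p \<in> S" "ae_eq K v p"
    and S: "\<And>p. p \<in> S \<Longrightarrow> continuous_on UNIV p"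
      "\<And>p x y t. p \<in> S \<Longrightarrow> p (x + t *\<^sub>R (y - x)) = p x + t *\<^sub>R (p y - p x)"
  shows "elem_poly S v K = p"
  unfolding elem_poly_def
proof (rule the_equality)
  show "p \<in> S \<and> ae_eq K v p" using p by blast
  fix p' assume p': "p' \<in> S \<and> ae_eq K v p'"
  then have "ae_eq K p' p" using p(2) ae_eq_sym ae_eq_trans by blast
  then show "p' = p" using p' p(1) by (intro affine_determined_by_ae_eq[OF K] S) auto
qed

lemmas elem_poly_P1 = elem_poly_eq[where S=P1, OF _ _ _ _ P1_affine]
lemmas elem_poly_RT0 = elem_poly_eq[where S=RT0, OF _ _ _ _ RT0_affine]

section \<open>Grid elements as barycentric simplices\<close>

definition mesh_simplex :: "'a::euclidean_space set \<Rightarrow> 'a set \<Rightarrow> ('a \<Rightarrow> 'a) \<Rightarrow> ('a \<Rightarrow> real) \<Rightarrow> bool" where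
  "mesh_simplex K C g c \<longleftrightarrow> K = convex hull C \<and> \<not> affine_dependent C \<and> bary_simplex C g c"

lemma mesh_simplex_exists:
  assumes "conforming_mesh \<Omega> T" "K \<in> T"
  obtains C g c where "mesh_simplex K C g c"
proof -
  have "int DIM('a) simplex K" using assms by (auto simp: conforming_mesh_def)
  then obtain C where C: "\<not> affine_dependent C" "int (card C) = int DIM('a) + 1" "K = convex hull C"
    unfolding simplex_def by blast
  then have "card C = Suc DIM('a)" by linarith
  then obtain g c where "bary_simplex C g c" using ex_bary_simplex[OF C(1)] by blast
  then show ?thesis using that C by (auto simp: mesh_simplex_def)
qed

lemma mesh_simplex_facets:
  assumes "mesh_simplex K C g c"
  shows "\<Gamma> facet_of K \<longleftrightarrow> (\<exists>v\<in>C. \<Gamma> = convex hull (C - {v}))"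
proof -
  interpret bary_simplex C g c "\<lambda>w x. g w \<bullet> x + c w" using assms by (auto simp: mesh_simplex_def)
  have "convex hull (C - {v}) \<noteq> {}" if "v \<in> C" for v using facet_center_in[OF that] by blast
  then show ?thesis
    using facet_of_convex_hull_affine_independent[of C \<Gamma>] assms unfolding mesh_simplex_def by blast
qed

text \<open>Writing an affine function of the neighbouring simplex in the barycentric coordinates of the
  first one shows that it is a multiple of the coordinate vanishing on the common facet; the factor cannot
  be positive, since otherwise the two simplices would overlap.\<close>

lemma opposite_simplices:
  assumes K: "mesh_simplex K C g c" and K': "mesh_simplex K' C' g' c'"
    and v: "v \<in> C" and v': "v' \<in> C'" and \<Gamma>: "convex hull (C - {v}) = \<Gamma>" "convex hull (C' - {v'}) = \<Gamma>"
    and int: "K \<inter> K' = \<Gamma>"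
  shows "bary_simplex.outward g' v' = - bary_simplex.outward g v"
    and "bary_simplex.facet_center C' v' = bary_simplex.facet_center C v"
proof -
  interpret k: bary_simplex C g c "\<lambda>w x. g w \<bullet> x + c w" using K by (auto simp: mesh_simplex_def)
  interpret k': bary_simplex C' g' c' "\<lambda>w x. g' w \<bullet> x + c' w" using K' by (auto simp: mesh_simplex_def)
  have ind: "\<not> affine_dependent (C - {v})" "\<not> affine_dependent (C' - {v'})"
    using K K' affine_independent_subset[OF _ Diff_subset] unfolding mesh_simplex_def by blast+
  \<comment> \<open>Extreme points recover the vertices from the common facet, so the two simplices
    share all vertices except \<open>v\<close> and \<open>v'\<close>.\<close>
  have "x \<in> C - {v} \<longleftrightarrow> x extreme_point_of \<Gamma>" "x \<in> C' - {v'} \<longleftrightarrow> x extreme_point_of \<Gamma>" for x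
    using extreme_point_of_convex_hull_affine_independent[OF ind(1), of x]
      extreme_point_of_convex_hull_affine_independent[OF ind(2), of x] \<Gamma> by (simp_all only:)
  then have CC: "C - {v} = C' - {v'}" by blast
  show center: "k'.facet_center v' = k.facet_center v"
    unfolding k.facet_center_def k'.facet_center_def CC ..
  let ?b = "\<lambda>w x. g w \<bullet> x + c w" and ?b' = "\<lambda>w x. g' w \<bullet> x + c' w"
  have multiple: "?b' v' x = ?b v x * ?b' v' v" for x
  proof -
    have "?b' v' x = g' v' \<bullet> (\<Sum>w\<in>C. ?b w x *\<^sub>R w) + c' v' * (\<Sum>w\<in>C. ?b w x)"
      by (simp only: k.sum_bary_vertex k.sum_bary)
    also have "\<dots> = (\<Sum>w\<in>C. ?b w x * ?b' v' w)"
      by (simp only: inner_sum_right sum_distrib_left sum.distrib[symmetric]) (simp add: algebra_simps)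
    also have "\<dots> = (\<Sum>w\<in>C. if w = v then ?b v x * ?b' v' v else 0)"
    proof (rule sum.cong[OF refl])
      fix w assume "w \<in> C"
      show "?b w x * ?b' v' w = (if w = v then ?b v x * ?b' v' v else 0)"
      proof (cases "w = v")
        case False
        then have "w \<in> C' - {v'}" using CC \<open>w \<in> C\<close> by blast
        then have "?b' v' w = 0" using k'.bary_vertex[OF v', of w] by auto
        then show ?thesis using False by simp
      qed simp
    qed
    also have "\<dots> = ?b v x * ?b' v' v" using v k.finite_C by simp
    finally show ?thesis .
  qed
  have sign: "?b' v' v \<le> 0"
  proof (rule ccontr)
    assume "\<not> ?b' v' v \<le> 0"
    then have pos: "?b' v' v > 0" by simp
    let ?y = "k.facet_center v"
    obtain e where e: "e > 0" "\<And>x w. dist ?y x < e \<Longrightarrow> w \<in> C - {v} \<Longrightarrow> ?b w x > 0"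
      using k.ball_facet_center[OF v] by blast
    obtain e' where e': "e' > 0" "\<And>x w. dist ?y x < e' \<Longrightarrow> w \<in> C' - {v'} \<Longrightarrow> ?b' w x > 0"
      using k'.ball_facet_center[OF v'] center by metis
    \<comment> \<open>Chosen so that the step \<open>t *\<^sub>R g v\<close> from the common
      centroid has half the smaller radius; in this direction the coordinate of \<open>v\<close>
      increases.\<close>
    define t where "t = min e e' / (2 * norm (g v))"
    have gv: "norm (g v) > 0" using k.g_nonzero[OF v] by simp
    have t: "t > 0" using e e' gv by (simp add: t_def)
    let ?x = "?y + t *\<^sub>R g v"
    have "norm (t *\<^sub>R g v) = min e e' / 2" using gv t e(1) e'(1) by (simp add: t_def)
    then have dist: "dist ?y ?x < e" "dist ?y ?x < e'" using e(1) e'(1) by (auto simp: dist_norm)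
    have "?b v ?x = t * (g v \<bullet> g v)"
      using k.bary_facet_center[OF v v] by (simp add: inner_add_right)
    then have bv: "?b v ?x > 0" using t gv by simp
    then have bv': "?b' v' ?x > 0" unfolding multiple[of ?x] using pos by simp
    have "?x \<in> K" using e(2)[OF dist(1)] bv K unfolding mesh_simplex_def k.hull_eq
      by (auto simp: less_imp_le) (metis Diff_iff less_imp_le singletonD)
    moreover have "?x \<in> K'" using e'(2)[OF dist(2)] bv' K' unfolding mesh_simplex_def k'.hull_eq
      by (auto simp: less_imp_le) (metis Diff_iff less_imp_le singletonD)
    ultimately have "?x \<in> \<Gamma>" using int by blast
    then have "?b v ?x = 0" using \<Gamma>(1) k.facet_eq[OF v] by auto
    then show False using bv by simp
  qed
  have "- k'.outward v' = k.outward v"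
  proof (subst k.outward_unique[OF v, symmetric], intro conjI ballI)
    show "norm (- k'.outward v') = 1" using k'.norm_outward[OF v'] by simp
    fix x y assume x: "x \<in> convex hull (C - {v})" and y: "y \<in> convex hull C"
    have "?b' v' x = 0" using x \<Gamma> k'.facet_eq[OF v'] by auto
    moreover have "?b' v' y \<le> 0"
      using y v sign unfolding multiple[of y] k.hull_eq by (auto intro: mult_nonneg_nonpos)
    ultimately have "g' v' \<bullet> (y - x) \<le> 0" by (simp add: inner_diff_right)
    then show "- k'.outward v' \<bullet> (y - x) \<le> 0"
      by (simp add: k'.outward_def mult_nonneg_nonpos)
  qed
  then show "k'.outward v' = - k.outward v" by (metis minus_minus)
qed

section \<open>Local conservation on the grid\<close>

lemma polygonal_domainD:
  assumes "polygonal_domain \<Omega>"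
  shows "open \<Omega>" "bounded \<Omega>" "interior (closure \<Omega>) = \<Omega>" "\<Omega> \<in> sets lebesgue"
  using assms by (auto simp: polygonal_domain_def)

lemma conforming_meshD:
  fixes T :: "'a::euclidean_space set set"
  assumes "conforming_mesh \<Omega> T"
  shows "finite T" "\<And>K. K \<in> T \<Longrightarrow> K \<subseteq> closure \<Omega>" "\<And>K K'. K \<in> T \<Longrightarrow> K' \<in> T \<Longrightarrow> (K \<inter> K') face_of K"
    "\<And>K. K \<in> T \<Longrightarrow> aff_dim K = int DIM('a)"
  using assms by (auto simp: conforming_mesh_def triangulation_def aff_dim_simplex)

lemma mesh_simplexD:
  assumes "mesh_simplex K C g c"
  shows "bary_simplex C g c" "K = convex hull C" "compact K" "convex K" "interior K \<noteq> {}"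
    "K \<in> lmeasurable" "K \<in> sets lebesgue" "negligible (K - interior K)"
proof -
  show b: "bary_simplex C g c" and K: "K = convex hull C" using assms by (auto simp: mesh_simplex_def)
  interpret bary_simplex C g c "\<lambda>w x. g w \<bullet> x + c w" by (rule b)
  show "compact K" "convex K" "interior K \<noteq> {}" unfolding K using compact_hulls(1) hull_interior_nonempty by auto
  then show "K \<in> lmeasurable" "K \<in> sets lebesgue" by (auto intro: lmeasurable_compact fmeasurableD)
  have "frontier K = K - interior K" using \<open>compact K\<close> by (simp add: frontier_def compact_imp_closed)
  then show "negligible (K - interior K)" using negligible_convex_frontier[OF \<open>convex K\<close>] by simp
qed

lemma mesh_interior_subset:
  assumes "polygonal_domain \<Omega>" "conforming_mesh \<Omega> T" "K \<in> T" shows "interior K \<subseteq> \<Omega>"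
  using interior_mono[OF conforming_meshD(2)[OF assms(2,3)]] polygonal_domainD(3)[OF assms(1)] by simp

text \<open>For distinct elements the intersection is a proper face of at least one of them, hence
  of smaller dimension.\<close>

lemma negligible_Int_elements:
  fixes T :: "'a::euclidean_space set set"
  assumes "conforming_mesh \<Omega> T" "K \<in> T" "K' \<in> T" "K \<noteq> K'"
  shows "negligible (K \<inter> K')"
proof -
  obtain C g c where K: "mesh_simplex K C g c" using mesh_simplex_exists[OF assms(1,2)] .
  obtain C' g' c' where K': "mesh_simplex K' C' g' c'" using mesh_simplex_exists[OF assms(1,3)] .
  note cv = mesh_simplexD(4)[OF K] mesh_simplexD(4)[OF K']
  have F: "(K \<inter> K') face_of K" "(K \<inter> K') face_of K'"
    using conforming_meshD(3)[OF assms(1,2,3)] conforming_meshD(3)[OF assms(1,3,2)] by (simp_all add: Int_commute)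
  have "K \<inter> K' \<noteq> K \<or> K \<inter> K' \<noteq> K'" using assms(4) by auto
  then have "aff_dim (K \<inter> K') < int DIM('a)"
    using face_of_aff_dim_lt[OF cv(1) F(1)] face_of_aff_dim_lt[OF cv(2) F(2)]
      conforming_meshD(4)[OF assms(1)] assms(2,3) by fastforce
  then have "interior (K \<inter> K') = {}" by (intro low_dim_interior) simp
  then show ?thesis using negligible_convex_interior[of "K \<inter> K'"] cv by (simp add: convex_Int)
qed

text \<open>A closed element may touch the frontier of \<open>\<Omega>\<close>, where membership in
  \<open>L2 \<Omega>\<close> says nothing. Its own frontier is negligible by convexity, so integrals
  can be moved to the interior, which lies in \<open>\<Omega>\<close>.\<close>

lemma integral_element_interior:
  fixes f :: "'a::euclidean_space \<Rightarrow> real"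
  assumes K: "mesh_simplex K C g c" and f: "f \<in> L2 (interior K)"
  shows "(LINT x|lebesgue_on K. f x) = (LINT x|lebesgue_on (interior K). f x)"
proof -
  have "K - interior K \<in> null_sets lebesgue"
    using mesh_simplexD(8)[OF K] by (simp add: negligible_iff_null_sets)
  then have "AE x in lebesgue. x \<notin> K - interior K" by (rule AE_not_in)
  then have AE: "AE x in lebesgue. indicator (interior K) x * f x = indicator K x * f x"
    using interior_subset[of K] by (auto elim!: eventually_mono simp: indicator_def)
  have m: "(\<lambda>x. indicator (interior K) x * f x) \<in> borel_measurable lebesgue"
  proof -
    have "(\<lambda>x. indicator (interior K) x *\<^sub>R f x) \<in> borel_measurable lebesgue"
      using f by (subst borel_measurable_restrict_space_iff[symmetric]) (auto simp: L2_def)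
    then show ?thesis by simp
  qed
  then have "(\<lambda>x. indicator K x * f x) \<in> borel_measurable lebesgue"
    using AE by (rule borel_measurable_AE)
  then have "(LINT x|lebesgue. indicator (interior K) x * f x) = (LINT x|lebesgue. indicator K x * f x)"
    using m AE by (intro integral_cong_AE)
  then show ?thesis using mesh_simplexD(7)[OF K] by (simp add: integral_restrict_space)
qed

lemma rt_space_elem_poly:
  assumes "conforming_mesh \<Omega> T" "q \<in> rt_space \<Omega> T" "K \<in> T"
  obtains a b where "ae_eq K q (\<lambda>x. a + b *\<^sub>R x)" "elem_poly RT0 q K = (\<lambda>x. a + b *\<^sub>R x)"
proof -
  obtain C g c where K: "mesh_simplex K C g c" using mesh_simplex_exists[OF assms(1,3)] .
  obtain p where p: "p \<in> RT0" "ae_eq K q p" using assms(2,3) by (auto simp: rt_space_def)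
  then obtain a b where ab: "p = (\<lambda>x. a + b *\<^sub>R x)" by (auto simp: RT0_def)
  have "elem_poly RT0 q K = p" by (rule elem_poly_RT0[OF mesh_simplexD(5,7)[OF K] p])
  then show ?thesis using that p(2) unfolding ab by blast
qed

text \<open>If \<open>K\<close> is the element \<open>Km \<Gamma>\<close>, both sides use the same
  normal and the same polynomial. Otherwise the normal is reversed and the polynomial is that of the
  neighbour; continuity of the normal component at the centroid reconciles the two.\<close>

lemma element_flux_eq_normal_flux:
  fixes T :: "'a::euclidean_space set set"
  assumes \<Omega>: "polygonal_domain \<Omega>" and mesh: "conforming_mesh \<Omega> T" and orient: "mesh_orientation T Km"
    and q: "q \<in> rt_space \<Omega> T" and KT: "K \<in> T" and K: "mesh_simplex K C g c" and v: "v \<in> C"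
    and \<Gamma>: "convex hull (C - {v}) = \<Gamma>" and ae: "ae_eq K q (\<lambda>x. a + b *\<^sub>R x)"
    and ab: "elem_poly RT0 q K = (\<lambda>x. a + b *\<^sub>R x)"
  shows "measure lebesgue (face_slab \<Gamma>) * ((a + b *\<^sub>R bary_simplex.facet_center C v) \<bullet> bary_simplex.outward g v)
    = (if Km \<Gamma> = K then 1 else - 1) * normal_flux Km q \<Gamma>"
proof -
  note kb = mesh_simplexD(1)[OF K]
  have facet: "\<Gamma> facet_of K" using mesh_simplex_facets[OF K] v \<Gamma> by blast
  then have \<Gamma>T: "\<Gamma> \<in> mesh_faces T" using KT by (auto simp: mesh_faces_def)
  have K_el: "K \<in> face_elems T \<Gamma>" using KT facet by (simp add: face_elems_def)
  have Km_el: "Km \<Gamma> \<in> face_elems T \<Gamma>" using orient \<Gamma>T by (simp add: mesh_orientation_def)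
  show ?thesis
  proof (cases "Km \<Gamma> = K")
    case True
    have "face_normal Km \<Gamma> = bary_simplex.outward g v"
      using bary_simplex.face_normal_outward[OF kb v, of Km] True \<Gamma> mesh_simplexD(2)[OF K] by simp
    then show ?thesis
      using bary_simplex.surface_integral_affine_flux[OF kb v, of a b] True \<Gamma> ab by (simp add: normal_flux_def)
  next
    case False
    define K' where "K' = Km \<Gamma>"
    have K'T: "K' \<in> T" and facet': "\<Gamma> facet_of K'" using Km_el by (auto simp: face_elems_def K'_def)
    have "(\<exists>K1 K2. K1 \<noteq> K2 \<and> face_elems T \<Gamma> = {K1, K2} \<and> \<Gamma> = K1 \<inter> K2) \<or> (\<exists>K. face_elems T \<Gamma> = {K} \<and> \<Gamma> \<subseteq> frontier \<Omega>)"
      using mesh \<Gamma>T unfolding conforming_mesh_def by blast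
    then have int: "K \<inter> K' = \<Gamma>" using K_el Km_el False unfolding K'_def by (elim disjE exE conjE) auto
    obtain C' g' c' where K': "mesh_simplex K' C' g' c'" using mesh_simplex_exists[OF mesh K'T] .
    note kb' = mesh_simplexD(1)[OF K']
    have "\<exists>v'\<in>C'. \<Gamma> = convex hull (C' - {v'})" using mesh_simplex_facets[OF K'] facet' by (rule iffD1)
    then obtain v' where v': "v' \<in> C'" "convex hull (C' - {v'}) = \<Gamma>" by blast
    note opp = opposite_simplices[OF K K' v v'(1) \<Gamma> v'(2) int]
    obtain a' b' where ae': "ae_eq K' q (\<lambda>x. a' + b' *\<^sub>R x)" and ab': "elem_poly RT0 q K' = (\<lambda>x. a' + b' *\<^sub>R x)"
      using rt_space_elem_poly[OF mesh q K'T] .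
    interpret k: bary_simplex C g c "\<lambda>w x. g w \<bullet> x + c w" by (rule kb)
    interpret k': bary_simplex C' g' c' "\<lambda>w x. g' w \<bullet> x + c' w" by (rule kb')
    have fn: "face_normal Km \<Gamma> = k'.outward v'"
      using k'.face_normal_outward[OF v'(1), of Km] v'(2) mesh_simplexD(2)[OF K'] by (simp add: K'_def)
    have nf: "normal_flux Km q \<Gamma> = measure lebesgue (face_slab \<Gamma>) * ((a' + b' *\<^sub>R k.facet_center v) \<bullet> (- k.outward v))"
      unfolding normal_flux_def fn K'_def[symmetric] ab'
      using k'.surface_integral_affine_flux[OF v'(1), of a' b'] v'(2) opp by simp
    let ?y = "k.facet_center v" and ?n = "k.outward v"
    obtain e where e: "e > 0" "\<And>x w. dist ?y x < e \<Longrightarrow> w \<in> C - {v} \<Longrightarrow> g w \<bullet> x + c w > 0"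
      using k.ball_facet_center[OF v] by blast
    obtain e' where e': "e' > 0" "\<And>x w. dist ?y x < e' \<Longrightarrow> w \<in> C' - {v'} \<Longrightarrow> g' w \<bullet> x + c' w > 0"
      using k'.ball_facet_center[OF v'(1)] opp(2) by metis
    define d where "d = min e e'"
    have d: "d > 0" using e e' by (simp add: d_def)
    have gpos: "norm (g v) > 0" "norm (g' v') > 0" using k.g_nonzero[OF v] k'.g_nonzero[OF v'(1)] by auto
    \<comment> \<open>Near the centroid the two coordinates vanishing on the facet are multiples of
      opposite sign of the signed distance to one hyperplane, so the two half-balls lie in
      \<open>K\<close> and \<open>K'\<close>.\<close>
    have nv: "g v \<bullet> x + c v = - norm (g v) * (?n \<bullet> (x - ?y))" for x
      using k.bary_diff[of v x ?y] k.bary_facet_center[OF v v] gpos by (simp add: k.outward_def)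
    have nv': "g' v' \<bullet> x + c' v' = norm (g' v') * (?n \<bullet> (x - ?y))" for x
    proof -
      have "g' v' \<bullet> x + c' v' = - norm (g' v') * (k'.outward v' \<bullet> (x - k'.facet_center v'))"
        using k'.bary_diff[of v' x "k'.facet_center v'"] k'.bary_facet_center[OF v'(1) v'(1)] gpos
        by (simp add: k'.outward_def)
      then show ?thesis by (simp add: opp)
    qed
    have inK: "x \<in> K" if "x \<in> ball ?y d" "?n \<bullet> (x - ?y) \<le> 0" for x
    proof -
      have "0 \<le> g w \<bullet> x + c w" if "w \<in> C" for w
      proof (cases "w = v")
        case True
        then show ?thesis unfolding True nv using \<open>?n \<bullet> (x - ?y) \<le> 0\<close> by (simp add: mult_nonneg_nonpos)
      next
        case False
        then show ?thesis using e(2)[of x w] \<open>x \<in> ball ?y d\<close> that by (simp add: d_def less_imp_le)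
      qed
      then show ?thesis using mesh_simplexD(2)[OF K] k.hull_eq by blast
    qed
    have inK': "x \<in> K'" if "x \<in> ball ?y d" "?n \<bullet> (x - ?y) \<ge> 0" for x
    proof -
      have "0 \<le> g' w \<bullet> x + c' w" if "w \<in> C'" for w
      proof (cases "w = v'")
        case True
        then show ?thesis unfolding True nv' using \<open>?n \<bullet> (x - ?y) \<ge> 0\<close> by simp
      next
        case False
        then show ?thesis using e'(2)[of x w] \<open>x \<in> ball ?y d\<close> that by (simp add: d_def less_imp_le)
      qed
      then show ?thesis using mesh_simplexD(2)[OF K'] k'.hull_eq by blast
    qed
    \<comment> \<open>The ball is so far known to lie only in the closure of
      \<open>\<Omega>\<close>; the absence of slits,
      \<open>interior (closure \<Omega>) = \<Omega>\<close>, places it in \<open>\<Omega>\<close>,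
      as the continuity argument requires.\<close>
    have "ball ?y d \<subseteq> K \<union> K'" using inK inK' linear by blast
    also have "\<dots> \<subseteq> closure \<Omega>" using conforming_meshD(2)[OF mesh] KT K'T by blast
    finally have ball: "ball ?y d \<subseteq> \<Omega>"
      using interior_maximal[of "ball ?y d" "closure \<Omega>"] polygonal_domainD(3)[OF \<Omega>] by simp
    have s: "ball ?y d \<inter> {x. ?n \<bullet> (x - ?y) < 0} \<in> sets lebesgue" "ball ?y d \<inter> {x. ?n \<bullet> (x - ?y) > 0} \<in> sets lebesgue"
    proof -
      have "open {x. ?n \<bullet> (x - ?y) < 0}" "open {x. ?n \<bullet> (x - ?y) > 0}"
        by (intro open_Collect_less continuous_intros)+
      then have "open (ball ?y d \<inter> {x. ?n \<bullet> (x - ?y) < 0})" "open (ball ?y d \<inter> {x. ?n \<bullet> (x - ?y) > 0})"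
        by auto
      then show "ball ?y d \<inter> {x. ?n \<bullet> (x - ?y) < 0} \<in> sets lebesgue" "ball ?y d \<inter> {x. ?n \<bullet> (x - ?y) > 0} \<in> sets lebesgue"
        by simp_all
    qed
    have "(a + b *\<^sub>R ?y) \<bullet> ?n = (a' + b' *\<^sub>R ?y) \<bullet> ?n"
    proof (rule normal_component_continuous[OF polygonal_domainD(1)[OF \<Omega>] _ k.norm_outward[OF v] d ball])
      show "q \<in> Hdiv \<Omega>" using q by (simp add: rt_space_def)
      show "ae_eq (ball ?y d \<inter> {x. ?n \<bullet> (x - ?y) < 0}) q (\<lambda>x. a + b *\<^sub>R x)"
        by (rule ae_eq_subset[OF ae _ mesh_simplexD(7)[OF K] s(1)]) (use inK in auto)
      show "ae_eq (ball ?y d \<inter> {x. ?n \<bullet> (x - ?y) > 0}) q (\<lambda>x. a' + b' *\<^sub>R x)"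
        by (rule ae_eq_subset[OF ae' _ mesh_simplexD(7)[OF K'] s(2)]) (use inK' in auto)
    qed
    then show ?thesis using False nf by simp
  qed
qed

section \<open>Conservation from testing with element indicators\<close>

lemma Kplus_eq:
  assumes "face_elems T \<Gamma> = {K1, K2}" "Km \<Gamma> = K1" "K1 \<noteq> K2" shows "Kplus T Km \<Gamma> = K2"
  unfolding Kplus_def using assms by (intro the_equality) auto

lemma mesh_face_cases:
  assumes mesh: "conforming_mesh \<Omega> T" and orient: "mesh_orientation T Km" and \<Gamma>: "\<Gamma> \<in> mesh_faces T"
  obtains (inner) "inner_face T \<Gamma>" "Km \<Gamma> \<noteq> Kplus T Km \<Gamma>" "face_elems T \<Gamma> = {Km \<Gamma>, Kplus T Km \<Gamma>}"
    | (boundary) "\<not> inner_face T \<Gamma>" "face_elems T \<Gamma> = {Km \<Gamma>}"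
proof -
  have Km: "Km \<Gamma> \<in> face_elems T \<Gamma>" using orient \<Gamma> by (simp add: mesh_orientation_def)
  have "(\<exists>K1 K2. K1 \<noteq> K2 \<and> face_elems T \<Gamma> = {K1, K2} \<and> \<Gamma> = K1 \<inter> K2) \<or>
      (\<exists>K. face_elems T \<Gamma> = {K} \<and> \<Gamma> \<subseteq> frontier \<Omega>)"
    using mesh \<Gamma> unfolding conforming_mesh_def by blast
  then show ?thesis
  proof (elim disjE exE conjE)
    fix K1 K2 assume *: "K1 \<noteq> K2" "face_elems T \<Gamma> = {K1, K2}"
    then have "inner_face T \<Gamma>" by (simp add: inner_face_def)
    consider "Km \<Gamma> = K1" | "Km \<Gamma> = K2" using Km * by auto
    then show ?thesis
    proof cases
      case 1
      then show ?thesis using inner \<open>inner_face T \<Gamma>\<close> * Kplus_eq[of T \<Gamma> K1 K2 Km] by auto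
    next
      case 2
      have "face_elems T \<Gamma> = {K2, K1}" using *(2) by auto
      then show ?thesis using inner \<open>inner_face T \<Gamma>\<close> * 2 Kplus_eq[of T \<Gamma> K2 K1 Km] by auto
    qed
  next
    fix K assume *: "face_elems T \<Gamma> = {K}"
    then show ?thesis using boundary Km by (simp add: inner_face_def)
  qed
qed

lemma const_P1: "(\<lambda>x. k) \<in> P1"
  unfolding P1_def by (auto intro!: exI[of _ 0] exI[of _ k])

lemma gradient_const: "gradient (\<lambda>x. k) x = 0"
  by (rule gradient_eq[OF GDERIV_const])

text \<open>Stated for an arbitrary coefficient \<open>s\<close>, so that it covers both the
  snapshot fluxes and the offset flux, whose coefficient is the constant one.\<close>

lemma flux_reconstruction_locally_conservative:
  fixes T :: "'a::euclidean_space set set"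
  assumes \<Omega>: "polygonal_domain \<Omega>" and mesh: "conforming_mesh \<Omega> T" and orient: "mesh_orientation T Km"
    and f: "f \<in> L2 \<Omega>"
    and u: "galerkin_solution (dg_space \<Omega> T) (dg_form T Km \<nu> s) (L2_inner \<Omega> f) u"
    and R: "flux_reconstruction \<Omega> T Km \<nu> s R"
  shows "R u \<in> Hdiv_mesh \<Omega> T f"
proof -
  note \<Omega>D = polygonal_domainD[OF \<Omega>]
  have uV: "u \<in> dg_space \<Omega> T" using u by (simp add: galerkin_solution_def)
  define q where "q = R u"
  have q: "q \<in> rt_space \<Omega> T" using R uV by (simp add: flux_reconstruction_def q_def)
  then have qH: "q \<in> Hdiv \<Omega>" by (simp add: rt_space_def)
  have "(LINT x|lebesgue_on K. weak_div \<Omega> q x) = (LINT x|lebesgue_on K. f x)" if KT: "K \<in> T" for K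
  proof -
    obtain C g c where K: "mesh_simplex K C g c" using mesh_simplex_exists[OF mesh KT] .
    interpret bary_simplex C g c "\<lambda>w x. g w \<bullet> x + c w" by (rule mesh_simplexD(1)[OF K])
    have Kh: "K = convex hull C" by (rule mesh_simplexD(2)[OF K])
    have Ks: "K \<in> sets lebesgue" by (rule mesh_simplexD(7)[OF K])
    have KO: "interior K \<subseteq> \<Omega>" by (rule mesh_interior_subset[OF \<Omega> mesh KT])
    define iK where "iK = (indicator K :: 'a \<Rightarrow> real)"
    \<comment> \<open>The jump of the indicator across \<open>\<Gamma>\<close>. Its sign is the one
      that converts the flux along the face normal into the flux out of \<open>K\<close>, as in
      \<open>element_flux_eq_normal_flux\<close>.\<close>
    define j where "j \<Gamma> = (if \<Gamma> facet_of K then (if Km \<Gamma> = K then 1 else - 1) else (0::real))" for \<Gamma>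
    \<comment> \<open>Grid elements are closed, so the indicator of \<open>K\<close> is zero on a
      neighbour only up to the shared face.\<close>
    have iK_ae: "ae_eq K' iK (\<lambda>x. if K' = K then 1 else 0)" if K'T: "K' \<in> T" for K'
    proof -
      obtain C' g' c' where K': "mesh_simplex K' C' g' c'" using mesh_simplex_exists[OF mesh K'T] .
      show ?thesis
      proof (cases "K' = K")
        case True
        then show ?thesis unfolding ae_eq_def iK_def by (intro AE_I2) (auto simp: space_restrict_space)
      next
        case False
        then have "K \<inter> K' \<in> null_sets lebesgue"
          using negligible_Int_elements[OF mesh KT K'T] by (simp add: negligible_iff_null_sets)
        then have "AE x in lebesgue. x \<notin> K \<inter> K'" by (rule AE_not_in)
        then show ?thesis using False
          by (auto simp: ae_eq_restrict_space_iff[OF mesh_simplexD(7)[OF K']] iK_def elim!: eventually_mono)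
      qed
    qed
    have ep: "elem_poly P1 iK K' = (\<lambda>x. if K' = K then 1 else 0)" if K'T: "K' \<in> T" for K'
    proof -
      obtain C' g' c' where K': "mesh_simplex K' C' g' c'" using mesh_simplex_exists[OF mesh K'T] .
      show ?thesis by (rule elem_poly_P1[OF mesh_simplexD(5,7)[OF K'] const_P1 iK_ae[OF K'T]])
    qed
    have iKL: "iK \<in> L2 \<Omega>"
    proof (rule bounded_L2)
      show "\<Omega> \<in> lmeasurable" using \<Omega>D by (intro bounded_set_imp_lmeasurable)
      have "iK \<in> borel_measurable lebesgue" unfolding iK_def using Ks by (rule borel_measurable_indicator)
      then show "iK \<in> borel_measurable (lebesgue_on \<Omega>)" by (rule measurable_restrict_space1)
      show "norm (iK x) \<le> 1" for x by (simp add: iK_def indicator_def)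
    qed
    have iKV: "iK \<in> dg_space \<Omega> T"
      using iKL iK_ae const_P1 unfolding dg_space_def by blast
    have Km_T: "Km \<Gamma> \<in> T" if "\<Gamma> \<in> mesh_faces T" for \<Gamma>
      using orient that by (auto simp: mesh_orientation_def face_elems_def)
    have avg: "face_avg T Km (normal_diffusion Km s iK \<Gamma>) \<Gamma> x = 0" if \<Gamma>: "\<Gamma> \<in> mesh_faces T" for \<Gamma> x
    proof -
      have nd: "normal_diffusion Km s iK \<Gamma> K' x = 0" if "K' \<in> T" for K'
        unfolding normal_diffusion_def ep[OF that] gradient_const by simp
      from mesh orient \<Gamma> show ?thesis
      proof (cases rule: mesh_face_cases)
        case inner
        then have "Kplus T Km \<Gamma> \<in> T" by (auto simp: face_elems_def)
        then show ?thesis using nd Km_T[OF \<Gamma>] by (simp add: face_avg_def)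
      next
        case boundary
        then show ?thesis using nd Km_T[OF \<Gamma>] by (simp add: face_avg_def)
      qed
    qed
    have jump: "face_jump T Km (elem_poly P1 iK) \<Gamma> x = j \<Gamma>" if \<Gamma>: "\<Gamma> \<in> mesh_faces T" for \<Gamma> x
    proof -
      have facet: "\<Gamma> facet_of K \<longleftrightarrow> K \<in> face_elems T \<Gamma>" using KT by (simp add: face_elems_def)
      from mesh orient \<Gamma> show ?thesis
      proof (cases rule: mesh_face_cases)
        case inner
        then have "Kplus T Km \<Gamma> \<in> T" by (auto simp: face_elems_def)
        then show ?thesis using inner unfolding face_jump_def j_def facet
          by (auto simp: ep Km_T[OF \<Gamma>])
      next
        case boundary
        then show ?thesis unfolding face_jump_def j_def facet by (auto simp: ep Km_T[OF \<Gamma>])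
      qed
    qed
    have flux: "normal_flux Km q \<Gamma> = (LINT x|surface_measure \<Gamma>.
             - face_avg T Km (normal_diffusion Km s u \<Gamma>) \<Gamma> x
             + \<nu> / diameter \<Gamma> * face_jump T Km (elem_poly P1 u) \<Gamma> x)" if "\<Gamma> \<in> mesh_faces T" for \<Gamma>
      using R uV that by (simp add: flux_reconstruction_def q_def)
    have "dg_form T Km \<nu> s u iK = (\<Sum>\<Gamma>\<in>mesh_faces T. j \<Gamma> * normal_flux Km q \<Gamma>)"
    proof -
      have "(\<Sum>K\<in>T. LINT x|lebesgue_on K.
          (s x *\<^sub>R gradient (elem_poly P1 u K) x) \<bullet> gradient (elem_poly P1 iK K) x) = 0"
        by (intro sum.neutral ballI) (simp add: ep gradient_const)
      moreover have "(LINT x|surface_measure \<Gamma>.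
        - face_avg T Km (normal_diffusion Km s iK \<Gamma>) \<Gamma> x * face_jump T Km (elem_poly P1 u) \<Gamma> x
        - face_avg T Km (normal_diffusion Km s u \<Gamma>) \<Gamma> x * face_jump T Km (elem_poly P1 iK) \<Gamma> x
        + \<nu> / diameter \<Gamma> * face_jump T Km (elem_poly P1 u) \<Gamma> x * face_jump T Km (elem_poly P1 iK) \<Gamma> x)
        = j \<Gamma> * normal_flux Km q \<Gamma>" if \<Gamma>: "\<Gamma> \<in> mesh_faces T" for \<Gamma>
      proof -
        \<comment> \<open>The indicator has zero gradient on every element, so the first face term
          vanishes, and its constant jump factors out of the other two. The remaining integrand is
          the one prescribed for the reconstruction.\<close>
        have "(LINT x|surface_measure \<Gamma>.
            - face_avg T Km (normal_diffusion Km s iK \<Gamma>) \<Gamma> x * face_jump T Km (elem_poly P1 u) \<Gamma> x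
            - face_avg T Km (normal_diffusion Km s u \<Gamma>) \<Gamma> x * face_jump T Km (elem_poly P1 iK) \<Gamma> x
            + \<nu> / diameter \<Gamma> * face_jump T Km (elem_poly P1 u) \<Gamma> x * face_jump T Km (elem_poly P1 iK) \<Gamma> x)
          = (LINT x|surface_measure \<Gamma>. j \<Gamma> * (- face_avg T Km (normal_diffusion Km s u \<Gamma>) \<Gamma> x
             + \<nu> / diameter \<Gamma> * face_jump T Km (elem_poly P1 u) \<Gamma> x))"
          unfolding avg[OF \<Gamma>] jump[OF \<Gamma>]
          by (intro Bochner_Integration.integral_cong refl) (simp add: algebra_simps)
        also have "\<dots> = j \<Gamma> * normal_flux Km q \<Gamma>"
          unfolding flux[OF \<Gamma>] by (rule integral_mult_right_zero)
        finally show ?thesis .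
      qed
      ultimately show ?thesis unfolding dg_form_def by simp
    qed
    then have test: "(\<Sum>\<Gamma>\<in>mesh_faces T. j \<Gamma> * normal_flux Km q \<Gamma>) = L2_inner \<Omega> f iK"
      using u iKV by (simp add: galerkin_solution_def)
    obtain a b where ae: "ae_eq K q (\<lambda>x. a + b *\<^sub>R x)" and ab: "elem_poly RT0 q K = (\<lambda>x. a + b *\<^sub>R x)"
      using rt_space_elem_poly[OF mesh q KT] .
    have fin: "finite (mesh_faces T)"
    proof -
      have "finite {\<Gamma>. \<Gamma> facet_of K'}" if K'T: "K' \<in> T" for K'
      proof -
        obtain C' g' c' where K': "mesh_simplex K' C' g' c'" using mesh_simplex_exists[OF mesh K'T] .
        have "finite C'" using mesh_simplexD(1)[OF K'] by (rule bary_simplex.finite_C)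
        moreover have "{\<Gamma>. \<Gamma> facet_of K'} = (\<lambda>v. convex hull (C' - {v})) ` C'"
          using mesh_simplex_facets[OF K'] by auto
        ultimately show ?thesis by simp
      qed
      then have "finite (\<Union>K'\<in>T. {\<Gamma>. \<Gamma> facet_of K'})" using conforming_meshD(1)[OF mesh] by simp
      moreover have "mesh_faces T = (\<Union>K'\<in>T. {\<Gamma>. \<Gamma> facet_of K'})" by (auto simp: mesh_faces_def)
      ultimately show ?thesis by simp
    qed
    let ?F = "\<lambda>v. convex hull (C - {v})"
    \<comment> \<open>Only the facets of \<open>K\<close> carry a nonzero jump; afterwards they are
      indexed by the opposite vertices in order to apply \<open>divergence_affine\<close>.\<close>
    have "(\<Sum>\<Gamma>\<in>mesh_faces T. j \<Gamma> * normal_flux Km q \<Gamma>) = (\<Sum>\<Gamma>\<in>?F ` C. j \<Gamma> * normal_flux Km q \<Gamma>)"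
    proof (rule sum.mono_neutral_right[OF fin])
      show "?F ` C \<subseteq> mesh_faces T" using mesh_simplex_facets[OF K] KT by (auto simp: mesh_faces_def)
      show "\<forall>\<Gamma>\<in>mesh_faces T - ?F ` C. j \<Gamma> * normal_flux Km q \<Gamma> = 0"
        using mesh_simplex_facets[OF K] by (auto simp: j_def)
    qed
    also have "\<dots> = (\<Sum>v\<in>C. j (?F v) * normal_flux Km q (?F v))"
      using facet_hull_inj by (intro sum.reindex_cong[OF _ refl refl] inj_onI)
    also have "\<dots> = (\<Sum>v\<in>C. measure lebesgue (face_slab (?F v)) * ((a + b *\<^sub>R facet_center v) \<bullet> outward v))"
    proof (rule sum.cong[OF refl])
      fix v assume v: "v \<in> C"
      have "?F v facet_of K" using mesh_simplex_facets[OF K] v by blast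
      then show "j (?F v) * normal_flux Km q (?F v) =
          measure lebesgue (face_slab (?F v)) * ((a + b *\<^sub>R facet_center v) \<bullet> outward v)"
        using element_flux_eq_normal_flux[OF \<Omega> mesh orient q KT K v refl ae ab] by (simp add: j_def)
    qed
    also have "\<dots> = b * DIM('a) * measure lebesgue K" unfolding Kh by (rule divergence_affine)
    finally have 1: "L2_inner \<Omega> f iK = b * DIM('a) * measure lebesgue K" using test by simp
    have iKs: "interior K \<in> sets lebesgue" by simp
    have gL: "weak_div \<Omega> q \<in> L2 (interior K)" by (rule L2_subset[OF weak_div_L2[OF qH] KO \<Omega>D(4) iKs])
    have fL: "f \<in> L2 (interior K)" by (rule L2_subset[OF f KO \<Omega>D(4) iKs])
    have "(LINT x|lebesgue_on K. weak_div \<Omega> q x) = (LINT x|lebesgue_on (interior K). weak_div \<Omega> q x)"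
      by (rule integral_element_interior[OF K gL])
    also have "\<dots> = (LINT x|lebesgue_on (interior K). b * DIM('a))"
    proof (rule integral_cong_AE)
      have "bounded (interior K)"
        using compact_imp_bounded[OF mesh_simplexD(3)[OF K]] interior_subset bounded_subset by blast
      then have "ae_eq (interior K) (weak_div \<Omega> q) (\<lambda>x. b * DIM('a))"
        by (rule weak_div_affine[OF \<Omega>D(1) qH open_interior _ KO ae_eq_subset[OF ae interior_subset Ks iKs]])
      then show "AE x in lebesgue_on (interior K). weak_div \<Omega> q x = b * DIM('a)" by (simp add: ae_eq_def)
      show "weak_div \<Omega> q \<in> borel_measurable (lebesgue_on (interior K))" using gL by (simp add: L2_def)
    qed simp
    also have "\<dots> = (LINT x|lebesgue_on K. b * DIM('a))"
    proof -
      have "interior K \<in> lmeasurable" using mesh_simplexD(3)[OF K]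
        by (intro bounded_set_imp_lmeasurable) (auto intro: bounded_subset[OF compact_imp_bounded interior_subset])
      then have "(\<lambda>x. b * DIM('a)) \<in> L2 (interior K)" by (rule bounded_L2[OF _ _ order_refl]) simp
      then show ?thesis using integral_element_interior[OF K] by metis
    qed
    also have "\<dots> = b * DIM('a) * measure lebesgue K"
      using Ks by (simp add: measure_restrict_space)
    also have "\<dots> = L2_inner \<Omega> f iK" using 1 by simp
    \<comment> \<open>\<open>K\<close> may contain points outside \<open>\<Omega>\<close>, but those
      lie in the null set \<open>K - interior K\<close>.\<close>
    also have "\<dots> = L2_inner (interior K) f (\<lambda>x. 1)"
    proof -
      have "K - interior K \<in> null_sets lebesgue"
        using mesh_simplexD(8)[OF K] by (simp add: negligible_iff_null_sets)
      then have "AE x in lebesgue. x \<notin> K - interior K" by (rule AE_not_in)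
      then have AE: "AE x in lebesgue. indicator \<Omega> x * (f x \<bullet> iK x) = indicator (interior K) x * (f x \<bullet> 1)"
        using KO by (auto elim!: eventually_mono simp: indicator_def iK_def dest: interior_subset[THEN subsetD])
      have "integrable lebesgue (\<lambda>x. indicator \<Omega> x * (f x \<bullet> iK x))"
        using L2_inner_integrable[OF f iKL] \<Omega>D(4) by (simp add: integrable_restrict_space)
      then have m: "(\<lambda>x. indicator \<Omega> x * (f x \<bullet> iK x)) \<in> borel_measurable lebesgue"
        by (rule borel_measurable_integrable)
      show ?thesis unfolding L2_inner_lebesgue[OF \<Omega>D(4)] L2_inner_lebesgue[OF iKs]
        by (rule integral_cong_AE[OF m borel_measurable_AE[OF m AE] AE])
    qed
    also have "\<dots> = (LINT x|lebesgue_on (interior K). f x)" by (simp add: L2_inner_def)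
    also have "\<dots> = (LINT x|lebesgue_on K. f x)" by (rule integral_element_interior[OF K fL, symmetric])
    finally show ?thesis .
  qed
  then show ?thesis using qH unfolding Hdiv_mesh_def q_def by blast
qed

section \<open>Linear structure behind the reduced spaces\<close>

lemma lin_closed_dg_space: "lin_closed (dg_space \<Omega> T)"
  unfolding lin_closed_def
proof (intro conjI ballI allI)
  show "(\<lambda>x. 0) \<in> dg_space \<Omega> T"
    unfolding dg_space_def using zero_L2 const_P1[of 0] ae_eq_refl by blast
  fix u v a b assume u: "u \<in> dg_space \<Omega> T" and v: "v \<in> dg_space \<Omega> T"
  have "\<exists>p\<in>P1. ae_eq K (\<lambda>x. a *\<^sub>R u x + b *\<^sub>R v x) p" if K: "K \<in> T" for K
  proof -
    obtain p p' where p: "p \<in> P1" "ae_eq K u p" "p' \<in> P1" "ae_eq K v p'"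
      using u v K unfolding dg_space_def by blast
    obtain g c g' c' where *: "\<forall>x. p x = g \<bullet> x + c" "\<forall>x. p' x = g' \<bullet> x + c'"
      using p(1,3) unfolding P1_def by blast
    have "\<forall>x. a *\<^sub>R p x + b *\<^sub>R p' x = (a *\<^sub>R g + b *\<^sub>R g') \<bullet> x + (a * c + b * c')"
      by (simp add: * inner_add_left algebra_simps)
    then have "(\<lambda>x. a *\<^sub>R p x + b *\<^sub>R p' x) \<in> P1" unfolding P1_def by blast
    then show ?thesis using ae_eq_lincomb[OF p(2,4)] by blast
  qed
  moreover have "(\<lambda>x. a *\<^sub>R u x + b *\<^sub>R v x) \<in> L2 \<Omega>"
    using u v by (intro L2_lincomb) (auto simp: dg_space_def)
  ultimately show "(\<lambda>x. a *\<^sub>R u x + b *\<^sub>R v x) \<in> dg_space \<Omega> T" unfolding dg_space_def by blast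
qed

text \<open>The integral over an element is the inner product with the constant one on its interior,
  where linearity of the weak divergence almost everywhere suffices.\<close>

lemma element_divergence_lincomb:
  assumes \<Omega>: "polygonal_domain \<Omega>" and mesh: "conforming_mesh \<Omega> T" and K: "K \<in> T"
    and p: "p \<in> Hdiv \<Omega>" and q: "q \<in> Hdiv \<Omega>"
  shows "(LINT x|lebesgue_on K. weak_div \<Omega> (\<lambda>x. a *\<^sub>R p x + b *\<^sub>R q x) x) =
    a * (LINT x|lebesgue_on K. weak_div \<Omega> p x) + b * (LINT x|lebesgue_on K. weak_div \<Omega> q x)"
proof -
  note \<Omega>D = polygonal_domainD[OF \<Omega>]
  obtain C g c where KC: "mesh_simplex K C g c" using mesh_simplex_exists[OF mesh K] .
  let ?K = "interior K"
  have KO: "?K \<subseteq> \<Omega>" by (rule mesh_interior_subset[OF \<Omega> mesh K])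
  have s: "?K \<in> sets lebesgue" by simp
  have L: "weak_div \<Omega> r \<in> L2 ?K" if "r \<in> Hdiv \<Omega>" for r
    by (rule L2_subset[OF weak_div_L2[OF that] KO \<Omega>D(4) s])
  have one: "(\<lambda>x. 1::real) \<in> L2 ?K"
  proof (rule bounded_L2)
    show "?K \<in> lmeasurable" using mesh_simplexD(3)[OF KC]
      by (intro bounded_set_imp_lmeasurable) (auto intro: bounded_subset[OF compact_imp_bounded interior_subset])
  qed auto
  have inner: "(LINT x|lebesgue_on K. weak_div \<Omega> r x) = L2_inner ?K (weak_div \<Omega> r) (\<lambda>x. 1)" if "r \<in> Hdiv \<Omega>" for r
    using integral_element_interior[OF KC L[OF that]] by (simp add: L2_inner_def)
  have pq: "(\<lambda>x. a *\<^sub>R p x + b *\<^sub>R q x) \<in> Hdiv \<Omega>" by (rule Hdiv_lincomb[OF \<Omega>D(1) p q])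
  have "L2_inner ?K (weak_div \<Omega> (\<lambda>x. a *\<^sub>R p x + b *\<^sub>R q x)) (\<lambda>x. 1) =
      L2_inner ?K (\<lambda>x. a *\<^sub>R weak_div \<Omega> p x + b *\<^sub>R weak_div \<Omega> q x) (\<lambda>x. 1)"
    by (intro L2_inner_cong ae_eq_subset[OF weak_div_lincomb[OF \<Omega>D(1) p q] KO \<Omega>D(4) s] ae_eq_refl
        L L2_lincomb pq p q one)
  also have "\<dots> = a * L2_inner ?K (weak_div \<Omega> p) (\<lambda>x. 1) + b * L2_inner ?K (weak_div \<Omega> q) (\<lambda>x. 1)"
    by (intro L2_inner_lincomb_left L p q one)
  finally show ?thesis unfolding inner[OF pq] inner[OF p] inner[OF q] .
qed

lemma diff_as_lincomb: "(\<lambda>x. p x - q x) = (\<lambda>x. 1 *\<^sub>R p x + (- 1) *\<^sub>R (q x :: 'b::real_vector))"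
  by simp

theorem proposition4p1:
  fixes \<Omega> :: "(real^'d) set"
    and T :: "(real^'d) set set"
    and Km :: "(real^'d) set \<Rightarrow> (real^'d) set"
    and P P_train :: "(real^'p) set"
    and f :: "real^'d \<Rightarrow> real"
    and \<sigma> :: "real^'p \<Rightarrow> real^'d \<Rightarrow> real"
    and \<nu> \<delta> :: real
    and N :: "(real^'d \<Rightarrow> real) \<Rightarrow> real"
    and Vh :: "(real^'d \<Rightarrow> real) set"
    and a :: "real^'p \<Rightarrow> (real^'d \<Rightarrow> real) \<Rightarrow> (real^'d \<Rightarrow> real) \<Rightarrow> real"
    and a1 :: "(real^'d \<Rightarrow> real) \<Rightarrow> (real^'d \<Rightarrow> real) \<Rightarrow> real"
    and uh :: "real^'p \<Rightarrow> real^'d \<Rightarrow> real"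
    and uf :: "real^'d \<Rightarrow> real"
    and R :: "real^'p \<Rightarrow> (real^'d \<Rightarrow> real) \<Rightarrow> real^'d \<Rightarrow> real^'d"
    and R1 :: "(real^'d \<Rightarrow> real) \<Rightarrow> real^'d \<Rightarrow> real^'d"
    and tf :: "real^'d \<Rightarrow> real^'d"
    and m :: "nat \<Rightarrow> real^'p"
    and V :: "nat \<Rightarrow> (real^'d \<Rightarrow> real) set"
    and Q :: "nat \<Rightarrow> (real^'d \<Rightarrow> real^'d) set"
    and n :: nat
  assumes "CARD('d) \<in> {2, 3}"
    and "polygonal_domain \<Omega>"
    and "compact P"
    and "f \<in> L2 \<Omega>"
    and "\<forall>\<mu>\<in>P. \<sigma> \<mu> \<in> Linf \<Omega> \<and> uniformly_positive \<Omega> (\<sigma> \<mu>)"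
    and "conforming_mesh \<Omega> T"
    and "mesh_orientation T Km"
    and "\<forall>\<mu>\<in>P. bounded_face_traces T (\<sigma> \<mu>)"
    and "Vh = dg_space \<Omega> T"
    and "is_norm_on \<Omega> Vh N"
    and "\<nu> > 0"
    and "a = (\<lambda>\<mu>. dg_form T Km \<nu> (\<sigma> \<mu>))"
    and "a1 = dg_form T Km \<nu> (\<lambda>x. 1)"
    and "\<forall>\<mu>\<in>P. coercive_on Vh N (a \<mu>)"
    and "coercive_on Vh N a1"
    and "\<forall>\<mu>\<in>P. galerkin_solution Vh (a \<mu>) (L2_inner \<Omega> f) (uh \<mu>)"
    and "galerkin_solution Vh a1 (L2_inner \<Omega> f) uf"
    and "\<forall>\<mu>\<in>P. flux_reconstruction \<Omega> T Km \<nu> (\<sigma> \<mu>) (R \<mu>)"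
    and "flux_reconstruction \<Omega> T Km \<nu> (\<lambda>x. 1) R1"
    and "finite P_train" and "P_train \<subseteq> P" and "\<delta> > 0"
    and "tf = R1 uf"
    and "V = snapshot_space (\<lambda>k. uh (m k))"
    and "Q = snapshot_space (\<lambda>k x. R (m k) (uh (m k)) x - tf x)"
    and "greedy_steps P_train \<delta> (\<lambda>k \<mu>. error_estimator \<Omega> Vh N f (\<sigma> \<mu>) (a \<mu>) (V k)) m n"
    and "depends_separably \<Omega> P Vh Vh a"
  shows
    "(\<forall>\<mu>\<in>P.
        uniquely_solvable \<Omega> (V n) (a \<mu>) (L2_inner \<Omega> f) \<and>
        (\<forall>u. galerkin_solution (V n) (a \<mu>) (L2_inner \<Omega> f) u \<longrightarrow>
           uniquely_solvable \<Omega> (Q n) (hdiv_inner \<Omega>) (hdiv_inner \<Omega> (\<lambda>x. R \<mu> u x - tf x)) \<and>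
           (\<forall>\<pi>. galerkin_solution (Q n) (hdiv_inner \<Omega>) (hdiv_inner \<Omega> (\<lambda>x. R \<mu> u x - tf x)) \<pi> \<longrightarrow>
              (\<lambda>x. \<pi> x + tf x) \<in> Hdiv_mesh \<Omega> T f)))
     \<and> depends_separably \<Omega> P (V n) (V n) a
     \<and> depends_separably \<Omega> P (V n) (Q n) (\<lambda>\<mu> v q. hdiv_inner \<Omega> (R \<mu> v) q)
     \<and> (\<forall>\<mu>\<in>P. \<forall>v\<in>V n. \<forall>q\<in>Q n.
          hdiv_inner \<Omega> (\<lambda>x. R \<mu> v x - tf x) q = hdiv_inner \<Omega> (R \<mu> v) q - hdiv_inner \<Omega> tf q)
     \<and> parameter_independent P (\<lambda>\<mu>. restrict (\<lambda>w. L2_inner \<Omega> f w) (V n))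
     \<and> parameter_independent P (\<lambda>\<mu>. restrict (\<lambda>q. hdiv_inner \<Omega> tf q) (Q n))
     \<and> parameter_independent P (\<lambda>\<mu>. restrict (\<lambda>(p, q). hdiv_inner \<Omega> p q) (Q n \<times> Q n))
     \<and> parameter_independent P (\<lambda>\<mu>. tf)"
proof -
  note \<Omega> = \<open>polygonal_domain \<Omega>\<close> and mesh = \<open>conforming_mesh \<Omega> T\<close> and orient = \<open>mesh_orientation T Km\<close>
    and f = \<open>f \<in> L2 \<Omega>\<close> and Vh = \<open>Vh = dg_space \<Omega> T\<close> and N = \<open>is_norm_on \<Omega> Vh N\<close> and sep = \<open>depends_separably \<Omega> P Vh Vh a\<close>
  have coer: "coercive_on Vh N (a \<mu>)" if "\<mu> \<in> P" for \<mu> using assms(14) that by blast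
  have rec: "flux_reconstruction \<Omega> T Km \<nu> (\<sigma> \<mu>) (R \<mu>)" if "\<mu> \<in> P" for \<mu> using assms(18) that by blast
  note \<Omega>D = polygonal_domainD[OF \<Omega>]
  define s where "s = (\<lambda>k. uh (m k))"
  define t where "t = (\<lambda>k x. R (m k) (uh (m k)) x - tf x)"
  have V: "V n = snapshot_space s n" and Q: "Q n = snapshot_space t n"
    using assms(24,25) by (simp_all add: s_def t_def)
  have lin_Vh: "lin_closed Vh" unfolding Vh by (rule lin_closed_dg_space)
  have Vh_L2: "Vh \<subseteq> L2 \<Omega>" by (auto simp: Vh dg_space_def)
  have R_rt: "R \<mu> v \<in> rt_space \<Omega> T" if "\<mu> \<in> P" "v \<in> Vh" for \<mu> v
    using rec[OF that(1)] that(2) by (simp add: flux_reconstruction_def Vh)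
  have R_Hdiv: "R \<mu> v \<in> Hdiv \<Omega>" if "\<mu> \<in> P" "v \<in> Vh" for \<mu> v
    using R_rt[OF that] by (simp add: rt_space_def)
  have tf_mesh: "tf \<in> Hdiv_mesh \<Omega> T f"
    unfolding \<open>tf = R1 uf\<close>
    by (rule flux_reconstruction_locally_conservative[OF \<Omega> mesh orient f _ assms(19)])
      (use assms(17) in \<open>simp add: Vh assms(13)\<close>)
  then have tf: "tf \<in> Hdiv \<Omega>" by (simp add: Hdiv_mesh_def)
  have R_mesh: "R \<mu> (uh \<mu>) \<in> Hdiv_mesh \<Omega> T f" if "\<mu> \<in> P" for \<mu>
    by (rule flux_reconstruction_locally_conservative[OF \<Omega> mesh orient f _ rec[OF that]])
      (use assms(16) that in \<open>simp add: Vh assms(12)\<close>)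
  \<comment> \<open>The greedy maximisers belong to the training set, which is contained in
    \<open>P\<close>.\<close>
  have mP: "m k \<in> P" if "k \<in> {1..n}" for k
    using assms(21,26) that by (auto simp: greedy_steps_def is_arg_max_def)
  have s_Vh: "s k \<in> Vh" if "k \<in> {1..n}" for k
    using assms(16) mP[OF that] by (simp add: s_def galerkin_solution_def)
  have VVh: "V n \<subseteq> Vh" unfolding V by (rule snapshot_space_subset[OF lin_Vh s_Vh])
  \<comment> \<open>Local conservation with right-hand side \<open>f\<close> is an affine condition.
    \<open>Z\<close> is the associated linear space, so \<open>snapshot_space_subset\<close> applies
    to the differences with \<open>tf\<close>.\<close>
  define Z where "Z = {q \<in> Hdiv \<Omega>. \<forall>K\<in>T. (LINT x|lebesgue_on K. weak_div \<Omega> q x) = 0}"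
  have lin_Hdiv: "lin_closed (Hdiv \<Omega>)"
    unfolding lin_closed_def using zero_Hdiv Hdiv_lincomb \<Omega>D(1) by blast
  have lin_Z: "lin_closed Z"
    unfolding lin_closed_def
  proof (intro conjI ballI allI)
    have "(LINT x|lebesgue_on K. weak_div \<Omega> (\<lambda>x. 0) x) = 0" if "K \<in> T" for K
      using element_divergence_lincomb[OF \<Omega> mesh that zero_Hdiv[OF \<Omega>D(1)] zero_Hdiv[OF \<Omega>D(1)], of 0 0] by simp
    then show "(\<lambda>x. 0) \<in> Z" using zero_Hdiv[OF \<Omega>D(1)] by (simp add: Z_def)
    fix p q a b assume "p \<in> Z" "q \<in> Z"
    then show "(\<lambda>x. a *\<^sub>R p x + b *\<^sub>R q x) \<in> Z"
      using element_divergence_lincomb[OF \<Omega> mesh, of _ p q a b] Hdiv_lincomb[OF \<Omega>D(1), of p q a b]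
      by (simp add: Z_def)
  qed
  have t_Z: "t k \<in> Z" if k: "k \<in> {1..n}" for k
  proof -
    let ?p = "R (m k) (uh (m k))"
    have p: "?p \<in> Hdiv_mesh \<Omega> T f" by (rule R_mesh[OF mP[OF k]])
    have "t k = (\<lambda>x. 1 *\<^sub>R ?p x + (- 1) *\<^sub>R tf x)" by (simp add: t_def)
    then show ?thesis
      using element_divergence_lincomb[OF \<Omega> mesh _ _ tf, of _ ?p 1 "- 1"] Hdiv_lincomb[OF \<Omega>D(1) _ tf, of ?p 1 "- 1"]
        p tf_mesh by (simp add: Z_def Hdiv_mesh_def)
  qed
  have QZ: "Q n \<subseteq> Z" unfolding Q by (rule snapshot_space_subset[OF lin_Z t_Z])
  then have QH: "Q n \<subseteq> Hdiv \<Omega>" by (auto simp: Z_def)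
  have t_H: "t k \<in> Hdiv \<Omega>" if "k \<in> {1..n}" for k using t_Z[OF that] by (simp add: Z_def)
  have bil: "bilinear_form_on \<Omega> Vh Vh (a \<mu>)" if "\<mu> \<in> P" for \<mu>
    by (rule depends_separably_bilinear[OF sep that lin_Vh lin_Vh])
  have solvable_V: "uniquely_solvable \<Omega> (V n) (a \<mu>) (L2_inner \<Omega> f)" if \<mu>: "\<mu> \<in> P" for \<mu>
    unfolding V
  proof (rule uniquely_solvable_snapshot_space[OF bil[OF \<mu>] lin_Vh])
    fix v assume v: "v \<in> Vh" "a \<mu> v v = 0"
    obtain \<alpha> where "\<alpha> > 0" "\<alpha> * (N v)\<^sup>2 \<le> a \<mu> v v" using coer[OF \<mu>] v(1) unfolding coercive_on_def by blast
    then have "N v = 0" using v(2) by (simp add: mult_le_0_iff)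
    then show "ae_eq \<Omega> v (\<lambda>x. 0)" using N v(1) unfolding is_norm_on_def by blast
  next
    show "linear_form_on Vh (L2_inner \<Omega> f)"
      unfolding linear_form_on_def using L2_inner_lincomb_right[OF _ _ f] Vh_L2 by blast
  qed (use s_Vh Vh_L2 f L2_inner_ae_zero_right in blast)+
  have diff_H: "(\<lambda>x. R \<mu> u x - tf x) \<in> Hdiv \<Omega>" if "\<mu> \<in> P" "u \<in> Vh" for \<mu> u
    unfolding diff_as_lincomb by (rule Hdiv_lincomb[OF \<Omega>D(1) R_Hdiv[OF that] tf])
  have solvable_Q: "uniquely_solvable \<Omega> (Q n) (hdiv_inner \<Omega>) (hdiv_inner \<Omega> r)" if r: "r \<in> Hdiv \<Omega>" for r
    unfolding Q
  proof (rule uniquely_solvable_snapshot_space[OF bilinear_form_hdiv_inner[OF \<Omega>D(1)] lin_Hdiv hdiv_inner_self_zero t_H])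
    show "linear_form_on (Hdiv \<Omega>) (hdiv_inner \<Omega> r)"
      unfolding linear_form_on_def using hdiv_inner_lincomb_right[OF \<Omega>D(1) _ _ r] by blast
    fix v assume v: "v \<in> Hdiv \<Omega>" "ae_eq \<Omega> v (\<lambda>x. 0)"
    have "hdiv_inner \<Omega> r v = hdiv_inner \<Omega> r (\<lambda>x. 0)"
      by (rule hdiv_inner_cong[OF \<Omega>D(1) ae_eq_refl v(2) r r v(1) zero_Hdiv[OF \<Omega>D(1)]])
    also have "\<dots> = 0"
      using hdiv_inner_lincomb_right[OF \<Omega>D(1) zero_Hdiv[OF \<Omega>D(1)] zero_Hdiv[OF \<Omega>D(1)] r, of 0 0] by simp
    finally show "hdiv_inner \<Omega> r v = 0" .
  qed
  \<comment> \<open>Conservation is a property of the whole affine space \<open>tf + Q n\<close>;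
    the projection merely selects one of its elements.\<close>
  have conservative: "(\<lambda>x. \<pi> x + tf x) \<in> Hdiv_mesh \<Omega> T f" if \<pi>: "\<pi> \<in> Q n" for \<pi>
  proof -
    have "\<pi> \<in> Hdiv \<Omega>" "\<And>K. K \<in> T \<Longrightarrow> (LINT x|lebesgue_on K. weak_div \<Omega> \<pi> x) = 0"
      using \<pi> QZ by (auto simp: Z_def)
    then show ?thesis
      using element_divergence_lincomb[OF \<Omega> mesh _ _ tf, of _ \<pi> 1 1] Hdiv_lincomb[OF \<Omega>D(1) _ tf, of \<pi> 1 1] tf_mesh
      by (simp add: Hdiv_mesh_def)
  qed
  have "depends_separably \<Omega> P (V n) (V n) a"
    by (rule depends_separably_subset[OF sep VVh VVh])
  \<comment> \<open>For each fixed \<mu> the map \<open>R \<mu>\<close> is linear modulo null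
    functions, which makes the flux form bilinear; the decomposition in \<mu> comes from the finite
    dimension of both spaces.\<close>
  moreover have "depends_separably \<Omega> P (V n) (Q n) (\<lambda>\<mu> v q. hdiv_inner \<Omega> (R \<mu> v) q)"
    unfolding V Q
  proof (rule depends_separably_finite_dimensional)
    show "s k \<in> L2 \<Omega>" "t k \<in> L2 \<Omega>" if "k \<in> {1..n}" for k
      using s_Vh[OF that] Vh_L2 Hdiv_L2[OF t_H[OF that]] by auto
    fix \<mu> assume \<mu>: "\<mu> \<in> P"
    have op: "linear_operator_on \<Omega> Vh (R \<mu>)"
      using rec[OF \<mu>] by (simp add: flux_reconstruction_def Vh)
    show "bilinear_form_on \<Omega> (snapshot_space s n) (snapshot_space t n) (\<lambda>v q. hdiv_inner \<Omega> (R \<mu> v) q)"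
      unfolding V[symmetric] Q[symmetric] bilinear_form_on_def
    proof (intro conjI ballI allI impI)
      fix v v' q q' assume *: "v \<in> V n" "v' \<in> V n" "q \<in> Q n" "q' \<in> Q n" "ae_eq \<Omega> v v'" "ae_eq \<Omega> q q'"
      then have Vs: "v \<in> Vh" "v' \<in> Vh" using VVh by auto
      then have "ae_eq \<Omega> (R \<mu> v) (R \<mu> v')" using op *(5) unfolding linear_operator_on_def by blast
      then show "hdiv_inner \<Omega> (R \<mu> v) q = hdiv_inner \<Omega> (R \<mu> v') q'"
        using * Vs QH by (intro hdiv_inner_cong[OF \<Omega>D(1)] R_Hdiv[OF \<mu>]) auto
    next
      fix v v' q and \<alpha> \<beta> :: real assume *: "v \<in> V n" "v' \<in> V n" "q \<in> Q n"
      then have Vs: "v \<in> Vh" "v' \<in> Vh" "q \<in> Hdiv \<Omega>" using VVh QH by auto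
      let ?w = "\<lambda>x. \<alpha> *\<^sub>R v x + \<beta> *\<^sub>R v' x"
      have w: "?w \<in> Vh" by (rule lin_closedD[OF lin_Vh Vs(1,2)])
      have "ae_eq \<Omega> (R \<mu> ?w) (\<lambda>x. \<alpha> *\<^sub>R R \<mu> v x + \<beta> *\<^sub>R R \<mu> v' x)"
        using op Vs unfolding linear_operator_on_def by blast
      then have "hdiv_inner \<Omega> (R \<mu> ?w) q = hdiv_inner \<Omega> (\<lambda>x. \<alpha> *\<^sub>R R \<mu> v x + \<beta> *\<^sub>R R \<mu> v' x) q"
        by (rule hdiv_inner_cong[OF \<Omega>D(1) _ ae_eq_refl R_Hdiv[OF \<mu> w]
            Hdiv_lincomb[OF \<Omega>D(1) R_Hdiv[OF \<mu> Vs(1)] R_Hdiv[OF \<mu> Vs(2)]] Vs(3) Vs(3)])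
      also have "\<dots> = \<alpha> * hdiv_inner \<Omega> (R \<mu> v) q + \<beta> * hdiv_inner \<Omega> (R \<mu> v') q"
        by (rule hdiv_inner_lincomb_left[OF \<Omega>D(1) R_Hdiv[OF \<mu> Vs(1)] R_Hdiv[OF \<mu> Vs(2)] Vs(3)])
      finally show "hdiv_inner \<Omega> (R \<mu> ?w) q = \<alpha> * hdiv_inner \<Omega> (R \<mu> v) q + \<beta> * hdiv_inner \<Omega> (R \<mu> v') q" .
    next
      fix v q q' and \<alpha> \<beta> :: real assume *: "v \<in> V n" "q \<in> Q n" "q' \<in> Q n"
      then have "v \<in> Vh" "q \<in> Hdiv \<Omega>" "q' \<in> Hdiv \<Omega>" using VVh QH by auto
      then show "hdiv_inner \<Omega> (R \<mu> v) (\<lambda>x. \<alpha> *\<^sub>R q x + \<beta> *\<^sub>R q' x) =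
          \<alpha> * hdiv_inner \<Omega> (R \<mu> v) q + \<beta> * hdiv_inner \<Omega> (R \<mu> v) q'"
        by (intro hdiv_inner_lincomb_right[OF \<Omega>D(1)] R_Hdiv[OF \<mu>])
    qed
  qed
  moreover have "hdiv_inner \<Omega> (\<lambda>x. R \<mu> v x - tf x) q = hdiv_inner \<Omega> (R \<mu> v) q - hdiv_inner \<Omega> tf q"
    if "\<mu> \<in> P" "v \<in> V n" "q \<in> Q n" for \<mu> v q
  proof -
    have "v \<in> Vh" "q \<in> Hdiv \<Omega>" using that VVh QH by auto
    then show ?thesis
      unfolding diff_as_lincomb
      using hdiv_inner_lincomb_left[OF \<Omega>D(1) R_Hdiv[OF that(1)] tf, of v q 1 "- 1"] by simp
  qed
  moreover have "uniquely_solvable \<Omega> (Q n) (hdiv_inner \<Omega>) (hdiv_inner \<Omega> (\<lambda>x. R \<mu> u x - tf x))"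
    if "\<mu> \<in> P" "galerkin_solution (V n) (a \<mu>) (L2_inner \<Omega> f) u" for \<mu> u
    using that VVh by (intro solvable_Q diff_H) (auto simp: galerkin_solution_def)
  moreover have "(\<lambda>x. \<pi> x + tf x) \<in> Hdiv_mesh \<Omega> T f"
    if "galerkin_solution (Q n) (hdiv_inner \<Omega>) l \<pi>" for l \<pi>
    using that conservative by (simp add: galerkin_solution_def)
  ultimately show ?thesis
    using solvable_V by (simp add: parameter_independent_def)
qed

end
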